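(* Let $p>6$. Suppose $u_0\in C^3(\mathbb{R}^3)$, $u_1\in C^2(\mathbb{R}^3)$ are real-valued with finite energy $$\int_{\mathbb{R}^3}\left(\frac{|u_1|^2+|\nabla u_0|^2}{2}+\frac{|u_0|^6}{6}\right)dx<\infty,$$ and suppose that the solution $u^{(0)}$ of the homogeneous wave equation $u^{(0)}_{tt}-\Delta u^{(0)}=0$ in $\mathbb{R}^3\times[0,\infty)$ with initial data $u^{(0)}|_{t=0}=u_0$, $u^{(0)}_t|_{t=0}=u_1$ is uniformly bounded on $\mathbb{R}^3\times[0,\infty)$. Then there exists $\varepsilon_0>0$ such that for all $\varepsilon\in\mathbb{R}$ with $|\varepsilon|<\varepsilon_0$ the initial value problem $$u_{tt}-\Delta u+u^5+u|u|^{p-2}=0\quad\text{in }\mathbb{R}^3\times[0,\infty),\qquad u|_{t=0}=\varepsilon u_0,\quad u_t|_{t=0}=\varepsilon u_1,$$ admits a global $C^2$-solution $u\in C^2\bigl(\mathbb{R}^3\times[0,\infty)\bigr)$.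
   Context: Here $u=u(x,t)$ with $x\in\mathbb{R}^3$, $t\ge 0$; $u_t=\partial u/\partial t$; $\nabla$ and $\Delta$ are the gradient and Laplacian in the space variables. *)

theory Defs
  imports "HOL-Analysis.Analysis"
begin

text \<open>
  \<open>C_k_on k S f\<close>: \<open>f\<close> is of class \<open>C\<^sup>k\<close> on \<open>S\<close>. Derivatives are taken within \<open>S\<close>, so for
  \<open>S = UNIV \<times> {0..}\<close> they are one-sided in the last variable at boundary points; there, as for
  \<open>S = UNIV\<close>, the derivative within \<open>S\<close> is unique, so \<open>frechet_derivative\<close> denotes it. Since the
  space is finite-dimensional, continuity of \<open>x \<mapsto> Df(x) v\<close> for each \<open>v\<close> is continuity of \<open>Df\<close>.
\<close>

fun C_k_on :: "nat \<Rightarrow> 'a::euclidean_space set \<Rightarrow> ('a \<Rightarrow> real) \<Rightarrow> bool" where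
  "C_k_on 0 S f \<longleftrightarrow> continuous_on S f"
| "C_k_on (Suc k) S f \<longleftrightarrow> f differentiable_on S \<and>
     (\<forall>v. C_k_on k S (\<lambda>x. frechet_derivative f (at x within S) v))"

definition partial_deriv :: "'a::euclidean_space \<Rightarrow> ('a \<Rightarrow> real) \<Rightarrow> 'a \<Rightarrow> real" where
  "partial_deriv b f x = deriv (\<lambda>s. f (x + s *\<^sub>R b)) 0"

definition gradient :: "('a::euclidean_space \<Rightarrow> real) \<Rightarrow> 'a \<Rightarrow> 'a" where
  "gradient f x = (\<Sum>b\<in>Basis. partial_deriv b f x *\<^sub>R b)"

definition laplacian :: "('a::euclidean_space \<Rightarrow> real) \<Rightarrow> 'a \<Rightarrow> real" where
  "laplacian f x = (\<Sum>b\<in>Basis. partial_deriv b (partial_deriv b f) x)"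

text \<open>
  Time derivative on \<open>[0,\<infinity>)\<close>, one-sided at \<open>t = 0\<close>; only meaningful for \<open>t \<ge> 0\<close>.
\<close>

definition time_deriv :: "('a \<Rightarrow> real \<Rightarrow> real) \<Rightarrow> 'a \<Rightarrow> real \<Rightarrow> real" where
  "time_deriv u x t = vector_derivative (u x) (at t within {0..})"

end

theory Submission
  imports Defs "HOL-Probability.Probability_Measure" "HOL-Real_Asymp.Real_Asymp"
begin

text \<open>
  The solution is sought as a fixed point of Duhamel's formula. Let \<open>w\<close> be the given free solution and
  write \<open>\<Phi> F\<close> for the solution of the inhomogeneous wave equation with right-hand side \<open>F\<close> and zero
  initial data, an integral of \<open>F\<close> over the backward light cone. The nonlinearity
  \<open>f v = v^5 + v |v|^(p-2)\<close> is replaced by \<open>k = f \<circ> cutoff\<close>, where the cutoff is the identity on \<open>[-1, 1]\<close> and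
  bounded, and \<open>u = \<epsilon> w - \<Phi> (k \<circ> u)\<close> is solved globally in time. Then \<open>|u| \<le> 1\<close> is shown everywhere for
  small \<open>\<epsilon>\<close>, so that \<open>k u = f u\<close> and \<open>u\<close> solves the original problem.

  \<^bold>\<open>Existence and regularity\<close> (\<open>wave_C2_solution\<close>). Since \<open>k\<close> is globally Lipschitz, Picard iteration with an
  exponential weight in time converges, together with first derivatives, on every compact domain of
  dependence. In rescaled coordinates \<open>\<Phi> F (z)\<close> is \<open>t^2\<close> times
  a weighted average of \<open>F \<circ> A\<close> over linear maps \<open>A\<close>. Therefore the derivative \<open>(z, h) \<mapsto> Du(z) h\<close>
  solves an equation of the same kind on the tangent space, and applying the C1 theory to it gives
  second derivatives. The locale \<open>averaging\<close> is set up to cover both cases.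

  \<^bold>\<open>The wave equation\<close> (\<open>duhamel_solves_wave\<close>). That \<open>\<Phi> F\<close> solves the wave equation rests on the Darboux equation for
  spherical means. The mean over the sphere is the mean over the directions of a uniform point
  in the ball; it is invariant under rotations. Differentiating this invariance twice shows that
  the Laplace-Beltrami operator, which is the sum of the squares of the rotation fields, has mean
  zero, and that is the Darboux equation.

  \<^bold>\<open>The bound\<close> (\<open>cone_energy_flux\<close>, \<open>duhamel_bound\<close>). Let \<open>P\<close> be the antiderivative of \<open>k\<close> with \<open>P 0 = 0\<close>. The energy
  identity on the region below a backward cone bounds the integral of \<open>P u\<close> over its mantle by the
  energy of the initial data, which is \<open>O(\<epsilon>^2)\<close>. With \<open>\<theta> = |cutoff u|\<close> one has \<open>\<theta>^6 \<le> 6 P u\<close> and \<open>|k u| \<le> C \<theta>^5\<close>, while \<open>\<theta> \<le> 3\<close>.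
  Kirchhoff's formula bounds \<open>\<Phi> (k \<circ> u)\<close> by the integral of \<open>r \<theta>^5\<close> over the radius \<open>r\<close> and the sphere, and
  for every \<open>\<delta> > 0\<close> there is \<open>\<mu> > 0\<close> with \<open>r \<theta>^5 \<le> r^2 \<theta>^6 / \<mu> + \<delta> / (1 + r^2)\<close>. The first term is controlled by
  the flux and the second has a small integral over all radii. Hence
  \<open>|\<Phi> (k \<circ> u)| \<le> B \<epsilon>^2 + 1/4\<close> with \<open>B\<close> independent of time.
\<close>

section \<open>Functions with continuous gradients\<close>

lemma continuous_on_UNIV_DERIV:
  fixes k :: "real \<Rightarrow> real"
  assumes "\<And>x. (k has_real_derivative k' x) (at x)"
  shows "continuous_on UNIV k"
  using assms by (meson DERIV_continuous_on has_field_derivative_at_within)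

text \<open>
  Gradients are kept as vectors instead of linear maps: uniform limits, bounds and integrals
  of derivatives are then those of vector valued functions.
\<close>

definition has_grad :: "('a::euclidean_space \<Rightarrow> real) \<Rightarrow> ('a \<Rightarrow> 'a) \<Rightarrow> 'a set \<Rightarrow> bool" where
  "has_grad f G S \<longleftrightarrow>
     (\<forall>z\<in>S. (f has_derivative (\<lambda>h. G z \<bullet> h)) (at z within S)) \<and> continuous_on S G"

definition C1 :: "'a set \<Rightarrow> ('a::euclidean_space \<Rightarrow> real) \<Rightarrow> bool" where
  "C1 S f \<longleftrightarrow> (\<exists>G. has_grad f G S)"

lemma has_gradD:
  assumes "has_grad f G S"
  shows "z \<in> S \<Longrightarrow> (f has_derivative (\<lambda>h. G z \<bullet> h)) (at z within S)"
    and "continuous_on S G" and "continuous_on S f"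
  using assms unfolding has_grad_def
  by (auto intro: has_derivative_continuous_on)

lemma has_grad_cong:
  assumes "has_grad f G S" "\<And>z. z \<in> S \<Longrightarrow> g z = f z"
  shows "has_grad g G S"
  using assms unfolding has_grad_def by (metis has_derivative_transform)

lemma has_grad_const: "has_grad (\<lambda>z. c) (\<lambda>z. 0) S"
  by (auto simp: has_grad_def)

lemma has_grad_inner: "has_grad (\<lambda>z. v \<bullet> z) (\<lambda>z. v) S"
  by (auto simp: has_grad_def intro!: derivative_eq_intros)

lemma has_grad_add:
  assumes "has_grad f F S" "has_grad g G S"
  shows "has_grad (\<lambda>z. f z + g z) (\<lambda>z. F z + G z) S"
  using assms unfolding has_grad_def
  by (auto intro!: derivative_eq_intros continuous_intros simp: inner_add_left)

lemma has_grad_diff: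
  assumes "has_grad f F S" "has_grad g G S"
  shows "has_grad (\<lambda>z. f z - g z) (\<lambda>z. F z - G z) S"
  using assms unfolding has_grad_def
  by (auto intro!: derivative_eq_intros continuous_intros simp: inner_diff_left)

lemma has_grad_mult:
  assumes f: "has_grad f F S" and g: "has_grad g G S"
  shows "has_grad (\<lambda>z. f z * g z) (\<lambda>z. f z *\<^sub>R G z + g z *\<^sub>R F z) S"
  using has_gradD[OF f] has_gradD[OF g] unfolding has_grad_def
  by (auto intro!: derivative_eq_intros continuous_intros simp: inner_add_left)

lemma has_grad_compose:
  assumes f: "has_grad f F S" and k: "\<And>x. (k has_real_derivative k' x) (at x)"
    and k': "continuous_on UNIV k'"
  shows "has_grad (\<lambda>z. k (f z)) (\<lambda>z. k' (f z) *\<^sub>R F z) S"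
proof -
  have "((\<lambda>z. k (f z)) has_derivative (\<lambda>h. (k' (f z) *\<^sub>R F z) \<bullet> h)) (at z within S)" if "z \<in> S" for z
    using has_derivative_compose[OF has_gradD(1)[OF f that] k[of "f z", unfolded has_field_derivative_def]]
    by simp
  moreover have "continuous_on S (\<lambda>z. k' (f z))"
    using continuous_on_compose2[OF k' has_gradD(3)[OF f]] by auto
  ultimately show ?thesis
    using has_gradD(2)[OF f] by (auto simp: has_grad_def intro!: continuous_intros)
qed

lemma has_grad_affine_compose:
  fixes L :: "'b::euclidean_space \<Rightarrow> 'a::euclidean_space"
  assumes f: "has_grad f G S" and L: "bounded_linear L" and adj: "\<And>v h. v \<bullet> L h = L' v \<bullet> h"
    and L': "continuous_on UNIV L'" and T: "\<And>z. z \<in> T \<Longrightarrow> x0 + L z \<in> S"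
  shows "has_grad (\<lambda>z. f (x0 + L z)) (\<lambda>z. L' (G (x0 + L z))) T"
proof -
  have cL: "continuous_on T (\<lambda>z. x0 + L z)"
    using L by (intro continuous_intros) (simp add: linear_continuous_on)
  have "((\<lambda>z. f (x0 + L z)) has_derivative (\<lambda>h. L' (G (x0 + L z)) \<bullet> h)) (at z within T)" if "z \<in> T" for z
  proof -
    have "((\<lambda>z. x0 + L z) has_derivative L) (at z within T)"
      using has_derivative_add_const[OF bounded_linear_imp_has_derivative[OF L], of x0]
      by (simp add: add.commute)
    moreover have "(f has_derivative (\<lambda>h. G (x0 + L z) \<bullet> h)) (at (x0 + L z) within (\<lambda>z. x0 + L z) ` T)"
      by (rule has_derivative_subset[OF has_gradD(1)[OF f]]) (use T that in auto)
    ultimately have "((\<lambda>z. f (x0 + L z)) has_derivative (\<lambda>h. G (x0 + L z) \<bullet> L h)) (at z within T)"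
      by (rule has_derivative_in_compose)
    then show ?thesis by (simp add: adj)
  qed
  moreover have "continuous_on T (\<lambda>z. L' (G (x0 + L z)))"
    by (rule continuous_on_compose2[OF L' continuous_on_compose2[OF has_gradD(2)[OF f] cL]]) (use T in auto)
  ultimately show ?thesis by (simp add: has_grad_def)
qed

lemma has_grad_linear_compose:
  fixes L :: "'b::euclidean_space \<Rightarrow> 'a::euclidean_space"
  assumes "has_grad f G S" "bounded_linear L" "\<And>v h. v \<bullet> L h = L' v \<bullet> h"
    and "continuous_on UNIV L'" "L ` T \<subseteq> S"
  shows "has_grad (\<lambda>z. f (L z)) (\<lambda>z. L' (G (L z))) T"
  using has_grad_affine_compose[of f G S L L' T 0] assms by auto

lemma C1_const: "C1 S (\<lambda>z. c)"
  unfolding C1_def using has_grad_const by blast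
lemma C1_inner: "C1 S (\<lambda>z. v \<bullet> z)"
  unfolding C1_def using has_grad_inner by blast
lemma C1_add: "C1 S f \<Longrightarrow> C1 S g \<Longrightarrow> C1 S (\<lambda>z. f z + g z)"
  unfolding C1_def using has_grad_add by blast
lemma C1_diff: "C1 S f \<Longrightarrow> C1 S g \<Longrightarrow> C1 S (\<lambda>z. f z - g z)"
  unfolding C1_def using has_grad_diff by blast
lemma C1_mult: "C1 S f \<Longrightarrow> C1 S g \<Longrightarrow> C1 S (\<lambda>z. f z * g z)"
  unfolding C1_def using has_grad_mult by blast
lemma C1_compose:
  "C1 S f \<Longrightarrow> (\<And>x. (k has_real_derivative k' x) (at x)) \<Longrightarrow> continuous_on UNIV k' \<Longrightarrow> C1 S (\<lambda>z. k (f z))"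
  unfolding C1_def using has_grad_compose by blast
lemma C1_sum: "(\<And>i. i \<in> I \<Longrightarrow> C1 S (f i)) \<Longrightarrow> C1 S (\<lambda>z. \<Sum>i\<in>I. f i z)"
  by (induction I rule: infinite_finite_induct) (auto intro: C1_const C1_add)
lemma C1_cong: "C1 S f \<Longrightarrow> (\<And>z. z \<in> S \<Longrightarrow> g z = f z) \<Longrightarrow> C1 S g"
  unfolding C1_def using has_grad_cong by metis
lemma C1_continuous_on: "C1 S f \<Longrightarrow> continuous_on S f"
  unfolding C1_def using has_gradD(3) by metis

lemma has_grad_lipschitz:
  assumes f: "has_grad f G S" and "convex K" "K \<subseteq> S" and B: "\<And>z. z \<in> K \<Longrightarrow> norm (G z) \<le> B"
    and "x \<in> K" "y \<in> K"
  shows "\<bar>f x - f y\<bar> \<le> B * norm (x - y)"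
proof -
  have "norm (f x - f y) \<le> B * norm (x - y)"
  proof (rule differentiable_bound[OF \<open>convex K\<close> _ _ \<open>x \<in> K\<close> \<open>y \<in> K\<close>])
    show "(f has_derivative (\<lambda>h. G z \<bullet> h)) (at z within K)" if "z \<in> K" for z
      using has_gradD(1)[OF f] that \<open>K \<subseteq> S\<close> has_derivative_subset by blast
    show "onorm ((\<bullet>) (G z)) \<le> B" if "z \<in> K" for z
    proof (rule order_trans[OF _ B[OF that]], rule onorm_bound)
      show "norm (G z \<bullet> x) \<le> norm (G z) * norm x" for x
        by (simp add: Cauchy_Schwarz_ineq2)
    qed simp
  qed
  then show ?thesis by simp
qed

section \<open>Integrals depending on a parameter\<close>

lemma continuous_on_closed_bounded:
  fixes f :: "'a::euclidean_space \<Rightarrow> 'b::real_normed_vector"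
  assumes "continuous_on S f" "closed S"
  obtains B where "B > 0" "\<And>z. z \<in> S \<Longrightarrow> norm z \<le> R \<Longrightarrow> norm (f z) \<le> B"
proof -
  have "compact (S \<inter> cball 0 R)"
    using assms(2) by (simp add: closed_Int_compact)
  then have "compact (f ` (S \<inter> cball 0 R))"
    by (rule compact_continuous_image[rotated]) (rule continuous_on_subset[OF assms(1)], auto)
  then obtain B where "B > 0" "\<And>y. y \<in> f ` (S \<inter> cball 0 R) \<Longrightarrow> norm y \<le> B"
    using compact_imp_bounded bounded_pos by metis
  with that show thesis by auto
qed

lemma continuous_on_UNIV_bounded:
  fixes f :: "'a::euclidean_space \<Rightarrow> 'b::real_normed_vector"
  assumes "continuous_on UNIV f"
  obtains B where "B > 0" "\<And>z. norm z \<le> R \<Longrightarrow> norm (f z) \<le> B"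
  by (rule continuous_on_closed_bounded[OF assms closed_UNIV, of R]) simp

lemma continuous_on_integral_dominated:
  fixes q :: "'p \<Rightarrow> 'a::metric_space \<Rightarrow> 'b::{banach,second_countable_topology}"
  assumes fm: "finite_measure M"
    and meas: "\<And>z. z \<in> Z \<Longrightarrow> (\<lambda>p. q p z) \<in> borel_measurable M"
    and cont: "\<And>p. p \<in> space M \<Longrightarrow> continuous_on Z (q p)"
    and bound: "\<And>p z. p \<in> space M \<Longrightarrow> z \<in> Z \<Longrightarrow> norm (q p z) \<le> B"
  shows "continuous_on Z (\<lambda>z. \<integral>p. q p z \<partial>M)"
  unfolding continuous_on_sequentially
proof (intro allI ballI impI, elim conjE)
  interpret finite_measure M by fact
  fix X a assume a: "a \<in> Z" and X: "\<forall>n. X n \<in> Z" "X \<longlonglongrightarrow> a"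
  show "((\<lambda>z. \<integral>p. q p z \<partial>M) \<circ> X) \<longlonglongrightarrow> (\<integral>p. q p a \<partial>M)"
    unfolding comp_def
  proof (rule integral_dominated_convergence[where w="\<lambda>_. B"])
    show "AE p in M. (\<lambda>n. q p (X n)) \<longlonglongrightarrow> q p a"
    proof (rule AE_I2)
      fix p assume "p \<in> space M"
      from cont[OF this] show "(\<lambda>n. q p (X n)) \<longlonglongrightarrow> q p a"
        using X a unfolding continuous_on_sequentially comp_def by blast
    qed
  qed (use X a meas bound in auto)
qed

text \<open>
  The difference quotients of the integrand, minus the candidate derivative, tend to 0
  pointwise, and by the mean value inequality they are bounded by twice the bound on the
  gradients. Dominated convergence does the rest; convexity of the domain is what makes the
  mean value inequality available.
\<close>

lemma has_derivative_integral_dominated: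
  fixes q :: "'p \<Rightarrow> 'a::euclidean_space \<Rightarrow> real" and g :: "'p \<Rightarrow> 'a \<Rightarrow> 'a"
  assumes fm: "finite_measure M"
    and z: "z \<in> Z" and Z: "convex Z"
    and meas: "\<And>z. z \<in> Z \<Longrightarrow> (\<lambda>p. q p z) \<in> borel_measurable M"
    and gmeas: "(\<lambda>p. g p z) \<in> borel_measurable M"
    and deriv: "\<And>p z. p \<in> space M \<Longrightarrow> z \<in> Z \<Longrightarrow> (q p has_derivative (\<lambda>h. g p z \<bullet> h)) (at z within Z)"
    and bound: "\<And>p z. p \<in> space M \<Longrightarrow> z \<in> Z \<Longrightarrow> norm (g p z) \<le> B"
    and qbound: "\<And>p z. p \<in> space M \<Longrightarrow> z \<in> Z \<Longrightarrow> \<bar>q p z\<bar> \<le> B'"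
  shows "((\<lambda>z. \<integral>p. q p z \<partial>M) has_derivative (\<lambda>h. (\<integral>p. g p z \<partial>M) \<bullet> h)) (at z within Z)"
  unfolding has_derivative_within tendsto_at_iff_sequentially
proof (intro conjI allI impI)
  interpret finite_measure M by fact
  have iq: "integrable M (\<lambda>p. q p z)" if "z \<in> Z" for z
    by (rule integrable_const_bound[of _ B']) (use meas that qbound in auto)
  have ig: "integrable M (\<lambda>p. g p z)"
    by (rule integrable_const_bound[of _ B]) (use gmeas z bound in auto)
  show "bounded_linear ((\<bullet>) (\<integral>p. g p z \<partial>M))" by (rule bounded_linear_inner_right)
  fix X :: "nat \<Rightarrow> 'a" assume X: "\<forall>i. X i \<in> Z - {z}" "X \<longlonglongrightarrow> z"
  define r where "r n p = (1 / norm (X n - z)) * (q p (X n) - (q p z + g p z \<bullet> (X n - z)))" for n p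
  have XZ: "X n \<in> Z" "X n \<noteq> z" for n using X by auto
  have eq: "((\<lambda>y. (1 / norm (y - z)) *\<^sub>R ((\<integral>p. q p y \<partial>M) - ((\<integral>p. q p z \<partial>M) + (\<integral>p. g p z \<partial>M) \<bullet> (y - z)))) \<circ> X)
      = (\<lambda>n. \<integral>p. r n p \<partial>M)"
    unfolding r_def comp_def using iq[OF XZ(1)] iq[OF z] ig
    by (auto simp: fun_eq_iff)
  have "(\<lambda>n. \<integral>p. r n p \<partial>M) \<longlonglongrightarrow> (\<integral>p. 0 \<partial>M)"
  proof (rule integral_dominated_convergence[where w="\<lambda>_. 2 * B"])
    show "AE p in M. (\<lambda>n. r n p) \<longlonglongrightarrow> 0"
    proof (rule AE_I2)
      fix p assume "p \<in> space M"
      from deriv[OF this z] show "(\<lambda>n. r n p) \<longlonglongrightarrow> 0"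
        using X unfolding has_derivative_within tendsto_at_iff_sequentially r_def comp_def by auto
    qed
    show "AE p in M. norm (r n p) \<le> 2 * B" for n
    proof (rule AE_I2)
      fix p assume p: "p \<in> space M"
      have "norm (q p (X n) - q p z) \<le> B * norm (X n - z)"
      proof (rule differentiable_bound[OF Z _ _ XZ(1) z])
        show "(q p has_derivative (\<lambda>h. g p x \<bullet> h)) (at x within Z)" if "x \<in> Z" for x
          using deriv[OF p that] .
        show "onorm ((\<bullet>) (g p x)) \<le> B" if "x \<in> Z" for x
        proof (rule order_trans[OF _ bound[OF p that]], rule onorm_bound)
          show "norm (g p x \<bullet> y) \<le> norm (g p x) * norm y" for y
            by (simp add: Cauchy_Schwarz_ineq2)
        qed simp
      qed
      moreover have "\<bar>g p z \<bullet> (X n - z)\<bar> \<le> B * norm (X n - z)"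
        using Cauchy_Schwarz_ineq2[of "g p z" "X n - z"] bound[OF p z]
        by (meson mult_right_mono norm_ge_zero order_trans)
      ultimately have "\<bar>q p (X n) - (q p z + g p z \<bullet> (X n - z))\<bar> \<le> 2 * B * norm (X n - z)"
        by auto
      then show "norm (r n p) \<le> 2 * B"
        using XZ(2)[of n] by (auto simp: r_def abs_mult field_simps)
    qed
  qed (use meas XZ z gmeas in \<open>auto simp: r_def\<close>)
  then show "((\<lambda>y. (1 / norm (y - z)) *\<^sub>R ((\<integral>p. q p y \<partial>M) - ((\<integral>p. q p z \<partial>M) + (\<integral>p. g p z \<partial>M) \<bullet> (y - z)))) \<circ> X) \<longlonglongrightarrow> 0"
    unfolding eq by simp
qed

section \<open>Volterra equations over averaging families\<close>

lemma geometric_uniform_limit: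
  fixes f :: "nat \<Rightarrow> 'a \<Rightarrow> 'b::banach"
  assumes N: "\<And>n z. z \<in> K \<Longrightarrow> norm (f (Suc n) z - f n z) \<le> N * (3/4) ^ n"
  shows "uniform_limit K f (\<lambda>z. lim (\<lambda>n. f n z)) sequentially"
    and "z \<in> K \<Longrightarrow> norm (f n z) \<le> norm (f 0 z) + 4 * N"
proof -
  have eq: "f n z = f 0 z + (\<Sum>i<n. f (Suc i) z - f i z)" for n z
    using sum_lessThan_telescope[of "\<lambda>i. f i z" n] by simp
  have sm: "summable (\<lambda>n. N * (3/4::real) ^ n)" by (intro summable_mult summable_geometric) simp
  have "uniform_limit K (\<lambda>n z. \<Sum>i<n. f (Suc i) z - f i z) (\<lambda>z. suminf (\<lambda>i. f (Suc i) z - f i z)) sequentially"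
    by (rule Weierstrass_m_test[OF _ sm]) (use N in auto)
  then have "uniform_limit K (\<lambda>n z. f 0 z + (\<Sum>i<n. f (Suc i) z - f i z)) (\<lambda>z. f 0 z + suminf (\<lambda>i. f (Suc i) z - f i z)) sequentially"
    by (intro uniform_limit_intros)
  then have ul: "uniform_limit K f (\<lambda>z. f 0 z + suminf (\<lambda>i. f (Suc i) z - f i z)) sequentially"
    using eq by (metis (mono_tags, lifting) uniform_limit_cong')
  have "lim (\<lambda>n. f n z) = f 0 z + suminf (\<lambda>i. f (Suc i) z - f i z)" if "z \<in> K" for z
    using tendsto_uniform_limitI[OF ul that] by (rule limI)
  then show "uniform_limit K f (\<lambda>z. lim (\<lambda>n. f n z)) sequentially"
    using ul by (metis (mono_tags, lifting) uniform_limit_cong')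
  assume z: "z \<in> K"
  have "norm (f n z) \<le> norm (f 0 z) + norm (\<Sum>i<n. f (Suc i) z - f i z)"
    by (subst eq[of n]) (rule norm_triangle_ineq)
  also have "norm (\<Sum>i<n. f (Suc i) z - f i z) \<le> (\<Sum>i<n. N * (3/4) ^ i)"
    by (rule sum_norm_le) (use N z in auto)
  also have "\<dots> \<le> suminf (\<lambda>n. N * (3/4::real) ^ n)"
  proof (rule sum_le_suminf[OF sm])
    show "0 \<le> N * (3/4) ^ i" for i using order_trans[OF norm_ge_zero N[OF z]] .
  qed auto
  also have "\<dots> = 4 * N" by (subst suminf_mult) (auto simp: suminf_geometric intro!: summable_geometric)
  finally show "norm (f n z) \<le> norm (f 0 z) + 4 * N" by simp
qed

text \<open>
  A family of linear maps \<open>A p\<close>, averaged over a probability measure, that pulls every point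
  towards smaller times: the time \<open>e \<bullet> z\<close> of \<open>z\<close> shrinks by the factor \<open>1 - c p\<close>. The compact
  convex sets \<open>K R\<close> are mapped into themselves, so that all estimates may be made on one of
  them at a time. The model is the backward light cone: \<open>A p z\<close> is a point on the cone with
  vertex \<open>z\<close>, and \<open>K R\<close> is a domain of dependence. The same structure is used a second time,
  for points together with tangent vectors.
\<close>

locale averaging =
  fixes M :: "'p measure" and c :: "'p \<Rightarrow> real" and A :: "'p \<Rightarrow> 'a::euclidean_space \<Rightarrow> 'a"
    and e :: 'a and S :: "'a set" and K :: "real \<Rightarrow> 'a set" and C :: real
  assumes prob: "prob_space M"
    and c_meas [measurable]: "c \<in> borel_measurable M"
    and c_nonneg: "0 \<le> c p" and c_le: "c p \<le> 1"
    and A_linear: "linear (A p)"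
    and A_meas [measurable]: "(\<lambda>p. A p z) \<in> borel_measurable M"
    and A_bound: "norm (A p z) \<le> C * norm z"
    and A_time: "e \<bullet> A p z = (1 - c p) * (e \<bullet> z)"
    and A_K: "z \<in> K R \<Longrightarrow> A p z \<in> K R"
    and K_convex: "convex (K R)" and K_compact: "compact (K R)" and K_sub: "K R \<subseteq> S"
    and time_nonneg: "z \<in> S \<Longrightarrow> 0 \<le> e \<bullet> z" and time_le: "z \<in> K R \<Longrightarrow> e \<bullet> z \<le> R"
    and K_exhaust: "z \<in> S \<Longrightarrow> \<exists>R U. open U \<and> z \<in> U \<and> S \<inter> U \<subseteq> K R"
begin

sublocale prob_space M by (rule prob)

lemma c_norm_le: "norm v \<le> N \<Longrightarrow> c p * norm v \<le> N"
  using mult_mono[OF c_le[of p] _ _ norm_ge_zero, of v N] by simp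

definition avg :: "('a \<Rightarrow> real) \<Rightarrow> 'a \<Rightarrow> real" where
  "avg F z = (\<integral>p. c p * F (A p z) \<partial>M)"

text \<open>
  The gradient of a composition with \<open>A p\<close> is the adjoint of \<open>A p\<close> applied to the gradient, so
  this is how gradients are averaged.
\<close>

definition avg_adj :: "('a \<Rightarrow> 'a) \<Rightarrow> 'a \<Rightarrow> 'a" where
  "avg_adj F z = (\<integral>p. c p *\<^sub>R adjoint (A p) (F (A p z)) \<partial>M)"

lemma K_cases: assumes "z \<in> S" obtains R where "z \<in> K R"
  using K_exhaust[OF assms] assms by blast

lemma A_S: "z \<in> S \<Longrightarrow> A p z \<in> S"
  using A_K K_sub by (meson K_cases subsetD)

lemma C_nonneg: "0 \<le> C"
proof -
  obtain b :: 'a where "b \<in> Basis" using nonempty_Basis by blast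
  then have "0 \<le> C * norm b" using A_bound[of undefined b] norm_ge_zero order_trans by blast
  then show ?thesis using \<open>b \<in> Basis\<close> by simp
qed

lemma adjoint_bound: "norm (adjoint (A p) v) \<le> C * norm v"
proof -
  let ?w = "adjoint (A p) v"
  have "norm ?w ^ 2 = ?w \<bullet> ?w" by (simp add: power2_norm_eq_inner)
  also have "\<dots> = A p ?w \<bullet> v" by (rule adjoint_works[OF A_linear])
  also have "\<dots> \<le> norm (A p ?w) * norm v" by (rule norm_cauchy_schwarz)
  also have "\<dots> \<le> C * norm ?w * norm v" by (intro mult_right_mono A_bound) auto
  finally have "norm ?w * norm ?w \<le> norm ?w * (C * norm v)" by (simp add: power2_eq_square ac_simps)
  then show ?thesis using C_nonneg by (cases "norm ?w = 0") auto
qed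

lemma adjoint_measurable:
  assumes [measurable]: "F \<in> borel_measurable M"
  shows "(\<lambda>p. adjoint (A p) (F p)) \<in> borel_measurable M"
proof -
  have "adjoint (A p) (F p) = (\<Sum>b\<in>Basis. (A p b \<bullet> F p) *\<^sub>R b)" for p
    by (subst euclidean_representation[symmetric])
      (simp add: adjoint_works[OF A_linear, symmetric] inner_commute[of "adjoint (A p) (F p)"])
  then show ?thesis by simp
qed

lemma measurable_A:
  fixes F :: "'a \<Rightarrow> 'b::topological_space"
  assumes "continuous_on S F" "z \<in> S"
  shows "(\<lambda>p. F (A p z)) \<in> borel_measurable M"
proof (rule measurable_compose[of _ M "restrict_space borel S"])
  show "(\<lambda>p. A p z) \<in> M \<rightarrow>\<^sub>M restrict_space borel S"
    using A_S[OF assms(2)] by (intro measurable_restrict_space2) auto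
qed (rule borel_measurable_continuous_on_restrict[OF assms(1)])

lemma measurable_A_mult:
  assumes "continuous_on S F" "z \<in> K R"
  shows "(\<lambda>p. c p * F (A p z)) \<in> borel_measurable M"
  using measurable_A[OF assms(1), of z] assms(2) K_sub[of R] by auto

lemma measurable_A_adjoint:
  assumes "continuous_on S F" "z \<in> K R"
  shows "(\<lambda>p. c p *\<^sub>R adjoint (A p) (F (A p z))) \<in> borel_measurable M"
proof -
  have "z \<in> S" using assms(2) K_sub[of R] by auto
  note [measurable] = adjoint_measurable[OF measurable_A[OF assms(1) this]]
  show ?thesis by measurable
qed

lemma K_bound:
  fixes F :: "'a \<Rightarrow> 'b::real_normed_vector"
  assumes "continuous_on S F"
  obtains B where "B > 0" "\<And>z. z \<in> K R \<Longrightarrow> norm (F z) \<le> B"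
proof -
  have "bounded (F ` K R)"
    by (intro compact_imp_bounded compact_continuous_image K_compact continuous_on_subset[OF assms] K_sub)
  then show thesis using that unfolding bounded_pos by auto
qed

lemma local_at: assumes "z \<in> S" obtains R where "z \<in> K R" "at z within S = at z within K R"
proof -
  obtain R U where RU: "open U" "z \<in> U" "S \<inter> U \<subseteq> K R" using K_exhaust[OF assms] by blast
  have "at z within S = at z within K R"
    by (rule at_within_nhd[OF RU(2,1)]) (use RU K_sub in blast)
  then show thesis using that[of R] RU assms by auto
qed

lemma continuous_on_S:
  assumes "\<And>R. continuous_on (K R) f" shows "continuous_on S f"
  unfolding continuous_on_eq_continuous_within
proof
  fix z assume "z \<in> S"
  then obtain R where R: "z \<in> K R" "at z within S = at z within K R" by (rule local_at)
  then show "continuous (at z within S) f"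
    using assms[of R] unfolding continuous_on_eq_continuous_within by auto
qed

lemma has_derivative_S:
  assumes "\<And>R z. z \<in> K R \<Longrightarrow> (f has_derivative f' z) (at z within K R)" "z \<in> S"
  shows "(f has_derivative f' z) (at z within S)"
  by (metis assms local_at)

lemma avg_integrable:
  assumes "continuous_on S F" "z \<in> S"
  shows "integrable M (\<lambda>p. c p * F (A p z))"
proof -
  obtain R where R: "z \<in> K R" using K_cases[OF assms(2)] .
  obtain B where B: "B > 0" "\<And>z. z \<in> K R \<Longrightarrow> norm (F z) \<le> B" using K_bound[OF assms(1), of R] by blast
  note [measurable] = measurable_A[OF assms]
  show ?thesis
  proof (rule integrable_const_bound[of _ B])
    show "AE p in M. norm (c p * F (A p z)) \<le> B"
      using c_norm_le[OF B(2)[OF A_K[OF R]]] by (simp add: abs_mult c_nonneg)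
  qed simp
qed

lemma avg_adj_integrable:
  assumes "continuous_on S F" "z \<in> S"
  shows "integrable M (\<lambda>p. c p *\<^sub>R adjoint (A p) (F (A p z)))"
proof -
  obtain R where R: "z \<in> K R" using K_cases[OF assms(2)] .
  obtain B where B: "B > 0" "\<And>z. z \<in> K R \<Longrightarrow> norm (F z) \<le> B" using K_bound[OF assms(1), of R] by blast
  note [measurable] = adjoint_measurable[OF measurable_A[OF assms]]
  show ?thesis
  proof (rule integrable_const_bound[of _ "C * B"])
    show "AE p in M. norm (c p *\<^sub>R adjoint (A p) (F (A p z))) \<le> C * B"
      using c_norm_le[OF order_trans[OF adjoint_bound mult_left_mono[OF B(2)[OF A_K[OF R]] C_nonneg]]]
      by (simp add: c_nonneg)
  qed simp
qed

lemma avg_continuous: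
  assumes F: "continuous_on S F" shows "continuous_on S (avg F)"
proof (rule continuous_on_S)
  fix R
  obtain B where B: "B > 0" "\<And>z. z \<in> K R \<Longrightarrow> norm (F z) \<le> B" using K_bound[OF F, of R] by blast
  show "continuous_on (K R) (avg F)" unfolding avg_def
  proof (rule continuous_on_integral_dominated[where B=B])
    show "finite_measure M" by unfold_locales
    show "(\<lambda>p. c p * F (A p z)) \<in> borel_measurable M" if "z \<in> K R" for z
      using measurable_A_mult[OF F that] .
    show "continuous_on (K R) (\<lambda>z. c p * F (A p z))" for p
      by (intro continuous_intros continuous_on_compose2[OF F]
            linear_continuous_on linear_conv_bounded_linear[THEN iffD1, OF A_linear])
        (use A_S K_sub in auto)
    show "norm (c p * F (A p z)) \<le> B" if "z \<in> K R" for p z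
      using c_norm_le[OF B(2)[OF A_K[OF that]], of p p] by (simp add: abs_mult c_nonneg)
  qed
qed

lemma avg_adj_continuous:
  assumes F: "continuous_on S F" shows "continuous_on S (avg_adj F)"
proof (rule continuous_on_S)
  fix R
  obtain B where B: "B > 0" "\<And>z. z \<in> K R \<Longrightarrow> norm (F z) \<le> B" using K_bound[OF F, of R] by blast
  show "continuous_on (K R) (avg_adj F)" unfolding avg_adj_def
  proof (rule continuous_on_integral_dominated[where B="C * B"])
    show "finite_measure M" by unfold_locales
    show "(\<lambda>p. c p *\<^sub>R adjoint (A p) (F (A p z))) \<in> borel_measurable M" if "z \<in> K R" for z
      using measurable_A_adjoint[OF F that] .
    show "continuous_on (K R) (\<lambda>z. c p *\<^sub>R adjoint (A p) (F (A p z)))" for p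
    proof (intro continuous_intros)
      have "continuous_on (K R) (A p)"
        using A_linear[of p] by (simp add: linear_continuous_on linear_conv_bounded_linear)
      then have "continuous_on (K R) (\<lambda>z. F (A p z))"
        by (rule continuous_on_compose2[OF F]) (use A_S K_sub in auto)
      then show "continuous_on (K R) (\<lambda>z. adjoint (A p) (F (A p z)))"
        using A_linear[of p]
        by (intro bounded_linear.continuous_on[of "adjoint (A p)"])
          (simp_all add: adjoint_linear flip: linear_conv_bounded_linear)
    qed
    show "norm (c p *\<^sub>R adjoint (A p) (F (A p z))) \<le> C * B" if "z \<in> K R" for p z
      using c_norm_le[OF order_trans[OF adjoint_bound mult_left_mono[OF B(2)[OF A_K[OF that]] C_nonneg]], of p p]
      by (simp add: c_nonneg)
  qed
qed

lemma has_grad_A: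
  assumes "has_grad F G S"
  shows "has_grad (\<lambda>z. F (A p z)) (\<lambda>z. adjoint (A p) (G (A p z))) S"
proof (rule has_grad_linear_compose[OF assms])
  show "bounded_linear (A p)" using A_linear linear_conv_bounded_linear by blast
  show "v \<bullet> A p h = adjoint (A p) v \<bullet> h" for v h
    using adjoint_works[OF A_linear, of h p v] by (simp add: inner_commute)
  show "continuous_on UNIV (adjoint (A p))"
    by (intro linear_continuous_on linear_conv_bounded_linear[THEN iffD1] adjoint_linear A_linear)
qed (use A_S in auto)

lemma avg_has_grad:
  assumes F: "has_grad F G S" shows "has_grad (avg F) (avg_adj G) S"
  unfolding has_grad_def
proof
  show "continuous_on S (avg_adj G)" by (rule avg_adj_continuous[OF has_gradD(2)[OF F]])
  show "\<forall>z\<in>S. (avg F has_derivative (\<bullet>) (avg_adj G z)) (at z within S)"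
  proof (intro ballI has_derivative_S)
    fix R z assume z: "z \<in> K R"
    obtain B where B: "B > 0" "\<And>z. z \<in> K R \<Longrightarrow> norm (F z) \<le> B" using K_bound[OF has_gradD(3)[OF F], of R] by blast
    obtain B' where B': "B' > 0" "\<And>z. z \<in> K R \<Longrightarrow> norm (G z) \<le> B'" using K_bound[OF has_gradD(2)[OF F], of R] by blast
    show "(avg F has_derivative (\<bullet>) (avg_adj G z)) (at z within K R)"
      unfolding avg_def avg_adj_def
    proof (rule has_derivative_integral_dominated[where B="C * B'" and B'=B])
      show "finite_measure M" by unfold_locales
      show "z \<in> K R" "convex (K R)" using z K_convex by auto
      show "(\<lambda>p. c p * F (A p z)) \<in> borel_measurable M" if "z \<in> K R" for z
        using measurable_A_mult[OF has_gradD(3)[OF F] that] .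
      show "(\<lambda>p. c p *\<^sub>R adjoint (A p) (G (A p z))) \<in> borel_measurable M"
        using measurable_A_adjoint[OF has_gradD(2)[OF F] z] .
      show "norm (c p *\<^sub>R adjoint (A p) (G (A p z))) \<le> C * B'" if "z \<in> K R" for p z
        using c_norm_le[OF order_trans[OF adjoint_bound mult_left_mono[OF B'(2)[OF A_K[OF that]] C_nonneg]], of p p]
        by (simp add: c_nonneg)
      show "\<bar>c p * F (A p z)\<bar> \<le> B" if "z \<in> K R" for p z
        using c_norm_le[OF B(2)[OF A_K[OF that]], of p p] by (simp add: c_nonneg abs_mult)
      show "((\<lambda>z. c p * F (A p z)) has_derivative (\<lambda>h. (c p *\<^sub>R adjoint (A p) (G (A p z))) \<bullet> h)) (at z within K R)"
        if "z \<in> K R" for p z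
      proof -
        have "((\<lambda>z. F (A p z)) has_derivative (\<lambda>h. adjoint (A p) (G (A p z)) \<bullet> h)) (at z within K R)"
          using has_gradD(1)[OF has_grad_A[OF F, of p]] that K_sub has_derivative_subset by blast
        from has_derivative_mult_right[OF this, of "c p"] show ?thesis by simp
      qed
    qed
  qed
qed

lemma avg_mono:
  assumes "continuous_on S F" "continuous_on S F'" "z \<in> K R" "\<And>y. y \<in> K R \<Longrightarrow> F y \<le> F' y"
  shows "avg F z \<le> avg F' z"
  unfolding avg_def
  by (intro integral_mono avg_integrable mult_left_mono)
    (use assms K_sub A_K c_nonneg in auto)

lemma avg_cmult: "avg (\<lambda>z. x * F z) z = x * avg F z"
  unfolding avg_def by (subst integral_mult_right_zero[symmetric]) (simp add: ac_simps)

lemma avg_add: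
  assumes "continuous_on S F" "continuous_on S F'" "z \<in> S"
  shows "avg (\<lambda>z. F z + F' z) z = avg F z + avg F' z"
  unfolding avg_def using avg_integrable[OF assms(1,3)] avg_integrable[OF assms(2,3)]
  by (simp add: ring_distribs)

lemma avg_diff:
  assumes "continuous_on S F" "continuous_on S F'" "z \<in> S"
  shows "avg (\<lambda>z. F z - F' z) z = avg F z - avg F' z"
  unfolding avg_def using avg_integrable[OF assms(1,3)] avg_integrable[OF assms(2,3)]
  by (simp add: ring_distribs)

lemma avg_abs_le: "\<bar>avg F z\<bar> \<le> avg (\<lambda>z. \<bar>F z\<bar>) z"
  unfolding avg_def using integral_abs_bound[of M "\<lambda>p. c p * F (A p z)"]
  by (simp add: abs_mult c_nonneg)

lemma avg_le_const:
  assumes "continuous_on S F" "z \<in> K R" "\<And>y. y \<in> K R \<Longrightarrow> F y \<le> N" "0 \<le> N"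
  shows "avg F z \<le> N"
proof -
  have "avg F z \<le> (\<integral>p. N \<partial>M)" unfolding avg_def
  proof (rule integral_mono)
    show "integrable M (\<lambda>p. c p * F (A p z))" by (rule avg_integrable) (use assms K_sub in auto)
    show "c p * F (A p z) \<le> N" for p
    proof -
      have "c p * F (A p z) \<le> c p * N" using assms A_K c_nonneg by (intro mult_left_mono) auto
      also have "\<dots> \<le> 1 * N" using c_le assms(4) by (intro mult_right_mono) auto
      finally show ?thesis by simp
    qed
  qed simp
  then show ?thesis by (simp add: prob_space)
qed

lemma avg_adj_norm_le:
  assumes "continuous_on S F" "z \<in> S"
  shows "norm (avg_adj F z) \<le> C * avg (\<lambda>z. norm (F z)) z"
proof -
  have "norm (avg_adj F z) \<le> (\<integral>p. norm (c p *\<^sub>R adjoint (A p) (F (A p z))) \<partial>M)"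
    unfolding avg_adj_def by (rule integral_norm_bound)
  also have "\<dots> \<le> (\<integral>p. C * (c p * norm (F (A p z))) \<partial>M)"
  proof (rule integral_mono)
    show "integrable M (\<lambda>p. norm (c p *\<^sub>R adjoint (A p) (F (A p z))))"
      by (rule integrable_norm[OF avg_adj_integrable[OF assms]])
    show "integrable M (\<lambda>p. C * (c p * norm (F (A p z))))"
      by (rule integrable_mult_right[OF avg_integrable]) (use assms in \<open>auto intro!: continuous_intros\<close>)
    show "norm (c p *\<^sub>R adjoint (A p) (F (A p z))) \<le> C * (c p * norm (F (A p z)))" for p
      using mult_left_mono[OF adjoint_bound[of p "F (A p z)"] c_nonneg[of p]] c_nonneg[of p]
      by (simp add: ac_simps)
  qed
  finally show ?thesis unfolding avg_def by simp
qed

lemma avg_adj_diff: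
  assumes "continuous_on S F" "continuous_on S F'" "z \<in> S"
  shows "avg_adj (\<lambda>z. F z - F' z) z = avg_adj F z - avg_adj F' z"
proof -
  have "adjoint (A p) (v - w) = adjoint (A p) v - adjoint (A p) w" for p v w
    by (rule linear_diff[OF adjoint_linear[OF A_linear]])
  then show ?thesis
  unfolding avg_adj_def using avg_adj_integrable[OF assms(1,3)] avg_adj_integrable[OF assms(2,3)]
  by (simp add: scaleR_diff_right)
qed

text \<open>
  A Gronwall lemma in the form needed for iterations. Claim the bound \<open>N q^n exp (l t)\<close> at
  time \<open>t\<close>. The integral operator evaluates \<open>d n\<close> at times \<open>(1 - c p) t\<close>, which gains the
  factor \<open>exp (- l c t)\<close>, and \<open>x exp (-x) \<le> 1\<close> with \<open>x = l c t\<close> turns the kernel \<open>t^2 c\<close> into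
  at most \<open>R / l\<close>. For large \<open>l\<close> the integral term is therefore at most half of the claimed
  bound, the source term at most a quarter, and \<open>1/2 + 1/4 \<le> q\<close>. With \<open>q = 3/4\<close> this gives
  geometric decay, with \<open>q = 1\<close> uniform boundedness.
\<close>

lemma volterra_decay:
  assumes cont: "\<And>n. continuous_on S (d n)"
    and d0: "\<And>z. z \<in> K R \<Longrightarrow> d 0 z \<le> Z" and "0 \<le> b" "0 \<le> B" "0 \<le> R" "3/4 \<le> q"
    and step: "\<And>n z. z \<in> K R \<Longrightarrow> d (Suc n) z \<le> b * q ^ n + B * ((e \<bullet> z)\<^sup>2 * avg (d n) z)"
  shows "\<exists>N\<ge>0. \<forall>n. \<forall>z\<in>K R. d n z \<le> N * q ^ n"
proof -
  \<comment> \<open>With this weight, B R / l is at most 1/2.\<close>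
  define l where "l = 2 * B * R + 1"
  have l: "l > 0" using assms by (simp add: l_def add_nonneg_pos)
  \<comment> \<open>Large enough for d 0, and for b to be at most a quarter of it.\<close>
  define N where "N = max Z (4 * b)"
  have N: "0 \<le> N" "Z \<le> N" "b \<le> N / 4" using \<open>0 \<le> b\<close> by (auto simp: N_def)
  have q: "0 \<le> q" "0 \<le> q ^ n" for n using \<open>3/4 \<le> q\<close> by auto
  have "\<forall>z\<in>K R. d n z \<le> N * q ^ n * exp (l * (e \<bullet> z))" for n
  proof (induction n)
    case 0
    show ?case
    proof
      fix z assume z: "z \<in> K R"
      then have "0 \<le> e \<bullet> z" using time_nonneg K_sub by auto
      then have "N * 1 \<le> N * exp (l * (e \<bullet> z))" using N l by (intro mult_left_mono) auto
      then show "d 0 z \<le> N * q ^ 0 * exp (l * (e \<bullet> z))" using d0[OF z] N by simp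
    qed
  next
    case (Suc n)
    show ?case
    proof
      fix z assume z: "z \<in> K R"
      then have zS: "z \<in> S" using K_sub by auto
      define t where "t = e \<bullet> z"
      have t: "0 \<le> t" "t \<le> R" using time_nonneg[OF zS] time_le[OF z] by (auto simp: t_def)
      let ?E = "exp (l * t)"
      have E: "1 \<le> ?E" using t l by simp
      have "t\<^sup>2 * avg (d n) z = (\<integral>p. t\<^sup>2 * (c p * d n (A p z)) \<partial>M)"
        unfolding avg_def by simp
      also have "\<dots> \<le> (\<integral>p. N * q ^ n * (R / l) * ?E \<partial>M)"
      proof (rule integral_mono)
        show "integrable M (\<lambda>p. t\<^sup>2 * (c p * d n (A p z)))"
          by (intro integrable_mult_right avg_integrable cont zS)
        fix p
        define x where "x = l * (c p * t)"
        have x: "0 \<le> x" using l t c_nonneg by (auto simp: x_def)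
        have dl: "d n (A p z) \<le> N * q ^ n * exp (l * ((1 - c p) * t))"
          using Suc A_K[OF z, of p] A_time[of p z] by (auto simp: t_def)
        have xe: "x * exp (- x) \<le> 1"
        proof -
          have "x \<le> exp x" using exp_ge_add_one_self[of x] by linarith
          then show ?thesis by (simp add: exp_minus field_simps)
        qed
        have "t\<^sup>2 * (c p * d n (A p z)) \<le> t\<^sup>2 * (c p * (N * q ^ n * exp (l * ((1 - c p) * t))))"
          using dl c_nonneg by (intro mult_left_mono) auto
        also have "\<dots> = N * q ^ n * (t / l) * (x * exp (- x)) * ?E"
          using l by (simp add: x_def power2_eq_square field_simps flip: exp_add)
        also have "\<dots> \<le> N * q ^ n * (R / l) * 1 * ?E"
          using N q l t x xe by (intro mult_mono mult_nonneg_nonneg divide_right_mono) auto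
        finally show "t\<^sup>2 * (c p * d n (A p z)) \<le> N * q ^ n * (R / l) * ?E" by simp
      qed simp
      also have "\<dots> = N * q ^ n * (R / l) * ?E" by (simp add: prob_space)
      finally have "B * (t\<^sup>2 * avg (d n) z) \<le> B * (N * q ^ n * (R / l) * ?E)"
        using \<open>0 \<le> B\<close> by (rule mult_left_mono)
      also have "\<dots> = (B * R / l) * (N * q ^ n * ?E)" by simp
      also have "\<dots> \<le> (1/2) * (N * q ^ n * ?E)"
        using N q l by (intro mult_right_mono) (auto simp: l_def divide_le_eq)
      finally have 1: "B * (t\<^sup>2 * avg (d n) z) \<le> (1/2) * (N * q ^ n * ?E)" .
      have "b * q ^ n * 1 \<le> (N / 4) * q ^ n * ?E"
        using N q E by (intro mult_mono) auto
      with 1 step[OF z, of n] have "d (Suc n) z \<le> (3/4) * (N * q ^ n * ?E)"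
        by (simp add: t_def)
      also have "\<dots> \<le> q * (N * q ^ n * ?E)"
        using N q \<open>3/4 \<le> q\<close> by (intro mult_right_mono) auto
      finally show "d (Suc n) z \<le> N * q ^ Suc n * exp (l * (e \<bullet> z))"
        by (simp add: t_def ac_simps)
    qed
  qed
  moreover have "N * q ^ n * exp (l * (e \<bullet> z)) \<le> (N * exp (l * R)) * q ^ n" if "z \<in> K R" for n z
  proof -
    have "exp (l * (e \<bullet> z)) \<le> exp (l * R)" using time_le[OF that] l by auto
    then have "(N * q ^ n) * exp (l * (e \<bullet> z)) \<le> (N * q ^ n) * exp (l * R)"
      using N q by (intro mult_left_mono) auto
    then show ?thesis by (simp add: ac_simps)
  qed
  ultimately have "\<forall>n. \<forall>z\<in>K R. d n z \<le> (N * exp (l * R)) * q ^ n" by (meson order_trans)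
  then show ?thesis using N by (intro exI[of _ "N * exp (l * R)"]) auto
qed

end

context averaging begin

text \<open>
  For the light cone this is the solution of the inhomogeneous wave equation with zero initial
  data: the factor \<open>t^2\<close> and the weight \<open>c p\<close> together make up the kernel \<open>r dr\<close> of
  Kirchhoff's formula in the rescaled radius \<open>r = t c\<close>.
\<close>

definition duhamel :: "('a \<Rightarrow> real) \<Rightarrow> 'a \<Rightarrow> real" where
  "duhamel F z = (e \<bullet> z)\<^sup>2 * avg F z"

definition duhamel_grad :: "('a \<Rightarrow> real) \<Rightarrow> ('a \<Rightarrow> 'a) \<Rightarrow> 'a \<Rightarrow> 'a" where
  "duhamel_grad F G z = (2 * (e \<bullet> z) * avg F z) *\<^sub>R e + (e \<bullet> z)\<^sup>2 *\<^sub>R avg_adj G z"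

lemma duhamel_continuous: "continuous_on S F \<Longrightarrow> continuous_on S (duhamel F)"
  unfolding duhamel_def by (intro continuous_intros avg_continuous)

lemma duhamel_has_grad:
  assumes "has_grad F G S"
  shows "has_grad (duhamel F) (duhamel_grad F G) S"
proof -
  have "has_grad (\<lambda>z. ((e \<bullet> z) * (e \<bullet> z)) * avg F z)
     (\<lambda>z. ((e \<bullet> z) * (e \<bullet> z)) *\<^sub>R avg_adj G z + avg F z *\<^sub>R ((e \<bullet> z) *\<^sub>R e + (e \<bullet> z) *\<^sub>R e)) S"
    by (intro has_grad_mult has_grad_inner avg_has_grad assms)
  moreover have "(\<lambda>z. ((e \<bullet> z) * (e \<bullet> z)) * avg F z) = duhamel F"
    by (simp add: duhamel_def fun_eq_iff power2_eq_square)
  moreover have "(\<lambda>z. ((e \<bullet> z) * (e \<bullet> z)) *\<^sub>R avg_adj G z + avg F z *\<^sub>R ((e \<bullet> z) *\<^sub>R e + (e \<bullet> z) *\<^sub>R e)) = duhamel_grad F G"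
    by (simp add: duhamel_grad_def fun_eq_iff power2_eq_square algebra_simps flip: scaleR_add_left)
  ultimately show ?thesis by simp
qed

lemma duhamel_diff_le:
  assumes "continuous_on S F" "continuous_on S F'" "continuous_on S D" "z \<in> K R"
    and "\<And>y. y \<in> K R \<Longrightarrow> \<bar>F y - F' y\<bar> \<le> B * D y"
  shows "\<bar>duhamel F z - duhamel F' z\<bar> \<le> B * ((e \<bullet> z)\<^sup>2 * avg D z)"
proof -
  have z: "z \<in> S" using assms(4) K_sub by auto
  have "duhamel F z - duhamel F' z = (e \<bullet> z)\<^sup>2 * avg (\<lambda>z. F z - F' z) z"
    using avg_diff[OF assms(1,2) z] by (simp add: duhamel_def right_diff_distrib)
  moreover have "\<bar>avg (\<lambda>z. F z - F' z) z\<bar> \<le> avg (\<lambda>z. B * D z) z"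
    by (rule order_trans[OF avg_abs_le avg_mono])
      (use assms in \<open>auto intro!: continuous_intros\<close>)
  ultimately show ?thesis
    using mult_left_mono[of "\<bar>avg (\<lambda>z. F z - F' z) z\<bar>" "B * avg D z" "(e \<bullet> z)\<^sup>2"]
    by (simp add: abs_mult avg_cmult ac_simps)
qed

text \<open>
  The difference of two solutions, taken as a constant sequence, satisfies the hypotheses of
  the decay lemma with no source term, hence is bounded by \<open>N (3/4)^n\<close> for every \<open>n\<close>.
\<close>

lemma volterra_unique:
  assumes u: "continuous_on S u" and v: "continuous_on S v" and a: "continuous_on S a"
    and k: "continuous_on UNIV k" "\<And>x y. \<bar>k x - k y\<bar> \<le> L * \<bar>x - y\<bar>"
    and equ: "\<And>z. z \<in> S \<Longrightarrow> u z = g z - duhamel (\<lambda>z. a z * k (u z)) z"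
    and eqv: "\<And>z. z \<in> S \<Longrightarrow> v z = g z - duhamel (\<lambda>z. a z * k (v z)) z"
    and z: "z \<in> S"
  shows "u z = v z"
proof -
  obtain R where R: "z \<in> K R" using K_cases[OF z] .
  then have R0: "0 \<le> R" using time_nonneg[OF z] time_le[OF R] by simp
  have L: "0 \<le> L" using k(2)[of 1 0] by simp
  obtain Ab where Ab: "Ab > 0" "\<And>z. z \<in> K R \<Longrightarrow> norm (a z) \<le> Ab" using K_bound[OF a, of R] by blast
  have cd: "continuous_on S (\<lambda>z. \<bar>u z - v z\<bar>)" using u v by (intro continuous_intros)
  obtain N0 where N0: "\<And>z. z \<in> K R \<Longrightarrow> norm \<bar>u z - v z\<bar> \<le> N0" using K_bound[OF cd, of R] by blast
  have cont: "continuous_on S (\<lambda>z. a z * k (w z))" if "continuous_on S w" for w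
    using that by (intro continuous_intros a continuous_on_compose2[OF k(1)]) auto
  have "\<exists>N\<ge>0. \<forall>n. \<forall>z\<in>K R. \<bar>u z - v z\<bar> \<le> N * (3/4) ^ n"
  proof (rule volterra_decay[where b=0 and B="Ab * L" and d="\<lambda>n z. \<bar>u z - v z\<bar>" and Z=N0])
    fix y assume y: "y \<in> K R"
    then show "\<bar>u y - v y\<bar> \<le> N0" using N0 by force
    have "\<bar>u y - v y\<bar> = \<bar>duhamel (\<lambda>z. a z * k (u z)) y - duhamel (\<lambda>z. a z * k (v z)) y\<bar>"
      using equ[of y] eqv[of y] y K_sub[of R] by auto
    also have "\<dots> \<le> (Ab * L) * ((e \<bullet> y)\<^sup>2 * avg (\<lambda>z. \<bar>u z - v z\<bar>) y)"
    proof (rule duhamel_diff_le[OF cont[OF u] cont[OF v] cd y])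
      fix x assume "x \<in> K R"
      then have "\<bar>a x\<bar> * \<bar>k (u x) - k (v x)\<bar> \<le> Ab * (L * \<bar>u x - v x\<bar>)"
        using Ab k(2) L by (intro mult_mono) auto
      then show "\<bar>a x * k (u x) - a x * k (v x)\<bar> \<le> Ab * L * \<bar>u x - v x\<bar>"
        by (simp add: ac_simps flip: abs_mult right_diff_distrib)
    qed
    finally show "\<bar>u y - v y\<bar> \<le> 0 * (3/4) ^ n + Ab * L * ((e \<bullet> y)\<^sup>2 * avg (\<lambda>z. \<bar>u z - v z\<bar>) y)" for n
      by simp
  qed (use cd Ab L R0 in auto)
  then obtain N where N: "\<And>n. \<bar>u z - v z\<bar> \<le> N * (3/4) ^ n" using R by blast
  have "(\<lambda>n. N * (3/4::real) ^ n) \<longlonglongrightarrow> N * 0"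
    by (intro tendsto_intros LIMSEQ_realpow_zero) auto
  then have "\<bar>u z - v z\<bar> \<le> N * 0"
    using N by (intro LIMSEQ_le_const) auto
  then show ?thesis by simp
qed

context
  fixes g a :: "'a \<Rightarrow> real" and Gg Ga :: "'a \<Rightarrow> 'a" and k k' :: "real \<Rightarrow> real" and L :: real
  assumes g: "has_grad g Gg S" and a: "has_grad a Ga S"
    and k: "\<And>x. (k has_real_derivative k' x) (at x)" and k'_cont: "continuous_on UNIV k'"
    and k'_bound: "\<And>x. \<bar>k' x\<bar> \<le> L" and k'_lip: "\<And>x y. \<bar>k' x - k' y\<bar> \<le> L * \<bar>x - y\<bar>"
begin

primrec picard :: "nat \<Rightarrow> 'a \<Rightarrow> real" where
  "picard 0 = g"
| "picard (Suc n) = (\<lambda>z. g z - duhamel (\<lambda>z. a z * k (picard n z)) z)"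

definition rhs_grad :: "('a \<Rightarrow> real) \<Rightarrow> ('a \<Rightarrow> 'a) \<Rightarrow> 'a \<Rightarrow> 'a" where
  "rhs_grad u V z = a z *\<^sub>R k' (u z) *\<^sub>R V z + k (u z) *\<^sub>R Ga z"

primrec picard_grad :: "nat \<Rightarrow> 'a \<Rightarrow> 'a" where
  "picard_grad 0 = Gg"
| "picard_grad (Suc n) = (\<lambda>z. Gg z - duhamel_grad (\<lambda>z. a z * k (picard n z)) (rhs_grad (picard n) (picard_grad n)) z)"

lemma rhs_has_grad:
  assumes "has_grad u V S"
  shows "has_grad (\<lambda>z. a z * k (u z)) (rhs_grad u V) S"
  unfolding rhs_grad_def by (intro has_grad_mult a has_grad_compose[OF assms k k'_cont])

lemma picard_has_grad: "has_grad (picard n) (picard_grad n) S"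
  by (induction n) (auto intro!: g has_grad_diff duhamel_has_grad rhs_has_grad)

declare picard.simps [simp del] picard_grad.simps [simp del]

lemma k_lip: "\<bar>k x - k y\<bar> \<le> L * \<bar>x - y\<bar>"
proof -
  have "norm (k x - k y) \<le> L * norm (x - y)"
    by (rule field_differentiable_bound[where S=UNIV and f'=k'])
      (use k k'_bound in \<open>auto intro: has_field_derivative_at_within\<close>)
  then show ?thesis by simp
qed

lemma L_nonneg: "0 \<le> L" using k'_bound[of 0] by simp

text \<open>
  Three instances of the decay lemma, each of which feeds the next: first the increments of
  the iterates decay geometrically; then the gradients are bounded, since their recursion is
  affine with a bounded source; then the increments of the gradients decay, the source in
  their recursion being controlled by the increments of the iterates and by the bound on the
  gradients.
\<close>

lemma picard_steps:
  assumes "0 \<le> R"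
  shows "\<exists>N. \<forall>n. \<forall>z\<in>K R. \<bar>picard (Suc n) z - picard n z\<bar> \<le> N * (3/4) ^ n"
    and "\<exists>N. \<forall>n. \<forall>z\<in>K R. norm (picard_grad (Suc n) z - picard_grad n z) \<le> N * (3/4) ^ n"
proof -
  let ?U = picard and ?V = picard_grad
  define f where "f n z = a z * k (?U n z)" for n z
  define h where "h n z = rhs_grad (?U n) (?V n) z" for n z
  have kc: "continuous_on UNIV k" by (rule continuous_on_UNIV_DERIV[OF k])
  have Uc: "continuous_on S (?U n)" and Vc: "continuous_on S (?V n)" for n
    using has_gradD[OF picard_has_grad] by auto
  have fc: "continuous_on S (f n)" and hc: "continuous_on S (h n)" for n
    using has_gradD[OF rhs_has_grad[OF picard_has_grad[of n]]] by (auto simp: f_def h_def)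
  have US: "?U (Suc n) z = g z - duhamel (f n) z" for n z by (simp add: f_def[abs_def] picard.simps)
  have VS: "?V (Suc n) z = Gg z - duhamel_grad (f n) (h n) z" for n z by (simp add: f_def[abs_def] h_def[abs_def] picard_grad.simps)
  obtain Ab where Ab: "Ab > 0" "\<And>z. z \<in> K R \<Longrightarrow> \<bar>a z\<bar> \<le> Ab" using K_bound[OF has_gradD(3)[OF a], of R, unfolded real_norm_def] by blast
  obtain Gb where Gb: "Gb > 0" "\<And>z. z \<in> K R \<Longrightarrow> norm (Ga z) \<le> Gb" using K_bound[OF has_gradD(2)[OF a], of R] by blast
  obtain gb where gb: "gb > 0" "\<And>z. z \<in> K R \<Longrightarrow> \<bar>g z\<bar> \<le> gb" using K_bound[OF has_gradD(3)[OF g], of R, unfolded real_norm_def] by blast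
  obtain vb where vb: "vb > 0" "\<And>z. z \<in> K R \<Longrightarrow> norm (Gg z) \<le> vb" using K_bound[OF has_gradD(2)[OF g], of R] by blast
  have L: "0 \<le> L" by (rule L_nonneg)
  have sm: "norm (x *\<^sub>R v) \<le> X * W" if "\<bar>x\<bar> \<le> X" "norm v \<le> W" for x X W and v :: 'a
    unfolding norm_scaleR using that by (intro mult_mono) auto
  have am: "\<bar>x * y\<bar> \<le> X * Y" if "\<bar>x\<bar> \<le> X" "\<bar>y\<bar> \<le> Y" for x y X Y :: real
    unfolding abs_mult using that by (intro mult_mono) auto
  have KS: "z \<in> S" if "z \<in> K R" for z using that K_sub by auto
  have time: "0 \<le> e \<bullet> z" "e \<bullet> z \<le> R" "(e \<bullet> z)\<^sup>2 \<le> R\<^sup>2" if "z \<in> K R" for z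
    using time_nonneg[OF KS[OF that]] time_le[OF that] by (auto intro: power_mono)
  define d where "d n z = \<bar>?U (Suc n) z - ?U n z\<bar>" for n z
  have dc: "continuous_on S (d n)" for n unfolding d_def using Uc by (intro continuous_intros)
  have fd: "\<bar>f (Suc n) z - f n z\<bar> \<le> (Ab * L) * d n z" if "z \<in> K R" for n z
  proof -
    have "\<bar>a z\<bar> * \<bar>k (?U (Suc n) z) - k (?U n z)\<bar> \<le> Ab * (L * d n z)"
      unfolding d_def using Ab that k_lip L by (intro mult_mono) auto
    then show ?thesis by (simp add: f_def ac_simps flip: abs_mult right_diff_distrib)
  qed
  obtain N0 where N0: "\<And>z. z \<in> K R \<Longrightarrow> norm (d 0 z) \<le> N0" using K_bound[OF dc, of R] by blast
  have "\<exists>N\<ge>0. \<forall>n. \<forall>z\<in>K R. d n z \<le> N * (3/4) ^ n"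
  proof (rule volterra_decay[where b=0 and B="Ab * L" and Z=N0])
    fix z assume z: "z \<in> K R"
    then show "d 0 z \<le> N0" using N0 by force
    have "d (Suc n) z = \<bar>duhamel (f (Suc n)) z - duhamel (f n) z\<bar>" for n
      unfolding d_def US by simp
    also have "\<dots> n \<le> (Ab * L) * ((e \<bullet> z)\<^sup>2 * avg (d n) z)" for n
      by (rule duhamel_diff_le[OF fc fc dc z fd])
    finally show "d (Suc n) z \<le> 0 * (3/4) ^ n + Ab * L * ((e \<bullet> z)\<^sup>2 * avg (d n) z)" for n by simp
  qed (use dc Ab L assms in auto)
  then obtain N where N: "0 \<le> N" "\<And>n z. z \<in> K R \<Longrightarrow> d n z \<le> N * (3/4) ^ n" by blast
  then show "\<exists>N. \<forall>n. \<forall>z\<in>K R. \<bar>?U (Suc n) z - ?U n z\<bar> \<le> N * (3/4) ^ n" by (auto simp: d_def)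

  have Ub: "\<bar>?U n z\<bar> \<le> gb + 4 * N" if "z \<in> K R" for n z
    using geometric_uniform_limit(2)[of "K R" ?U N z n] N that gb(2)[OF that] by (auto simp: d_def picard.simps(1))
  define kb where "kb = \<bar>k 0\<bar> + L * (gb + 4 * N)"
  have kb: "\<bar>k (?U n z)\<bar> \<le> kb" if "z \<in> K R" for n z
  proof -
    have "\<bar>k (?U n z) - k 0\<bar> \<le> L * (gb + 4 * N)"
      using k_lip[of "?U n z" 0] mult_left_mono[OF Ub[OF that] L, of n] by simp
    then show ?thesis by (simp add: kb_def)
  qed
  have kb0: "0 \<le> kb" using gb N L by (auto simp: kb_def)
  have fb: "\<bar>f n z\<bar> \<le> Ab * kb" if "z \<in> K R" for n z
    unfolding f_def abs_mult using Ab that kb by (intro mult_mono) auto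
  have C: "0 \<le> C" by (rule C_nonneg)

  define v where "v n z = norm (?V n z)" for n z
  have vc: "continuous_on S (v n)" for n unfolding v_def using Vc by (intro continuous_intros)
  have hb: "norm (h n z) \<le> kb * Gb + (Ab * L) * v n z" if "z \<in> K R" for n z
  proof -
    have "norm (h n z) \<le> norm (a z *\<^sub>R k' (?U n z) *\<^sub>R ?V n z) + norm (k (?U n z) *\<^sub>R Ga z)"
      unfolding h_def rhs_grad_def by (rule norm_triangle_ineq)
    moreover have "norm (a z *\<^sub>R k' (?U n z) *\<^sub>R ?V n z) \<le> Ab * (L * v n z)"
      by (rule sm[OF Ab(2)[OF that] sm[OF k'_bound]]) (simp add: v_def)
    moreover have "norm (k (?U n z) *\<^sub>R Ga z) \<le> kb * Gb"
      by (rule sm[OF kb[OF that] Gb(2)[OF that]])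
    ultimately show ?thesis by simp
  qed
  have avgc: "avg (\<lambda>z. x + y * F z) z \<le> x + y * avg F z" if "z \<in> K R" "0 \<le> x" "continuous_on S F" for x y F z
  proof -
    have "avg (\<lambda>z. x + y * F z) z = avg (\<lambda>z. x) z + avg (\<lambda>z. y * F z) z"
      by (rule avg_add) (use that KS in \<open>auto intro!: continuous_intros\<close>)
    moreover have "avg (\<lambda>z. x) z \<le> x" by (rule avg_le_const[OF _ that(1)]) (use that in auto)
    ultimately show ?thesis by (simp add: avg_cmult)
  qed
  have vstep: "v (Suc n) z \<le> (vb + 2 * R * (Ab * kb) * norm e + R\<^sup>2 * (C * (kb * Gb))) * 1 ^ n
      + (C * (Ab * L)) * ((e \<bullet> z)\<^sup>2 * avg (v n) z)" if z: "z \<in> K R" for n z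
  proof -
    have "norm (?V (Suc n) z) \<le> norm (Gg z) + norm (duhamel_grad (f n) (h n) z)"
      unfolding VS by (rule norm_triangle_ineq4)
    also have "norm (duhamel_grad (f n) (h n) z) \<le> norm ((2 * (e \<bullet> z) * avg (f n) z) *\<^sub>R e) + norm ((e \<bullet> z)\<^sup>2 *\<^sub>R avg_adj (h n) z)"
      unfolding duhamel_grad_def by (rule norm_triangle_ineq)
    also have "norm ((2 * (e \<bullet> z) * avg (f n) z) *\<^sub>R e) \<le> 2 * R * (Ab * kb) * norm e"
    proof -
      have "\<bar>avg (f n) z\<bar> \<le> Ab * kb"
        by (rule order_trans[OF avg_abs_le avg_le_const[OF _ z]])
          (use fc fb Ab kb0 in \<open>auto intro!: continuous_intros\<close>)
      then show ?thesis unfolding norm_scaleR abs_mult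
        using time[OF z] assms Ab(1) kb0 by (intro mult_mono mult_nonneg_nonneg) auto
    qed
    also have "norm ((e \<bullet> z)\<^sup>2 *\<^sub>R avg_adj (h n) z) \<le> (e \<bullet> z)\<^sup>2 * (C * (kb * Gb + (Ab * L) * avg (v n) z))"
    proof -
      have "norm (avg_adj (h n) z) \<le> C * avg (\<lambda>z. norm (h n z)) z"
        by (rule avg_adj_norm_le[OF hc KS[OF z]])
      also have "avg (\<lambda>z. norm (h n z)) z \<le> avg (\<lambda>z. kb * Gb + (Ab * L) * v n z) z"
        by (rule avg_mono[OF _ _ z hb]) (use hc vc in \<open>auto intro!: continuous_intros\<close>)
      also have "\<dots> \<le> kb * Gb + (Ab * L) * avg (v n) z"
        by (rule avgc[OF z _ vc]) (use kb0 Gb in auto)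
      finally have "norm (avg_adj (h n) z) \<le> C * (kb * Gb + (Ab * L) * avg (v n) z)"
        using C by (simp add: mult_left_mono)
      then show ?thesis by (simp add: mult_left_mono)
    qed
    also have "\<dots> = (e \<bullet> z)\<^sup>2 * (C * (kb * Gb)) + (C * (Ab * L)) * ((e \<bullet> z)\<^sup>2 * avg (v n) z)"
      by (simp add: algebra_simps)
    also have "(e \<bullet> z)\<^sup>2 * (C * (kb * Gb)) \<le> R\<^sup>2 * (C * (kb * Gb))"
      using time[OF z] C kb0 Gb by (intro mult_right_mono) auto
    finally show ?thesis using vb(2)[OF z] unfolding v_def[of "Suc n"] power_one mult_1_right by linarith
  qed
  have "\<exists>N\<ge>0. \<forall>n. \<forall>z\<in>K R. v n z \<le> N * 1 ^ n"
    by (rule volterra_decay[OF vc _ _ _ assms _ vstep, of vb])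
      (use vb assms Ab kb0 Gb C L in \<open>auto simp: v_def picard_grad.simps(1)\<close>)
  then obtain N' where N': "0 \<le> N'" "\<And>n z. z \<in> K R \<Longrightarrow> v n z \<le> N'" by auto

  define w where "w n z = norm (?V (Suc n) z - ?V n z)" for n z
  have wc: "continuous_on S (w n)" for n unfolding w_def using Vc by (intro continuous_intros)
  define Q where "Q = L * N * Gb + Ab * (L * N) * N'"
  have Q: "0 \<le> Q" using L N Gb Ab N' by (auto simp: Q_def)
  have hd: "norm (h (Suc n) z - h n z) \<le> Q * (3/4) ^ n + (Ab * L) * w n z" if z: "z \<in> K R" for n z
  proof -
    \<comment> \<open>The three differences are estimated by the increment of the gradients, by the Lipschitz
      bound on k', and by that on k.\<close>
    have eq: "h (Suc n) z - h n z = (a z * k' (?U n z)) *\<^sub>R (?V (Suc n) z - ?V n z)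
        + (a z * (k' (?U (Suc n) z) - k' (?U n z))) *\<^sub>R ?V (Suc n) z
        + (k (?U (Suc n) z) - k (?U n z)) *\<^sub>R Ga z"
      unfolding h_def rhs_grad_def by (simp add: algebra_simps)
    have tri: "norm (x + y + w) \<le> norm x + norm y + norm w" for x y w :: 'a
      by (rule order_trans[OF norm_triangle_ineq add_right_mono[OF norm_triangle_ineq]])
    have "norm (h (Suc n) z - h n z) \<le> norm ((a z * k' (?U n z)) *\<^sub>R (?V (Suc n) z - ?V n z))
        + norm ((a z * (k' (?U (Suc n) z) - k' (?U n z))) *\<^sub>R ?V (Suc n) z)
        + norm ((k (?U (Suc n) z) - k (?U n z)) *\<^sub>R Ga z)"
      unfolding eq by (rule tri)
    moreover have "norm ((a z * k' (?U n z)) *\<^sub>R (?V (Suc n) z - ?V n z)) \<le> (Ab * L) * w n z"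
      by (rule sm[OF am[OF Ab(2)[OF z] k'_bound]]) (simp add: w_def)
    moreover have "norm ((a z * (k' (?U (Suc n) z) - k' (?U n z))) *\<^sub>R ?V (Suc n) z) \<le> Ab * (L * (N * (3/4) ^ n)) * N'"
    proof -
      have "\<bar>k' (?U (Suc n) z) - k' (?U n z)\<bar> \<le> L * (N * (3/4) ^ n)"
        using k'_lip[of "?U (Suc n) z" "?U n z"] mult_left_mono[OF N(2)[OF z, of n] L] by (simp add: d_def)
      then show ?thesis
        by (rule sm[OF am[OF Ab(2)[OF z]] N'(2)[OF z, of "Suc n", unfolded v_def]])
    qed
    moreover have "norm ((k (?U (Suc n) z) - k (?U n z)) *\<^sub>R Ga z) \<le> (L * (N * (3/4) ^ n)) * Gb"
    proof -
      have "\<bar>k (?U (Suc n) z) - k (?U n z)\<bar> \<le> L * (N * (3/4) ^ n)"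
        using k_lip[of "?U (Suc n) z" "?U n z"] mult_left_mono[OF N(2)[OF z, of n] L] by (simp add: d_def)
      then show ?thesis by (rule sm[OF _ Gb(2)[OF z]])
    qed
    ultimately have "norm (h (Suc n) z - h n z) \<le> (Ab * L) * w n z + Ab * (L * (N * (3/4) ^ n)) * N' + (L * (N * (3/4) ^ n)) * Gb"
      by linarith
    then show ?thesis by (simp add: Q_def algebra_simps)
  qed
  have wstep: "w (Suc n) z \<le> (2 * R * (Ab * L * N) * norm e + R\<^sup>2 * (C * Q)) * (3/4) ^ n
      + (C * (Ab * L)) * ((e \<bullet> z)\<^sup>2 * avg (w n) z)" if z: "z \<in> K R" for n z
  proof -
    define q where "q = (3/4::real) ^ n"
    have q: "0 \<le> q" by (simp add: q_def)
    have "?V (Suc (Suc n)) z - ?V (Suc n) z = duhamel_grad (f n) (h n) z - duhamel_grad (f (Suc n)) (h (Suc n)) z"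
      unfolding VS by simp
    also have "\<dots> = (2 * (e \<bullet> z) * (avg (f n) z - avg (f (Suc n)) z)) *\<^sub>R e + (e \<bullet> z)\<^sup>2 *\<^sub>R (avg_adj (h n) z - avg_adj (h (Suc n)) z)"
      unfolding duhamel_grad_def by (simp add: algebra_simps)
    also have "\<dots> = (2 * (e \<bullet> z) * (avg (\<lambda>z. f n z - f (Suc n) z) z)) *\<^sub>R e + (e \<bullet> z)\<^sup>2 *\<^sub>R avg_adj (\<lambda>z. h n z - h (Suc n) z) z"
      using avg_diff[OF fc fc KS[OF z]] avg_adj_diff[OF hc hc KS[OF z]] by simp
    finally have "w (Suc n) z \<le> norm ((2 * (e \<bullet> z) * (avg (\<lambda>z. f n z - f (Suc n) z) z)) *\<^sub>R e) + norm ((e \<bullet> z)\<^sup>2 *\<^sub>R avg_adj (\<lambda>z. h n z - h (Suc n) z) z)"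
      unfolding w_def by (metis norm_triangle_ineq)
    also have "norm ((2 * (e \<bullet> z) * (avg (\<lambda>z. f n z - f (Suc n) z) z)) *\<^sub>R e) \<le> 2 * R * (Ab * L * (N * q)) * norm e"
    proof -
      have "\<bar>avg (\<lambda>z. f n z - f (Suc n) z) z\<bar> \<le> Ab * L * (N * q)"
      proof (rule order_trans[OF avg_abs_le avg_le_const[OF _ z]])
        fix y assume "y \<in> K R"
        then have "\<bar>f (Suc n) y - f n y\<bar> \<le> Ab * L * d n y" "Ab * L * d n y \<le> Ab * L * (N * q)"
          unfolding q_def using fd[of y n] N(2)[of y n] Ab(1) L by (auto intro!: mult_left_mono)
        then have "\<bar>f (Suc n) y - f n y\<bar> \<le> Ab * L * (N * q)" by linarith
        then show "\<bar>f n y - f (Suc n) y\<bar> \<le> Ab * L * (N * q)" by (simp add: abs_minus_commute)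
      qed (use fc Ab L N q in \<open>auto intro!: continuous_intros\<close>)
      then show ?thesis unfolding norm_scaleR abs_mult
        using time[OF z] assms Ab(1) L N(1) q by (intro mult_mono mult_nonneg_nonneg) auto
    qed
    also have "norm ((e \<bullet> z)\<^sup>2 *\<^sub>R avg_adj (\<lambda>z. h n z - h (Suc n) z) z) \<le> (e \<bullet> z)\<^sup>2 * (C * (Q * q + (Ab * L) * avg (w n) z))"
    proof -
      have "norm (avg_adj (\<lambda>z. h n z - h (Suc n) z) z) \<le> C * avg (\<lambda>z. norm (h n z - h (Suc n) z)) z"
        by (rule avg_adj_norm_le[OF _ KS[OF z]]) (use hc in \<open>auto intro!: continuous_intros\<close>)
      also have "avg (\<lambda>z. norm (h n z - h (Suc n) z)) z \<le> avg (\<lambda>z. Q * q + (Ab * L) * w n z) z"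
        by (rule avg_mono[OF _ _ z]) (use hc wc hd in \<open>auto intro!: continuous_intros simp: norm_minus_commute q_def\<close>)
      also have "\<dots> \<le> Q * q + (Ab * L) * avg (w n) z"
        by (rule avgc[OF z _ wc]) (use Q q in auto)
      finally have "norm (avg_adj (\<lambda>z. h n z - h (Suc n) z) z) \<le> C * (Q * q + (Ab * L) * avg (w n) z)"
        using C by (simp add: mult_left_mono)
      then show ?thesis by (simp add: mult_left_mono)
    qed
    also have "\<dots> = (e \<bullet> z)\<^sup>2 * (C * (Q * q)) + (C * (Ab * L)) * ((e \<bullet> z)\<^sup>2 * avg (w n) z)"
      by (simp add: algebra_simps)
    also have "(e \<bullet> z)\<^sup>2 * (C * (Q * q)) \<le> R\<^sup>2 * (C * (Q * q))"
      using time[OF z] C Q q by (intro mult_right_mono) auto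
    finally show ?thesis by (simp add: q_def algebra_simps)
  qed
  obtain W0 where W0: "\<And>z. z \<in> K R \<Longrightarrow> norm (w 0 z) \<le> W0" using K_bound[OF wc, of R] by blast
  have "\<exists>N\<ge>0. \<forall>n. \<forall>z\<in>K R. w n z \<le> N * (3/4) ^ n"
    by (rule volterra_decay[OF wc _ _ _ assms _ wstep, of W0])
      (use W0 assms Ab C L N Q in \<open>force+\<close>)
  then show "\<exists>N. \<forall>n. \<forall>z\<in>K R. norm (?V (Suc n) z - ?V n z) \<le> N * (3/4) ^ n" by (auto simp: w_def)
qed

text \<open>
  The Picard iterates and their gradients converge uniformly on every \<open>K R\<close>, so the limit is
  continuously differentiable and solves the equation.
\<close>

theorem volterra_C1_solution:
  "\<exists>u. C1 S u \<and> (\<forall>z\<in>S. u z = g z - duhamel (\<lambda>z. a z * k (u z)) z)"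
proof -
  define u where "u z = lim (\<lambda>n. picard n z)" for z
  define V where "V z = lim (\<lambda>n. picard_grad n z)" for z
  have ulim: "uniform_limit (K R) picard u sequentially" and Vlim: "uniform_limit (K R) picard_grad V sequentially"
    if "0 \<le> R" for R
  proof -
    from picard_steps(1)[OF that] obtain N where "\<And>n z. z \<in> K R \<Longrightarrow> norm (picard (Suc n) z - picard n z) \<le> N * (3/4) ^ n"
      by auto
    from geometric_uniform_limit(1)[of "K R" picard, OF this]
    show "uniform_limit (K R) picard u sequentially" by (simp add: u_def[abs_def])
    from picard_steps(2)[OF that] obtain N where "\<And>n z. z \<in> K R \<Longrightarrow> norm (picard_grad (Suc n) z - picard_grad n z) \<le> N * (3/4) ^ n"
      by auto
    from geometric_uniform_limit(1)[of "K R" picard_grad, OF this]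
    show "uniform_limit (K R) picard_grad V sequentially" by (simp add: V_def[abs_def])
  qed
  have R0: "0 \<le> R" if "z \<in> K R" for z R
    using time_nonneg[of z] time_le[OF that] that K_sub[of R] by (meson order_trans subsetD)
  have Vcont: "continuous_on S V"
  proof (rule continuous_on_S)
    fix R
    show "continuous_on (K R) V"
    proof (cases "K R = {}")
      case False
      then have "0 \<le> R" using R0 by auto
      then show ?thesis
        by (intro uniform_limit_theorem[OF _ Vlim])
          (auto intro!: always_eventually continuous_on_subset[OF has_gradD(2)[OF picard_has_grad]] K_sub)
    qed auto
  qed
  have der: "(u has_derivative (\<lambda>h. V z \<bullet> h)) (at z within K R)" if z: "z \<in> K R" for R z
  proof -
    have R: "0 \<le> R" using R0[OF z] .
    have "\<exists>g. \<forall>x\<in>K R. (\<lambda>n. picard n x) \<longlonglongrightarrow> g x \<and> (g has_derivative (\<bullet>) (V x)) (at x within K R)"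
    proof (rule has_derivative_sequence[OF K_convex _ _ z])
      show "(picard n has_derivative (\<bullet>) (picard_grad n x)) (at x within K R)" if "x \<in> K R" for n x
        using has_gradD(1)[OF picard_has_grad] that K_sub has_derivative_subset by blast
      show "(\<lambda>n. picard n z) \<longlonglongrightarrow> u z" using tendsto_uniform_limitI[OF ulim[OF R] z] .
      fix \<epsilon> :: real assume "\<epsilon> > 0"
      then have "\<forall>\<^sub>F n in sequentially. \<forall>x\<in>K R. dist (picard_grad n x) (V x) < \<epsilon>"
        using Vlim[OF R] by (rule uniform_limitD[rotated])
      then show "\<forall>\<^sub>F n in sequentially. \<forall>x\<in>K R. \<forall>h::'a. norm (picard_grad n x \<bullet> h - V x \<bullet> h) \<le> \<epsilon> * norm h"
      proof (rule eventually_mono, intro ballI allI)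
        fix n x and h :: 'a assume "\<forall>x\<in>K R. dist (picard_grad n x) (V x) < \<epsilon>" "x \<in> K R"
        then have "norm (picard_grad n x - V x) * norm h \<le> \<epsilon> * norm h"
          by (intro mult_right_mono) (auto simp: dist_norm less_imp_le)
        then show "norm (picard_grad n x \<bullet> h - V x \<bullet> h) \<le> \<epsilon> * norm h"
          using Cauchy_Schwarz_ineq2[of "picard_grad n x - V x" h] by (simp add: inner_diff_left)
      qed
    qed
    then obtain g' where g': "\<And>x. x \<in> K R \<Longrightarrow> (\<lambda>n. picard n x) \<longlonglongrightarrow> g' x"
        "\<And>x. x \<in> K R \<Longrightarrow> (g' has_derivative (\<bullet>) (V x)) (at x within K R)" by blast
    have "u x = g' x" if "x \<in> K R" for x using g'(1)[OF that] by (simp add: u_def limI)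
    then show ?thesis using g'(2)[OF z] z by (metis has_derivative_transform)
  qed
  have "(u has_derivative (\<lambda>h. V z \<bullet> h)) (at z within S)" if "z \<in> S" for z
    by (rule has_derivative_S[where f=u and f'="\<lambda>z h. V z \<bullet> h", OF der that])
  then have uV: "has_grad u V S" unfolding has_grad_def using Vcont by blast
  have "u z = g z - duhamel (\<lambda>z. a z * k (u z)) z" if z: "z \<in> S" for z
  proof -
    obtain R where R: "z \<in> K R" using K_cases[OF z] .
    note lim = tendsto_uniform_limitI[OF ulim[OF R0[OF R]]]
    obtain N where N: "\<And>n z. z \<in> K R \<Longrightarrow> norm (picard (Suc n) z - picard n z) \<le> N * (3/4) ^ n"
      using picard_steps(1)[OF R0[OF R]] by auto
    obtain gb where gb: "gb > 0" "\<And>z. z \<in> K R \<Longrightarrow> \<bar>g z\<bar> \<le> gb" using K_bound[OF has_gradD(3)[OF g], of R, unfolded real_norm_def] by blast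
    obtain Ab where Ab: "Ab > 0" "\<And>z. z \<in> K R \<Longrightarrow> \<bar>a z\<bar> \<le> Ab" using K_bound[OF has_gradD(3)[OF a], of R, unfolded real_norm_def] by blast
    have Ub: "\<bar>picard n y\<bar> \<le> gb + 4 * N" if "y \<in> K R" for n y
      using geometric_uniform_limit(2)[of "K R" picard N y n] N that gb(2)[OF that] by (auto simp: picard.simps(1))
    have kb: "\<bar>k (picard n y)\<bar> \<le> \<bar>k 0\<bar> + L * (gb + 4 * N)" if "y \<in> K R" for n y
      using k_lip[of "picard n y" 0] mult_left_mono[OF Ub[OF that] L_nonneg, of n] by simp
    have kc: "isCont k x" for x using k DERIV_isCont by blast
    have "(\<lambda>n. avg (\<lambda>z. a z * k (picard n z)) z) \<longlonglongrightarrow> avg (\<lambda>z. a z * k (u z)) z"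
      unfolding avg_def
    proof (rule integral_dominated_convergence[where w="\<lambda>_. Ab * (\<bar>k 0\<bar> + L * (gb + 4 * N))"])
      show "(\<lambda>p. c p * (a (A p z) * k (u (A p z)))) \<in> borel_measurable M"
        using measurable_A_mult[OF has_gradD(3)[OF rhs_has_grad[OF uV]] R] .
      show "(\<lambda>p. c p * (a (A p z) * k (picard n (A p z)))) \<in> borel_measurable M" for n
        using measurable_A_mult[OF has_gradD(3)[OF rhs_has_grad[OF picard_has_grad]] R] .
      show "AE p in M. (\<lambda>n. c p * (a (A p z) * k (picard n (A p z)))) \<longlonglongrightarrow> c p * (a (A p z) * k (u (A p z)))"
        by (intro AE_I2 tendsto_mult tendsto_const isCont_tendsto_compose[OF kc] lim A_K R)
      show "AE p in M. norm (c p * (a (A p z) * k (picard n (A p z)))) \<le> Ab * (\<bar>k 0\<bar> + L * (gb + 4 * N))" for n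
      proof (rule AE_I2)
        fix p
        have "c p * (\<bar>a (A p z)\<bar> * \<bar>k (picard n (A p z))\<bar>) \<le> 1 * (Ab * (\<bar>k 0\<bar> + L * (gb + 4 * N)))"
          using Ab A_K[OF R, of p] kb c_le[of p] c_nonneg[of p] by (intro mult_mono) auto
        then show "norm (c p * (a (A p z) * k (picard n (A p z)))) \<le> Ab * (\<bar>k 0\<bar> + L * (gb + 4 * N))"
          by (simp add: abs_mult c_nonneg)
      qed
    qed simp
    then have "(\<lambda>n. picard (Suc n) z) \<longlonglongrightarrow> g z - duhamel (\<lambda>z. a z * k (u z)) z"
      unfolding picard.simps(2) duhamel_def by (intro tendsto_intros)
    moreover have "(\<lambda>n. picard (Suc n) z) \<longlonglongrightarrow> u z" using lim[OF R] by (rule LIMSEQ_Suc)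
    ultimately show ?thesis using LIMSEQ_unique by blast
  qed
  with uV show ?thesis unfolding C1_def by blast
qed

end

end

section \<open>Functions of class C2 on the half space of nonnegative times\<close>

abbreviation (input) Slab :: "((real^3) \<times> real) set" where "Slab \<equiv> UNIV \<times> {0..}"

text \<open>
  Differentiability of every component of the gradient is what allows the second derivative to
  be treated by the theory of first derivatives.
\<close>

definition C2 :: "'a set \<Rightarrow> ('a::euclidean_space \<Rightarrow> real) \<Rightarrow> bool" where
  "C2 S f \<longleftrightarrow> (\<exists>G. has_grad f G S \<and> (\<forall>v. C1 S (\<lambda>z. G z \<bullet> v)))"

text \<open>
  At boundary points the derivative within the closed half space is still determined, because
  the half space contains a segment in each coordinate direction.
\<close>

lemma Slab_derivative_unique:
  assumes "(f has_derivative f') (at z within Slab)" "(f has_derivative f'') (at z within Slab)" "z \<in> Slab"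
  shows "f' = f''"
proof (rule frechet_derivative_unique_within[OF assms(1,2)])
  fix i :: "(real^3) \<times> real" and \<epsilon> :: real assume i: "i \<in> Basis" and "0 < \<epsilon>"
  then have "0 \<le> snd i" by (auto simp: Basis_prod_def)
  then show "\<exists>d. 0 < \<bar>d\<bar> \<and> \<bar>d\<bar> < \<epsilon> \<and> z + d *\<^sub>R i \<in> Slab"
    using \<open>0 < \<epsilon>\<close> assms(3) by (intro exI[of _ "\<epsilon>/2"]) (auto simp: mem_Times_iff)
qed

lemma Slab_grad_unique:
  assumes "has_grad f G Slab" "has_grad f G' Slab" "z \<in> Slab"
  shows "G z = G' z"
proof -
  have "(\<bullet>) (G z) = (\<bullet>) (G' z)"
    by (rule Slab_derivative_unique[OF has_gradD(1)[OF assms(1)] has_gradD(1)[OF assms(2)]]) (use assms in auto)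
  then show ?thesis by (metis vector_eq_rdot)
qed

lemma frechet_derivative_has_grad:
  assumes "f differentiable_on S" "\<And>v. continuous_on S (\<lambda>x. frechet_derivative f (at x within S) v)"
  shows "has_grad f (\<lambda>x. \<Sum>b\<in>Basis. frechet_derivative f (at x within S) b *\<^sub>R b) S"
  unfolding has_grad_def
proof
  show "continuous_on S (\<lambda>x. \<Sum>b\<in>Basis. frechet_derivative f (at x within S) b *\<^sub>R b)"
    by (intro continuous_intros assms)
  show "\<forall>z\<in>S. (f has_derivative (\<bullet>) (\<Sum>b\<in>Basis. frechet_derivative f (at z within S) b *\<^sub>R b)) (at z within S)"
  proof
    fix z assume "z \<in> S"
    let ?D = "frechet_derivative f (at z within S)"
    have D: "(f has_derivative ?D) (at z within S)"
      using assms(1) \<open>z \<in> S\<close> by (simp add: differentiable_on_def frechet_derivative_works)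
    have "?D h = (\<Sum>b\<in>Basis. ?D b *\<^sub>R b) \<bullet> h" for h
    proof -
      have "?D h = ?D (\<Sum>b\<in>Basis. (h \<bullet> b) *\<^sub>R b)" by (simp add: euclidean_representation)
      also have "\<dots> = (\<Sum>b\<in>Basis. (h \<bullet> b) * ?D b)"
        using has_derivative_linear[OF D] by (simp add: linear_sum linear_cmul)
      finally show ?thesis by (simp add: inner_sum_left inner_commute[of h] mult.commute)
    qed
    then have "?D = (\<bullet>) (\<Sum>b\<in>Basis. ?D b *\<^sub>R b)" by (rule ext)
    with D show "(f has_derivative (\<bullet>) (\<Sum>b\<in>Basis. ?D b *\<^sub>R b)) (at z within S)" by (rule subst[rotated])
  qed
qed

lemma frechet_derivative_Slab:
  assumes "has_grad f G Slab" "z \<in> Slab"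
  shows "frechet_derivative f (at z within Slab) v = G z \<bullet> v"
proof -
  note D = has_gradD(1)[OF assms]
  then have "(f has_derivative frechet_derivative f (at z within Slab)) (at z within Slab)"
    using frechet_derivative_works differentiable_def by blast
  from Slab_derivative_unique[OF this D assms(2)] show ?thesis by simp
qed

lemma C1_iff_C_k_on: "C_k_on (Suc 0) Slab f \<longleftrightarrow> C1 Slab f"
proof
  assume "C_k_on (Suc 0) Slab f"
  then show "C1 Slab f" unfolding C1_def using frechet_derivative_has_grad[of f Slab] by auto
next
  assume "C1 Slab f"
  then obtain G where G: "has_grad f G Slab" unfolding C1_def by blast
  have "f differentiable_on Slab"
    using has_gradD(1)[OF G] unfolding differentiable_on_def differentiable_def by blast
  moreover have "continuous_on Slab (\<lambda>x. frechet_derivative f (at x within Slab) v)" for v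
  proof -
    have "continuous_on Slab (\<lambda>x. G x \<bullet> v)" using has_gradD(2)[OF G] by (intro continuous_intros)
    then show ?thesis using frechet_derivative_Slab[OF G, of _ v] by (simp cong: continuous_on_cong)
  qed
  ultimately show "C_k_on (Suc 0) Slab f" by simp
qed

lemma C2_iff_C_k_on: "C_k_on 2 Slab f \<longleftrightarrow> C2 Slab f"
proof
  assume "C_k_on 2 Slab f"
  then have f: "f differentiable_on Slab" "\<And>v. C1 Slab (\<lambda>x. frechet_derivative f (at x within Slab) v)"
    unfolding numeral_2_eq_2 C_k_on.simps(2)[of "Suc 0"] C1_iff_C_k_on by blast+
  obtain G where G: "has_grad f G Slab"
    using frechet_derivative_has_grad[OF f(1) C1_continuous_on[OF f(2)]] by blast
  have "C1 Slab (\<lambda>z. G z \<bullet> v)" for v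
    by (rule C1_cong[OF f(2)[of v]]) (simp add: frechet_derivative_Slab[OF G])
  with G show "C2 Slab f" unfolding C2_def by blast
next
  assume "C2 Slab f"
  then obtain G where G: "has_grad f G Slab" "\<And>v. C1 Slab (\<lambda>z. G z \<bullet> v)" unfolding C2_def by blast
  have "f differentiable_on Slab"
    using has_gradD(1)[OF G(1)] unfolding differentiable_on_def differentiable_def by blast
  moreover have "C1 Slab (\<lambda>x. frechet_derivative f (at x within Slab) v)" for v
    by (rule C1_cong[OF G(2)]) (rule frechet_derivative_Slab[OF G(1)])
  ultimately show "C_k_on 2 Slab f" unfolding numeral_2_eq_2 C_k_on.simps(2)[of "Suc 0"] C1_iff_C_k_on by blast
qed

section \<open>The backward light cone as an averaging family\<close>

definition unit_ball :: "(real^3) measure" where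
  "unit_ball = uniform_measure lborel (cball 0 1)"

text \<open>
  A point of the backward cone is parametrized by its rescaled distance to the vertex in time,
  and by a direction. Directions are represented by points of the unit ball: the direction of
  a uniformly distributed point of the ball is uniformly distributed on the sphere, so that
  this serves as the normalized surface measure.
\<close>

definition cone_measure :: "(real \<times> (real^3)) measure" where
  "cone_measure = uniform_measure lborel {0..1} \<Otimes>\<^sub>M unit_ball"

text \<open>
  The first parameter is clamped to the unit interval, where the measure lives, so that the
  properties of the cone map hold for all parameters and not only almost everywhere.
\<close>

definition retard :: "real \<times> (real^3) \<Rightarrow> real" where
  "retard p = max 0 (min 1 (fst p))"

text \<open>
  With \<open>z = (x, t)\<close> and \<open>r = t retard p\<close> this is \<open>(x + r \<omega>, t - r)\<close> for a unit vector \<open>\<omega>\<close>, a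
  point on the backward light cone of \<open>z\<close>. Scaling the radius by \<open>t\<close> makes it linear in \<open>z\<close>.
\<close>

definition cone_map :: "real \<times> (real^3) \<Rightarrow> (real^3) \<times> real \<Rightarrow> (real^3) \<times> real" where
  "cone_map p z = (fst z + (snd z * retard p) *\<^sub>R sgn (snd p), (1 - retard p) * snd z)"

definition cone_region :: "real \<Rightarrow> ((real^3) \<times> real) set" where
  "cone_region R = {z. norm (fst z) + snd z \<le> R \<and> 0 \<le> snd z}"

definition ball_vol :: real where
  "ball_vol = measure lborel (cball (0::real^3) 1)"

lemma ball_vol: "0 < ball_vol" "emeasure lborel (cball (0::real^3) 1) = ennreal ball_vol"
proof -
  have "emeasure lborel (cball (0::real^3) 1) < \<infinity>" by (rule emeasure_lborel_cball_finite)
  then show e: "emeasure lborel (cball (0::real^3) 1) = ennreal ball_vol"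
    unfolding ball_vol_def by (intro emeasure_eq_ennreal_measure) auto
  have "unit_ball_vol (real DIM(real^3)) \<noteq> 0" using unit_ball_vol_pos[of "real DIM(real^3)"] by linarith
  then have "emeasure lborel (cball (0::real^3) 1) \<noteq> 0" by (simp add: emeasure_cball)
  then show "0 < ball_vol" unfolding e by (simp add: ennreal_eq_0_iff)
qed

lemma prob_unit_ball: "prob_space unit_ball"
  unfolding unit_ball_def using ball_vol by (intro prob_space_uniform_measure) auto

lemma sets_unit_ball [measurable_cong, simp]: "sets unit_ball = sets borel"
  and space_unit_ball [simp]: "space unit_ball = UNIV"
  by (auto simp: unit_ball_def)

interpretation ub: prob_space unit_ball by (rule prob_unit_ball)

lemma prob_unif: "prob_space (uniform_measure lborel {0..1::real})"
  by (rule prob_space_uniform_measure) auto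

interpretation unif: prob_space "uniform_measure lborel {0..1::real}" by (rule prob_unif)
interpretation pp: pair_prob_space "uniform_measure lborel {0..1::real}" unit_ball ..

lemma sets_cone_measure [measurable_cong, simp]: "sets cone_measure = sets borel"
proof -
  have "sets cone_measure = sets (borel \<Otimes>\<^sub>M borel :: (real \<times> (real^3)) measure)"
    unfolding cone_measure_def by (intro sets_pair_measure_cong) auto
  then show ?thesis unfolding borel_prod .
qed

lemma prob_cone_measure: "prob_space cone_measure"
  unfolding cone_measure_def by (rule pp.prob_space_axioms)

lemma norm_sgn_le: "norm (sgn (y::'a::real_normed_vector)) \<le> 1"
  by (simp add: norm_sgn)

lemma retard_bounds: "0 \<le> retard p" "retard p \<le> 1"
  by (auto simp: retard_def)

lemma retard_measurable [measurable]: "retard \<in> borel_measurable borel"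
  unfolding retard_def by (intro borel_measurable_continuous_onI continuous_intros)

lemma cone_map_measurable: "(\<lambda>p. cone_map p z) \<in> borel_measurable borel"
proof -
  have [measurable]: "fst \<in> borel_measurable (borel :: (real \<times> (real^3)) measure)"
    "snd \<in> borel_measurable (borel :: (real \<times> (real^3)) measure)"
    by (intro borel_measurable_continuous_onI continuous_intros)+
  show ?thesis unfolding cone_map_def sgn_div_norm by (intro borel_measurable_Pair) measurable
qed

lemma cone_map_linear: "linear (cone_map p)"
  by (rule linearI) (auto simp: cone_map_def algebra_simps)

text \<open>
  In the norm \<open>|x| + |t|\<close> the cone maps do not increase lengths: a step backwards in time by
  \<open>r\<close> moves the space variable by at most \<open>r\<close>. This is why one compact set of tangent vectors
  is invariant under all of them.
\<close>

lemma cone_map_norm_l1: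
  "norm (fst (cone_map p z)) + \<bar>snd (cone_map p z)\<bar> \<le> norm (fst z) + \<bar>snd z\<bar>"
proof -
  have "norm (fst (cone_map p z)) \<le> norm (fst z) + \<bar>snd z\<bar> * retard p * norm (sgn (snd p))"
    unfolding cone_map_def fst_conv
    by (rule order_trans[OF norm_triangle_ineq]) (simp add: abs_mult retard_bounds)
  also have "\<dots> \<le> norm (fst z) + \<bar>snd z\<bar> * retard p * 1"
    by (intro add_left_mono mult_left_mono norm_sgn_le) (simp add: retard_bounds)
  finally have "norm (fst (cone_map p z)) \<le> norm (fst z) + \<bar>snd z\<bar> * retard p" by simp
  moreover have "\<bar>snd (cone_map p z)\<bar> = \<bar>snd z\<bar> - \<bar>snd z\<bar> * retard p"
    using retard_bounds[of p] unfolding cone_map_def snd_conv abs_mult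
    by (simp add: left_diff_distrib right_diff_distrib mult.commute)
  ultimately show ?thesis by linarith
qed

lemma norm_prod_le: "norm z \<le> norm (fst z) + norm (snd z)"
  using norm_Pair_le[of "fst z" "snd z"] by simp

lemma norm_l1_le: "norm (fst z) + norm (snd z) \<le> 2 * norm z"
  using norm_fst_le[of "fst z" "snd z"] norm_snd_le[of "snd z" "fst z"] by simp

lemma cone_map_bound: "norm (cone_map p z) \<le> 2 * norm z"
  using norm_prod_le[of "cone_map p z"] cone_map_norm_l1[of p z] norm_l1_le[of z] by simp

lemma cone_region_compact: "compact (cone_region R)"
proof -
  have "closed (cone_region R)" unfolding cone_region_def
    by (intro closed_Collect_conj closed_Collect_le continuous_intros)
  moreover have "bounded (cone_region R)"
    by (rule boundedI[of _ R]) (use norm_prod_le in \<open>fastforce simp: cone_region_def intro: order_trans\<close>)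
  ultimately show ?thesis by (simp add: compact_eq_bounded_closed)
qed

lemma convex_cone_region: "convex (cone_region R)"
proof (rule convexI)
  fix x y :: "(real^3) \<times> real" and u v :: real assume *: "x \<in> cone_region R" "y \<in> cone_region R" "0 \<le> u" "0 \<le> v" "u + v = 1"
  have "norm (u *\<^sub>R fst x + v *\<^sub>R fst y) \<le> u * norm (fst x) + v * norm (fst y)"
    using * by (intro order_trans[OF norm_triangle_ineq]) simp
  also have "\<dots> \<le> u * (R - snd x) + v * (R - snd y)"
    using * by (intro add_mono mult_left_mono) (auto simp: cone_region_def)
  also have "\<dots> = (u + v) * R - (u * snd x + v * snd y)" by (simp add: algebra_simps)
  finally show "u *\<^sub>R x + v *\<^sub>R y \<in> cone_region R" using * by (auto simp: cone_region_def)
qed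

interpretation wave: averaging cone_measure retard cone_map "(0,1)" Slab cone_region 2
proof (rule averaging.intro)
  show "prob_space cone_measure" by (rule prob_cone_measure)
  show "retard \<in> borel_measurable cone_measure" by measurable
  show "(\<lambda>p. cone_map p z) \<in> borel_measurable cone_measure" for z using cone_map_measurable by simp
  show "(0,1) \<bullet> cone_map p z = (1 - retard p) * ((0,1) \<bullet> z)" for p z
    by (simp add: cone_map_def inner_prod_def)
  show "cone_map p z \<in> cone_region R" if "z \<in> cone_region R" for z R p
    using that cone_map_norm_l1[of p z] retard_bounds[of p]
    by (auto simp: cone_region_def) (auto simp: cone_map_def)
  show "\<exists>R U. open U \<and> z \<in> U \<and> Slab \<inter> U \<subseteq> cone_region R" if "z \<in> Slab" for z
  proof (rule exI[of _ "norm (fst z) + snd z + 1"], rule exI, intro conjI)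
    show "open {y. norm (fst y) + snd y < norm (fst z) + snd z + (1::real)}"
      by (intro open_Collect_less continuous_intros)
  qed (use that in \<open>auto simp: cone_region_def\<close>)
  show "(0,1) \<bullet> z \<le> R" if "z \<in> cone_region R" for z R
  proof -
    have "norm (fst z) + snd z \<le> R" using that by (simp add: cone_region_def)
    then have "snd z \<le> R" using norm_ge_zero[of "fst z"] by linarith
    then show ?thesis by (simp add: inner_prod_def)
  qed
  show "cone_region R \<subseteq> Slab" for R by (auto simp: cone_region_def mem_Times_iff)
qed (auto simp: retard_bounds cone_map_linear cone_map_bound convex_cone_region cone_region_compact
      inner_prod_def mem_Times_iff)

text \<open>
  The derivative \<open>(z, h) \<mapsto> Du(z) h\<close> of a solution solves an equation of the same kind, over
  pairs of a point and a tangent vector, on which the linear cone map acts diagonally.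
\<close>

definition tangent_map :: "real \<times> (real^3) \<Rightarrow> ((real^3) \<times> real) \<times> (real^3) \<times> real \<Rightarrow> ((real^3) \<times> real) \<times> (real^3) \<times> real" where
  "tangent_map p w = (cone_map p (fst w), cone_map p (snd w))"

definition tangent_region :: "real \<Rightarrow> (((real^3) \<times> real) \<times> (real^3) \<times> real) set" where
  "tangent_region R = cone_region R \<times> {h. norm (fst h) + \<bar>snd h\<bar> \<le> R}"

lemma l1_ball_compact: "compact {h::(real^3) \<times> real. norm (fst h) + \<bar>snd h\<bar> \<le> R}"
proof -
  have "closed {h::(real^3) \<times> real. norm (fst h) + \<bar>snd h\<bar> \<le> R}"
    by (intro closed_Collect_le continuous_intros)
  moreover have "bounded {h::(real^3) \<times> real. norm (fst h) + \<bar>snd h\<bar> \<le> R}"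
    by (rule boundedI[of _ R]) (use norm_prod_le in \<open>fastforce intro: order_trans\<close>)
  ultimately show ?thesis by (simp add: compact_eq_bounded_closed)
qed

lemma l1_ball_convex: "convex {h::(real^3) \<times> real. norm (fst h) + \<bar>snd h\<bar> \<le> R}"
proof (rule convexI, unfold mem_Collect_eq)
  fix x y :: "(real^3) \<times> real" and u v :: real
  assume *: "norm (fst x) + \<bar>snd x\<bar> \<le> R" "norm (fst y) + \<bar>snd y\<bar> \<le> R" "0 \<le> u" "0 \<le> v" "u + v = 1"
  have "norm (u *\<^sub>R fst x + v *\<^sub>R fst y) \<le> u * norm (fst x) + v * norm (fst y)"
    using * by (intro order_trans[OF norm_triangle_ineq]) simp
  moreover have "\<bar>u * snd x + v * snd y\<bar> \<le> u * \<bar>snd x\<bar> + v * \<bar>snd y\<bar>"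
    using * by (intro order_trans[OF abs_triangle_ineq]) (simp add: abs_mult)
  moreover have "u * (norm (fst x) + \<bar>snd x\<bar>) + v * (norm (fst y) + \<bar>snd y\<bar>) \<le> u * R + v * R"
    using * by (intro add_mono mult_left_mono) auto
  moreover have "u * R + v * R = R" using *(5) by (simp flip: distrib_right)
  ultimately show "norm (fst (u *\<^sub>R x + v *\<^sub>R y)) + \<bar>snd (u *\<^sub>R x + v *\<^sub>R y)\<bar> \<le> R"
    by (simp add: algebra_simps)
qed

interpretation tangent: averaging cone_measure retard tangent_map "((0,1),0)" "Slab \<times> UNIV" tangent_region 4
proof (rule averaging.intro)
  show "prob_space cone_measure" by (rule prob_cone_measure)
  show "retard \<in> borel_measurable cone_measure" by measurable
  show "(\<lambda>p. tangent_map p z) \<in> borel_measurable cone_measure" for z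
    unfolding tangent_map_def using cone_map_measurable by (intro borel_measurable_Pair) auto
  show "linear (tangent_map p)" for p
    using cone_map_linear[of p] by (intro linearI) (auto simp: tangent_map_def linear_add linear_cmul)
  show "norm (tangent_map p z) \<le> 4 * norm z" for p z
    using norm_prod_le[of "tangent_map p z"] cone_map_bound[of p "fst z"] cone_map_bound[of p "snd z"] norm_l1_le[of z]
    by (simp add: tangent_map_def)
  show "((0,1),0) \<bullet> tangent_map p z = (1 - retard p) * (((0,1),0) \<bullet> z)" for p z
    using wave.A_time[of p "fst z"] by (simp add: tangent_map_def inner_Pair inner_prod_def)
  show "tangent_map p z \<in> tangent_region R" if "z \<in> tangent_region R" for z R p
    using that cone_map_norm_l1[of p "snd z"] wave.A_K[of "fst z" R p]
    by (auto simp: tangent_region_def tangent_map_def)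
  show "\<exists>R U. open U \<and> z \<in> U \<and> (Slab \<times> UNIV) \<inter> U \<subseteq> tangent_region R" if "z \<in> Slab \<times> UNIV" for z
  proof (intro exI conjI)
    show "open {y. norm (fst (fst y)) + snd (fst y) + (norm (fst (snd y)) + \<bar>snd (snd y)\<bar>) <
         norm (fst (fst z)) + snd (fst z) + (norm (fst (snd z)) + \<bar>snd (snd z)\<bar>) + (1::real)}"
      by (intro open_Collect_less continuous_intros)
    show "(Slab \<times> UNIV) \<inter> {y. norm (fst (fst y)) + snd (fst y) + (norm (fst (snd y)) + \<bar>snd (snd y)\<bar>) <
         norm (fst (fst z)) + snd (fst z) + (norm (fst (snd z)) + \<bar>snd (snd z)\<bar>) + (1::real)} \<subseteq>
         tangent_region (norm (fst (fst z)) + snd (fst z) + (norm (fst (snd z)) + \<bar>snd (snd z)\<bar>) + 1)"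
      unfolding tangent_region_def cone_region_def
      by (auto simp: mem_Times_iff) (smt (verit) norm_ge_zero)+
  qed auto
  show "((0,1),0) \<bullet> z \<le> R" if "z \<in> tangent_region R" for z R
    using wave.time_le[of "fst z" R] that by (auto simp: tangent_region_def inner_prod_def)
  show "convex (tangent_region R)" "compact (tangent_region R)" for R
    unfolding tangent_region_def
    by (auto intro: convex_Times compact_Times convex_cone_region cone_region_compact l1_ball_compact l1_ball_convex)
qed (auto simp: retard_bounds cone_region_def inner_prod_def mem_Times_iff tangent_region_def)

section \<open>Solutions of class C2\<close>

lemma C1_fst:
  fixes f :: "'a::euclidean_space \<Rightarrow> real"
  assumes "C1 S f" shows "C1 (S \<times> (UNIV::'b::euclidean_space set)) (\<lambda>w. f (fst w))"
proof -
  obtain G where G: "has_grad f G S" using assms unfolding C1_def by blast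
  have "has_grad (\<lambda>w. f (fst w)) (\<lambda>w. (G (fst w), 0::'b)) (S \<times> UNIV)"
    by (rule has_grad_linear_compose[OF G, where L'="\<lambda>v. (v, 0)"])
      (auto simp: bounded_linear_fst inner_prod_def intro!: continuous_intros)
  then show ?thesis unfolding C1_def by blast
qed

lemma C1_slice:
  fixes f :: "'a::euclidean_space \<times> 'b::euclidean_space \<Rightarrow> real"
  assumes "C1 (S \<times> UNIV) f" shows "C1 S (\<lambda>z. f (z, b))"
proof -
  obtain G where G: "has_grad f G (S \<times> UNIV)" using assms unfolding C1_def by blast
  have "bounded_linear (\<lambda>z::'a. (z, 0::'b))"
    by (intro bounded_linear_Pair bounded_linear_ident bounded_linear_zero)
  then have "has_grad (\<lambda>z. f ((0, b) + (z, 0))) (\<lambda>z. fst (G ((0, b) + (z, 0)))) S"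
    by (intro has_grad_affine_compose[OF G, where L'=fst])
      (auto simp: inner_prod_def intro!: continuous_intros)
  then show ?thesis unfolding C1_def by (simp add: exI)
qed

text \<open>
  A first application of the fixed point theorem gives a solution \<open>u\<close> of class C1.
  Differentiating the equation, \<open>\<phi>(z, h) = Du(z) h\<close> solves a linear equation of the same type
  on the tangent space, whose coefficient \<open>k'(u)\<close> and whose inhomogeneity are of class C1. The
  second application gives a C1 solution of that equation, which is \<open>\<phi>\<close> by uniqueness. So the
  derivatives of \<open>u\<close> are of class C1.
\<close>

theorem wave_C2_solution:
  fixes k k' k'' :: "real \<Rightarrow> real"
  assumes g: "C2 Slab g"
    and k: "\<And>x. (k has_real_derivative k' x) (at x)" and k': "\<And>x. (k' has_real_derivative k'' x) (at x)"
    and k'': "continuous_on UNIV k''" and L: "\<And>x. \<bar>k' x\<bar> \<le> L" "\<And>x. \<bar>k'' x\<bar> \<le> L"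
  shows "\<exists>u. C2 Slab u \<and> (\<forall>z\<in>Slab. u z = g z - wave.duhamel (\<lambda>z. k (u z)) z)"
proof -
  obtain Gg where Gg: "has_grad g Gg Slab" "\<And>v. C1 Slab (\<lambda>z. Gg z \<bullet> v)" using g unfolding C2_def by blast
  have k'c: "continuous_on UNIV k'" by (rule continuous_on_UNIV_DERIV[OF k'])
  have lip: "\<bar>k' x - k' y\<bar> \<le> L * \<bar>x - y\<bar>" for x y
  proof -
    have "norm (k' x - k' y) \<le> L * norm (x - y)"
      by (rule field_differentiable_bound[where S=UNIV and f'=k''])
        (use k' L in \<open>auto intro: has_field_derivative_at_within\<close>)
    then show ?thesis by simp
  qed
  obtain u where u: "C1 Slab u" and eq: "\<And>z. z \<in> Slab \<Longrightarrow> u z = g z - wave.duhamel (\<lambda>z. 1 * k (u z)) z"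
    using wave.volterra_C1_solution[OF Gg(1) has_grad_const[of 1] k k'c L(1) lip] by blast
  obtain V where V: "has_grad u V Slab" using u unfolding C1_def by blast
  define F where "F z = k (u z)" for z
  define H where "H z = k' (u z) *\<^sub>R V z" for z
  have F: "has_grad F H Slab" unfolding F_def H_def by (rule has_grad_compose[OF V k k'c])
  have eq: "u z = g z - wave.duhamel F z" if "z \<in> Slab" for z using eq[OF that] by (simp add: F_def[abs_def])
  have "has_grad u (\<lambda>z. Gg z - wave.duhamel_grad F H z) Slab"
    by (rule has_grad_cong[OF has_grad_diff[OF Gg(1) wave.duhamel_has_grad[OF F]] eq])
  from Slab_grad_unique[OF V this]
  have Veq: "V z = Gg z - wave.duhamel_grad F H z" if "z \<in> Slab" for z using that by blast
  define \<phi> where "\<phi> w = V (fst w) \<bullet> snd w" for w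
  \<comment> \<open>The part of the differentiated equation that does not contain V inside the integral: the
    derivative of the time factor acts on an average of F alone.\<close>
  define \<gamma> where "\<gamma> w = Gg (fst w) \<bullet> snd w - (2 * ((0,1) \<bullet> fst w) * wave.avg F (fst w)) * ((0,1) \<bullet> snd w)" for w
  define a where "a w = k' (u (fst w))" for w :: "((real^3) \<times> real) \<times> (real^3) \<times> real"
  have \<phi>eq: "\<phi> w = \<gamma> w - tangent.duhamel (\<lambda>w. a w * \<phi> w) w" if "w \<in> Slab \<times> UNIV" for w
  proof -
    obtain z h where w: "w = (z, h)" by (cases w)
    have z: "z \<in> Slab" using that w by auto
    have "wave.avg_adj H z \<bullet> h = tangent.avg (\<lambda>w. a w * \<phi> w) w"
    proof -
      have "wave.avg_adj H z \<bullet> h = (\<integral>p. (retard p *\<^sub>R adjoint (cone_map p) (H (cone_map p z))) \<bullet> h \<partial>cone_measure)"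
        unfolding wave.avg_adj_def
        by (rule integral_inner_left[symmetric]) (rule wave.avg_adj_integrable[OF has_gradD(2)[OF F] z])
      also have "\<dots> = tangent.avg (\<lambda>w. a w * \<phi> w) w"
        unfolding tangent.avg_def w tangent_map_def a_def \<phi>_def H_def
        by (intro Bochner_Integration.integral_cong refl)
          (simp add: adjoint_works[OF cone_map_linear] inner_commute[of "adjoint _ _"] inner_commute[of h] inner_commute[of "V _"])
      finally show ?thesis .
    qed
    moreover have "V z \<bullet> h = Gg z \<bullet> h - ((2 * ((0,1) \<bullet> z) * wave.avg F z) * ((0,1) \<bullet> h)
        + ((0,1) \<bullet> z)\<^sup>2 * (wave.avg_adj H z \<bullet> h))"
      by (simp only: Veq[OF z] wave.duhamel_grad_def inner_diff_left inner_add_left inner_scaleR_left)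
    moreover have "((0,1),0) \<bullet> w = (0,1) \<bullet> z" by (simp add: w inner_Pair)
    moreover have "\<phi> w = V z \<bullet> h" by (simp add: \<phi>_def w)
    ultimately show ?thesis
      unfolding tangent.duhamel_def \<gamma>_def by (simp add: w del: inner_Pair)
  qed
  have C1inner: "C1 (Slab \<times> UNIV) (\<lambda>w. Gg (fst w) \<bullet> snd w)"
  proof (rule C1_cong)
    show "C1 (Slab \<times> UNIV) (\<lambda>w. \<Sum>b\<in>Basis. (Gg (fst w) \<bullet> b) * ((0, b) \<bullet> w))"
      by (intro C1_sum C1_mult C1_inner C1_fst[OF Gg(2)])
    show "Gg (fst w) \<bullet> snd w = (\<Sum>b\<in>Basis. (Gg (fst w) \<bullet> b) * ((0, b) \<bullet> w))" for w :: "((real^3) \<times> real) \<times> (real^3) \<times> real"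
      by (subst euclidean_inner) (simp add: inner_prod_def inner_commute mult.commute)
  qed
  have C1avg: "C1 Slab (wave.avg F)" unfolding C1_def using wave.avg_has_grad[OF F] by blast
  have "C1 (Slab \<times> UNIV) \<gamma>"
    unfolding \<gamma>_def
  proof (intro C1_diff C1inner C1_mult C1_const)
    show "C1 (Slab \<times> UNIV) (\<lambda>w. (0, 1) \<bullet> fst w)" by (rule C1_fst[OF C1_inner])
    show "C1 (Slab \<times> UNIV) (\<lambda>w. wave.avg F (fst w))" by (rule C1_fst[OF C1avg])
    show "C1 (Slab \<times> UNIV) (\<lambda>w. (0, 1) \<bullet> snd w)"
      by (rule C1_cong[OF C1_inner[of _ "(0,(0,1))"]]) (simp add: inner_prod_def)
  qed
  then obtain G\<gamma> where G\<gamma>: "has_grad \<gamma> G\<gamma> (Slab \<times> UNIV)" unfolding C1_def by blast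
  have "C1 (Slab \<times> UNIV) a" unfolding a_def by (rule C1_compose[OF C1_fst[OF u] k' k''])
  then obtain Ga where Ga: "has_grad a Ga (Slab \<times> UNIV)" unfolding C1_def by blast
  obtain \<psi> where \<psi>: "C1 (Slab \<times> UNIV) \<psi>" "\<And>w. w \<in> Slab \<times> UNIV \<Longrightarrow> \<psi> w = \<gamma> w - tangent.duhamel (\<lambda>w. a w * \<psi> w) w"
    using tangent.volterra_C1_solution[OF G\<gamma> Ga, of "\<lambda>x. x" "\<lambda>x. 1" 1] by auto
  have \<phi>c: "continuous_on (Slab \<times> UNIV) \<phi>" unfolding \<phi>_def
    by (intro continuous_intros continuous_on_compose2[OF has_gradD(2)[OF V]]) auto
  have "\<phi> w = \<psi> w" if "w \<in> Slab \<times> UNIV" for w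
    by (rule tangent.volterra_unique[OF \<phi>c C1_continuous_on[OF \<psi>(1)] has_gradD(3)[OF Ga], where k="\<lambda>x. x" and L=1, OF _ _ \<phi>eq \<psi>(2) that])
      auto
  then have "V z \<bullet> v = \<psi> (z, v)" if "z \<in> Slab" for z v
    using that by (metis SigmaI UNIV_I \<phi>_def fst_conv snd_conv)
  then have "C1 Slab (\<lambda>z. V z \<bullet> v)" for v
    by (rule C1_cong[OF C1_slice[OF \<psi>(1), of v]])
  with V have "C2 Slab u" unfolding C2_def by blast
  with eq show ?thesis by (auto simp: F_def[abs_def])
qed

section \<open>Integrals with a variable upper limit\<close>

text \<open>
  The integral is a function of the parameter and of the upper limit with a partial derivative
  in the former and a continuous one in the latter, hence differentiable; the chain rule then
  applies.
\<close>

lemma leibniz_variable_limit: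
  fixes k k' :: "real \<Rightarrow> real \<Rightarrow> real" and b :: "real \<Rightarrow> real"
  assumes I: "convex I" "h0 \<in> I"
    and deriv: "\<And>h s. h \<in> I \<Longrightarrow> s \<in> {0..B} \<Longrightarrow> ((\<lambda>h. k h s) has_real_derivative k' h s) (at h within I)"
    and kc: "continuous_on (I \<times> {0..B}) (\<lambda>(h, s). k h s)"
    and k'c: "continuous_on (I \<times> {0..B}) (\<lambda>(h, s). k' h s)"
    and b: "\<And>h. h \<in> I \<Longrightarrow> b h \<in> {0..B}" "(b has_real_derivative b') (at h0 within I)"
  shows "((\<lambda>h. integral {0..b h} (k h)) has_real_derivative
      b' * k h0 (b h0) + integral {0..b h0} (k' h0)) (at h0 within I)"
proof -
  define P where "P h y = integral {0..y} (k h)" for h y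
  have sl: "continuous_on {0..B} (f h)" if "continuous_on (I \<times> {0..B}) (\<lambda>(h, s). f h s)" "h \<in> I" for f :: "real \<Rightarrow> real \<Rightarrow> real" and h
  proof -
    have "continuous_on {0..B} (\<lambda>s. (\<lambda>(h, s). f h s) (h, s))"
      by (rule continuous_on_compose2[OF that(1)]) (use that(2) in \<open>auto intro!: continuous_intros\<close>)
    then show ?thesis by simp
  qed
  have b0: "b h0 \<in> {0..B}" using b(1) I(2) .
  have 1: "((\<lambda>h. P h (b h0)) has_derivative (\<lambda>x. integral {0..b h0} (k' h0) * x)) (at h0 within I)"
  proof -
    have "((\<lambda>h. integral (cbox 0 (b h0)) (k h)) has_field_derivative integral (cbox 0 (b h0)) (k' h0)) (at h0 within I)"
    proof (rule leibniz_rule_field_derivative[OF _ _ _ I(2,1)])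
      show "((\<lambda>h. k h s) has_real_derivative k' h s) (at h within I)" if "h \<in> I" "s \<in> cbox 0 (b h0)" for h s
        using deriv that b0 by auto
      show "k h integrable_on cbox 0 (b h0)" if "h \<in> I" for h
        using b0 by (intro integrable_continuous continuous_on_subset[OF sl[OF kc that]]) auto
      show "continuous_on (I \<times> cbox 0 (b h0)) (\<lambda>(h, s). k' h s)"
        using b0 by (intro continuous_on_subset[OF k'c]) auto
    qed
    then show ?thesis by (simp add: P_def has_field_derivative_def)
  qed
  have 2: "((\<lambda>y. P h y) has_derivative blinfun_mult_right (k h y)) (at y within {0..B})" if "h \<in> I" "y \<in> {0..B}" for h y
    using integral_has_real_derivative[OF sl[OF kc that(1)] that(2)]
    by (simp add: P_def has_field_derivative_def)
  have 3: "continuous (at (h0, b h0) within I \<times> {0..B}) (\<lambda>(h, y). blinfun_mult_right (k h y))"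
  proof -
    have "continuous_on (I \<times> {0..B}) (\<lambda>(h, y). blinfun_mult_right (k h y))"
      using kc by (auto simp: split_beta intro!: continuous_intros)
    then show ?thesis using I(2) b0 by (auto simp: continuous_on_eq_continuous_within)
  qed
  have 4: "((\<lambda>(h, y). P h y) has_derivative (\<lambda>(tx, ty). integral {0..b h0} (k' h0) * tx + blinfun_mult_right (k h0 (b h0)) ty))
      (at (h0, b h0) within I \<times> {0..B})"
    by (rule has_derivative_partialsI[OF 1 2 3 b0]) auto
  have 5: "((\<lambda>h. (h, b h)) has_derivative (\<lambda>x. (x, b' * x))) (at h0 within I)"
    using b(2) by (intro has_derivative_Pair has_derivative_ident) (simp add: has_field_derivative_def)
  have "((\<lambda>h. (\<lambda>(h, y). P h y) (h, b h)) has_derivative (\<lambda>x. (\<lambda>(tx, ty). integral {0..b h0} (k' h0) * tx + blinfun_mult_right (k h0 (b h0)) ty) (x, b' * x))) (at h0 within I)"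
    by (rule has_derivative_in_compose[OF 5 has_derivative_subset[OF 4]]) (use b(1) in auto)
  then show ?thesis
    unfolding has_field_derivative_def P_def prod.case
    by (rule has_derivative_eq_rhs) (simp add: fun_eq_iff algebra_simps)
qed

section \<open>Rotation invariance of spherical means\<close>

lemma orthogonal_transformation_measurable:
  fixes f :: "real^3 \<Rightarrow> real^3"
  assumes "orthogonal_transformation f"
  shows "f \<in> borel_measurable borel"
  using orthogonal_transformation_linear[OF assms]
  by (intro borel_measurable_continuous_onI linear_continuous_on) (simp add: linear_conv_bounded_linear)

lemma sgn_measurable [measurable]: "(sgn :: real^3 \<Rightarrow> real^3) \<in> borel_measurable borel"
  unfolding sgn_div_norm[abs_def] by measurable

lemma distr_lborel_orthogonal:
  fixes f :: "real^3 \<Rightarrow> real^3"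
  assumes f: "orthogonal_transformation f"
  shows "distr lborel borel f = lborel"
proof (rule lborel_eqI[symmetric])
  note fm [measurable] = orthogonal_transformation_measurable[OF f]
  show "sets (distr lborel borel f) = sets borel" by simp
  fix l u :: "real^3" assume lu: "\<And>b. b \<in> Basis \<Longrightarrow> l \<bullet> b \<le> u \<bullet> b"
  obtain g where g: "orthogonal_transformation g" "\<And>x. g (f x) = x" "\<And>y. f (g y) = y"
    using f orthogonal_transformation_bij[OF f] orthogonal_transformation_inv[OF f]
    by (metis bij_inv_eq_iff)
  \<comment> \<open>Boxes generate the Borel sets, and the invariance of their measure is known for images, so
    the preimage is written as an image under the inverse.\<close>
  have eq: "f -` box l u = g ` box l u" using g by (auto simp: image_iff) (metis)
  have "emeasure (distr lborel borel f) (box l u) = emeasure lborel (f -` box l u)"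
    by (subst emeasure_distr) auto
  also have "\<dots> = emeasure lebesgue (g ` box l u)"
    unfolding eq[symmetric] by (simp add: measurable_sets_borel[OF fm])
  also have "\<dots> = emeasure lebesgue (box l u)"
  proof -
    have "g ` box l u \<in> lmeasurable" "measure lebesgue (g ` box l u) = measure lebesgue (box l u)"
      using measurable_orthogonal_image[OF g(1)] measure_orthogonal_image[OF g(1)] by auto
    then show ?thesis by (simp add: emeasure_eq_measure2 fmeasurableD)
  qed
  also have "\<dots> = (\<Prod>b\<in>Basis. (u - l) \<bullet> b)" using lu by (simp add: emeasure_lborel_box_eq)
  finally show "emeasure (distr lborel borel f) (box l u) = (\<Prod>b\<in>Basis. (u - l) \<bullet> b)" .
qed

lemma distr_unit_ball_orthogonal:
  assumes f: "orthogonal_transformation f"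
  shows "distr unit_ball borel f = unit_ball"
proof (rule measure_eqI)
  note fm [measurable] = orthogonal_transformation_measurable[OF f]
  have [measurable]: "f \<in> borel_measurable unit_ball" by measurable
  show "sets (distr unit_ball borel f) = sets unit_ball" by simp
  fix A assume "A \<in> sets (distr unit_ball borel f)"
  then have A [measurable]: "A \<in> sets borel" by simp
  have fA: "f -` A \<in> sets borel" by (rule measurable_sets_borel[OF fm A])
  have eq: "cball 0 1 \<inter> f -` A = f -` (cball 0 1 \<inter> A)"
    using orthogonal_transformation_norm[OF f] by auto
  have "emeasure (distr unit_ball borel f) A = emeasure unit_ball (f -` A)"
    by (subst emeasure_distr) auto
  also have "\<dots> = emeasure lborel (f -` (cball 0 1 \<inter> A)) / emeasure lborel (cball (0::real^3) 1)"
    unfolding unit_ball_def using fA by (simp add: eq)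
  also have "emeasure lborel (f -` (cball 0 1 \<inter> A)) = emeasure (distr lborel borel f) (cball 0 1 \<inter> A)"
    by (subst emeasure_distr) auto
  finally show "emeasure (distr unit_ball borel f) A = emeasure unit_ball A"
    unfolding distr_lborel_orthogonal[OF f] by (simp add: unit_ball_def)
qed

text \<open>
  Orthogonal maps preserve Lebesgue measure and the ball, hence the distribution of the
  direction of a random point of the ball. All facts on spherical means below are drawn from
  this invariance.
\<close>

lemma sphere_mean_rotate:
  fixes h :: "real^3 \<Rightarrow> real"
  assumes f: "orthogonal_transformation f" and h [measurable]: "h \<in> borel_measurable borel"
  shows "(\<integral>y. h (f (sgn y)) \<partial>unit_ball) = (\<integral>y. h (sgn y) \<partial>unit_ball)"
proof -
  note fm [measurable] = orthogonal_transformation_measurable[OF f]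
  have "(\<integral>y. h (sgn y) \<partial>unit_ball) = (\<integral>y. h (sgn y) \<partial>distr unit_ball borel f)"
    by (simp add: distr_unit_ball_orthogonal[OF f])
  also have "\<dots> = (\<integral>y. h (sgn (f y)) \<partial>unit_ball)"
    by (subst integral_distr) auto
  also have "\<dots> = (\<integral>y. h (f (sgn y)) \<partial>unit_ball)"
    by (simp add: sgn_div_norm orthogonal_transformation_norm[OF f] linear_cmul[OF orthogonal_transformation_linear[OF f]])
  finally show ?thesis ..
qed

definition plane_rotation :: "real^3 \<Rightarrow> real^3 \<Rightarrow> real \<Rightarrow> real^3 \<Rightarrow> real^3" where
  "plane_rotation a b t v = v + (cos t - 1) *\<^sub>R ((v \<bullet> a) *\<^sub>R a + (v \<bullet> b) *\<^sub>R b)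
     + sin t *\<^sub>R ((v \<bullet> a) *\<^sub>R b - (v \<bullet> b) *\<^sub>R a)"

lemma plane_rotation_orthogonal:
  assumes a: "a \<bullet> a = 1" "b \<bullet> b = 1" "a \<bullet> b = 0"
  shows "orthogonal_transformation (plane_rotation a b t)"
proof -
  have lin: "linear (plane_rotation a b t)"
    by (rule linearI) (auto simp: plane_rotation_def algebra_simps inner_add_left)
  have "plane_rotation a b t v \<bullet> plane_rotation a b t v = v \<bullet> v" for v
  proof -
    define x y c s where "x = v \<bullet> a" and "y = v \<bullet> b" and "c = cos t" and "s = sin t"
    have cs: "s^2 = 1 - c^2" unfolding c_def s_def by (simp add: sin_squared_eq)
    have "plane_rotation a b t v \<bullet> plane_rotation a b t v
       = v \<bullet> v + (x^2 + y^2) * ((c - 1)^2 + s^2 + 2 * (c - 1))"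
      unfolding plane_rotation_def c_def[symmetric] s_def[symmetric]
      using a by (simp add: inner_add_left inner_add_right inner_diff_left inner_diff_right inner_commute[of b a]
          inner_commute[of a v] inner_commute[of b v] x_def[symmetric] y_def[symmetric] power2_eq_square algebra_simps)
    also have "\<dots> = v \<bullet> v" unfolding cs by (simp add: power2_eq_square algebra_simps)
    finally show ?thesis .
  qed
  then show ?thesis using lin by (simp add: orthogonal_transformation norm_eq_sqrt_inner)
qed

text \<open>
  The mean over the rotated sphere does not depend on the angle; its derivative at angle 0 is
  the mean of the derivative along the rotation field. This replaces the divergence theorem on
  the sphere.
\<close>

lemma sphere_mean_rotation_derivative:
  fixes f :: "real^3 \<Rightarrow> real"
  assumes f: "has_grad f G UNIV" and ab: "a \<bullet> a = 1" "b \<bullet> b = 1" "a \<bullet> b = 0"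
  shows "(\<integral>y. G (sgn y) \<bullet> ((sgn y \<bullet> a) *\<^sub>R b - (sgn y \<bullet> b) *\<^sub>R a) \<partial>unit_ball) = 0"
proof -
  define P where "P v = (v \<bullet> a) *\<^sub>R a + (v \<bullet> b) *\<^sub>R b" for v
  define J where "J v = (v \<bullet> a) *\<^sub>R b - (v \<bullet> b) *\<^sub>R a" for v
  have rot: "plane_rotation a b t v = v + (cos t - 1) *\<^sub>R P v + sin t *\<^sub>R J v" for t v
    by (simp add: plane_rotation_def P_def J_def)
  have [measurable]: "f \<in> borel_measurable borel" "G \<in> borel_measurable borel"
    by (intro borel_measurable_continuous_onI has_gradD[OF f])+
  have [measurable]: "P \<in> borel_measurable borel" "J \<in> borel_measurable borel"
    unfolding P_def[abs_def] J_def[abs_def] by measurable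
  have n1: "norm (plane_rotation a b t (sgn y)) \<le> 1" for t y
    using orthogonal_transformation_norm[OF plane_rotation_orthogonal[OF ab]] norm_sgn_le by metis
  have na: "norm a = 1" "norm b = 1" using ab by (auto simp: norm_eq_sqrt_inner)
  have ia: "\<bar>v \<bullet> a\<bar> \<le> norm v" "\<bar>v \<bullet> b\<bar> \<le> norm v" for v
    using Cauchy_Schwarz_ineq2[of v a] Cauchy_Schwarz_ineq2[of v b] na by auto
  have nP: "norm (P v) \<le> 2 * norm v" "norm (J v) \<le> 2 * norm v" for v
    unfolding P_def J_def
    using norm_triangle_ineq[of "(v \<bullet> a) *\<^sub>R a" "(v \<bullet> b) *\<^sub>R b"] norm_triangle_ineq4[of "(v \<bullet> a) *\<^sub>R b" "(v \<bullet> b) *\<^sub>R a"] ia[of v] na by auto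
  obtain B where B: "B > 0" "\<And>z. norm z \<le> 1 \<Longrightarrow> norm (G z) \<le> B"
    using continuous_on_UNIV_bounded[OF has_gradD(2)[OF f], of 1] by blast
  obtain B' where B': "B' > 0" "\<And>z. norm z \<le> 1 \<Longrightarrow> norm (f z) \<le> B'"
    using continuous_on_UNIV_bounded[OF has_gradD(3)[OF f], of 1] by blast
  have "((\<lambda>t. \<integral>y. f (plane_rotation a b t (sgn y)) \<partial>unit_ball) has_derivative
     (\<lambda>h. (\<integral>y. G (plane_rotation a b 0 (sgn y)) \<bullet> ((- sin 0) *\<^sub>R P (sgn y) + cos 0 *\<^sub>R J (sgn y)) \<partial>unit_ball) \<bullet> h)) (at 0 within UNIV)"
  proof (rule has_derivative_integral_dominated[where B="B * 4" and B'=B'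
        and g="\<lambda>y t. G (plane_rotation a b t (sgn y)) \<bullet> ((- sin t) *\<^sub>R P (sgn y) + cos t *\<^sub>R J (sgn y))"])
    show "finite_measure unit_ball" by unfold_locales
    show "(\<lambda>y. f (plane_rotation a b t (sgn y))) \<in> borel_measurable unit_ball" for t
      unfolding rot by measurable
    show "(\<lambda>y. G (plane_rotation a b 0 (sgn y)) \<bullet> (- sin 0 *\<^sub>R P (sgn y) + cos 0 *\<^sub>R J (sgn y))) \<in> borel_measurable unit_ball"
      unfolding rot by measurable
    show "\<bar>f (plane_rotation a b t (sgn y))\<bar> \<le> B'" for y t using B'(2)[OF n1] by simp
    show "norm (G (plane_rotation a b t (sgn y)) \<bullet> (- sin t *\<^sub>R P (sgn y) + cos t *\<^sub>R J (sgn y))) \<le> B * 4" for y t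
    proof -
      have "norm (- sin t *\<^sub>R P (sgn y) + cos t *\<^sub>R J (sgn y)) \<le> \<bar>sin t\<bar> * norm (P (sgn y)) + \<bar>cos t\<bar> * norm (J (sgn y))"
        by (rule order_trans[OF norm_triangle_ineq]) simp
      also have "\<dots> \<le> 1 * 2 + 1 * 2"
        using nP[of "sgn y"] norm_sgn_le[of y] by (intro add_mono mult_mono) (auto simp: abs_sin_le_one abs_cos_le_one)
      finally have "norm (- sin t *\<^sub>R P (sgn y) + cos t *\<^sub>R J (sgn y)) \<le> 4" by simp
      then have "norm (G (plane_rotation a b t (sgn y))) * norm (- sin t *\<^sub>R P (sgn y) + cos t *\<^sub>R J (sgn y)) \<le> B * 4"
        using B(2)[OF n1] B(1) by (intro mult_mono) auto
      then show ?thesis using Cauchy_Schwarz_ineq2 order_trans by (metis real_norm_def)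
    qed
    show "((\<lambda>t. f (plane_rotation a b t (sgn y))) has_derivative
        (\<lambda>h. (G (plane_rotation a b t (sgn y)) \<bullet> (- sin t *\<^sub>R P (sgn y) + cos t *\<^sub>R J (sgn y))) \<bullet> h)) (at t within UNIV)" for y t
    proof -
      have "((\<lambda>t. plane_rotation a b t (sgn y)) has_derivative (\<lambda>h. h *\<^sub>R (- sin t *\<^sub>R P (sgn y) + cos t *\<^sub>R J (sgn y)))) (at t)"
        unfolding rot by (auto intro!: derivative_eq_intros simp: algebra_simps)
      from has_derivative_compose[OF this, of f "\<lambda>h. G (plane_rotation a b t (sgn y)) \<bullet> h"] has_gradD(1)[OF f]
      show ?thesis by (simp add: mult.commute)
    qed
  qed auto
  moreover have "(\<lambda>t. \<integral>y. f (plane_rotation a b t (sgn y)) \<partial>unit_ball) = (\<lambda>t. \<integral>y. f (sgn y) \<partial>unit_ball)"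
    by (intro ext sphere_mean_rotate plane_rotation_orthogonal ab) measurable
  ultimately have "((\<lambda>t::real. \<integral>y. f (sgn y) \<partial>unit_ball) has_derivative
     (\<lambda>h. (\<integral>y. G (sgn y) \<bullet> J (sgn y) \<partial>unit_ball) * h)) (at 0)"
    by (simp add: rot)
  then have "(\<lambda>h. (\<integral>y. G (sgn y) \<bullet> J (sgn y) \<partial>unit_ball) * h) = (\<lambda>h::real. 0)"
    using has_derivative_unique[OF _ has_derivative_const] by blast
  from fun_cong[OF this, of 1] show ?thesis by (simp add: J_def)
qed

section \<open>The Darboux equation\<close>

definition smean :: "(real^3 \<Rightarrow> real) \<Rightarrow> real" where
  "smean f = (\<integral>y. f (sgn y) \<partial>unit_ball)"

lemma smean_integrable:
  assumes "continuous_on UNIV f" shows "integrable unit_ball (\<lambda>y. f (sgn y) :: real)"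
proof -
  obtain B where B: "B > 0" "\<And>z. norm z \<le> 1 \<Longrightarrow> norm (f z) \<le> B"
    using continuous_on_UNIV_bounded[OF assms, of 1] by blast
  have [measurable]: "f \<in> borel_measurable borel" using assms by (rule borel_measurable_continuous_onI)
  show ?thesis
    by (rule ub.integrable_const_bound[of _ B]) (use B(2)[OF norm_sgn_le] in auto)
qed

lemma smean_add: "continuous_on UNIV f \<Longrightarrow> continuous_on UNIV g \<Longrightarrow> smean (\<lambda>v. f v + g v) = smean f + smean g"
  and smean_diff: "continuous_on UNIV f \<Longrightarrow> continuous_on UNIV g \<Longrightarrow> smean (\<lambda>v. f v - g v) = smean f - smean g"
  and smean_cmult: "smean (\<lambda>v. c * f v) = c * smean f"
  and smean_const: "smean (\<lambda>v. c) = c"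
  unfolding smean_def using smean_integrable[of f] smean_integrable[of g] ub.prob_space by auto

lemma smean_cong:
  assumes "continuous_on UNIV f" "continuous_on UNIV g" "\<And>v. norm v = 1 \<Longrightarrow> f v = g v"
  shows "smean f = smean g"
  unfolding smean_def
proof (rule integral_cong_AE)
  show "(\<lambda>y. f (sgn y)) \<in> borel_measurable unit_ball" "(\<lambda>y. g (sgn y)) \<in> borel_measurable unit_ball"
    using smean_integrable assms by blast+
  have "AE y in lborel. y \<noteq> (0::real^3)" by (rule AE_lborel_singleton)
  then have "AE y in unit_ball. y \<noteq> 0" unfolding unit_ball_def by (intro AE_uniform_measureI) auto
  then show "AE y in unit_ball. f (sgn y) = g (sgn y)"
    by eventually_elim (simp add: assms(3) norm_sgn)
qed

lemma smean_sum:
  assumes "\<And>i. i \<in> I \<Longrightarrow> continuous_on UNIV (f i)"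
  shows "smean (\<lambda>v. \<Sum>i\<in>I. f i v) = (\<Sum>i\<in>I. smean (f i))"
  using assms
proof (induction I rule: infinite_finite_induct)
  case (insert x F)
  then show ?case by (simp add: smean_add continuous_on_sum)
qed (auto simp: smean_const)

lemma smean_rotation:
  assumes "has_grad f G UNIV" "a \<bullet> a = 1" "b \<bullet> b = 1" "a \<bullet> b = 0"
  shows "smean (\<lambda>v. G v \<bullet> ((v \<bullet> a) *\<^sub>R b - (v \<bullet> b) *\<^sub>R a)) = 0"
  unfolding smean_def by (rule sphere_mean_rotation_derivative[OF assms])

lemma has_grad_scaled:
  fixes f :: "real^3 \<Rightarrow> real"
  assumes "has_grad f G UNIV"
  shows "has_grad (\<lambda>v. f (x + r *\<^sub>R v)) (\<lambda>v. r *\<^sub>R G (x + r *\<^sub>R v)) UNIV"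
  by (rule has_grad_affine_compose[OF assms, where L="\<lambda>v. r *\<^sub>R v"])
    (auto intro!: continuous_intros bounded_linear_scaleR_right)

lemma continuous_on_scaled:
  fixes f :: "real^3 \<Rightarrow> 'b::topological_space"
  assumes "continuous_on UNIV f" shows "continuous_on UNIV (\<lambda>v. f (x + r *\<^sub>R v))"
  by (rule continuous_on_compose2[OF assms]) (auto intro!: continuous_intros)

lemma smean_radial_derivative:
  assumes f: "has_grad f g UNIV" and \<phi>: "continuous_on UNIV \<phi>"
  shows "((\<lambda>r. smean (\<lambda>v. \<phi> v * f (x + r *\<^sub>R v))) has_real_derivative
     smean (\<lambda>v. \<phi> v * (g (x + r *\<^sub>R v) \<bullet> v))) (at r)"
proof -
  let ?I = "{r - 1<..<r + 1}"
  have small: "norm (x + s *\<^sub>R sgn y) \<le> norm x + \<bar>r\<bar> + 1" if "s \<in> ?I" for s and y :: "real^3"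
  proof -
    have "norm (s *\<^sub>R sgn y) \<le> \<bar>s\<bar> * 1" unfolding norm_scaleR by (intro mult_left_mono norm_sgn_le) auto
    then show ?thesis using norm_triangle_ineq[of x "s *\<^sub>R sgn y"] that by auto
  qed
  obtain B where B: "B > 0" "\<And>z. norm z \<le> norm x + \<bar>r\<bar> + 1 \<Longrightarrow> norm (g z) \<le> B"
    using continuous_on_UNIV_bounded[OF has_gradD(2)[OF f]] by blast
  obtain B' where B': "B' > 0" "\<And>z. norm z \<le> norm x + \<bar>r\<bar> + 1 \<Longrightarrow> norm (f z) \<le> B'"
    using continuous_on_UNIV_bounded[OF has_gradD(3)[OF f]] by blast
  obtain P where P: "P > 0" "\<And>z. norm z \<le> 1 \<Longrightarrow> norm (\<phi> z) \<le> P"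
    using continuous_on_UNIV_bounded[OF \<phi>] by blast
  have [measurable]: "f \<in> borel_measurable borel" "g \<in> borel_measurable borel" "\<phi> \<in> borel_measurable borel"
    by (intro borel_measurable_continuous_onI has_gradD[OF f] \<phi>)+
  have "((\<lambda>r. \<integral>y. \<phi> (sgn y) * f (x + r *\<^sub>R sgn y) \<partial>unit_ball) has_derivative
     (\<lambda>h. (\<integral>y. \<phi> (sgn y) * (g (x + r *\<^sub>R sgn y) \<bullet> sgn y) \<partial>unit_ball) \<bullet> h)) (at r within ?I)"
  proof (rule has_derivative_integral_dominated[where B="P * B" and B'="P * B'" and g="\<lambda>y r. \<phi> (sgn y) * (g (x + r *\<^sub>R sgn y) \<bullet> sgn y)"])
    show "finite_measure unit_ball" by unfold_locales
    show "((\<lambda>r. \<phi> (sgn y) * f (x + r *\<^sub>R sgn y)) has_derivative (\<lambda>h. (\<phi> (sgn y) * (g (x + s *\<^sub>R sgn y) \<bullet> sgn y)) \<bullet> h)) (at s within ?I)" for y s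
    proof -
      have "((\<lambda>r. x + r *\<^sub>R sgn y) has_derivative (\<lambda>h. h *\<^sub>R sgn y)) (at s within ?I)"
        by (auto intro!: derivative_eq_intros)
      from has_derivative_compose[OF this, of f "\<lambda>h. g (x + s *\<^sub>R sgn y) \<bullet> h"] has_gradD(1)[OF f]
      have "((\<lambda>r. f (x + r *\<^sub>R sgn y)) has_derivative (\<lambda>h. g (x + s *\<^sub>R sgn y) \<bullet> (h *\<^sub>R sgn y))) (at s within ?I)" by simp
      from has_derivative_mult_right[OF this, of "\<phi> (sgn y)"] show ?thesis by (simp add: ac_simps)
    qed
    show "norm (\<phi> (sgn y) * (g (x + s *\<^sub>R sgn y) \<bullet> sgn y)) \<le> P * B" if "s \<in> ?I" for y s
    proof -
      have "\<bar>g (x + s *\<^sub>R sgn y) \<bullet> sgn y\<bar> \<le> B * 1"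
        by (rule order_trans[OF Cauchy_Schwarz_ineq2], rule mult_mono[OF B(2)[OF small[OF that]] norm_sgn_le]) (use B in auto)
      then show ?thesis unfolding real_norm_def abs_mult
        using P(2)[OF norm_sgn_le, of y] P(1) by (intro mult_mono) auto
    qed
    show "\<bar>\<phi> (sgn y) * f (x + s *\<^sub>R sgn y)\<bar> \<le> P * B'" if "s \<in> ?I" for y s
      unfolding abs_mult using P(2)[OF norm_sgn_le, of y] P(1) B'(2)[OF small[OF that], of y] by (intro mult_mono) auto
  qed auto
  then have "((\<lambda>r. \<integral>y. \<phi> (sgn y) * f (x + r *\<^sub>R sgn y) \<partial>unit_ball) has_derivative
     (\<lambda>h. (\<integral>y. \<phi> (sgn y) * (g (x + r *\<^sub>R sgn y) \<bullet> sgn y) \<partial>unit_ball) \<bullet> h)) (at r)"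
    by (simp add: at_within_open[of r ?I])
  then show ?thesis unfolding smean_def has_field_derivative_def by simp
qed

lemma sum_Basis_3:
  fixes f :: "real^3 \<Rightarrow> 'b::comm_monoid_add"
  shows "(\<Sum>b\<in>Basis. f b) = f (axis 1 1) + f (axis 2 1) + f (axis 3 1)"
proof -
  have B: "(Basis :: (real^3) set) = {axis 1 1, axis 2 1, axis 3 1}"
    unfolding Basis_vec_def by (auto simp: UNIV_3)
  have "axis 1 1 \<noteq> (axis 2 1 :: real^3)" "axis 1 1 \<noteq> (axis 3 1 :: real^3)" "axis 2 1 \<noteq> (axis 3 1 :: real^3)"
    by (auto simp: axis_eq_axis)
  then show ?thesis unfolding B by (simp add: ac_simps)
qed

text \<open>
  The rotation field of the plane of \<open>a\<close> and \<open>b\<close> is a first order operator whose image has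
  mean zero. Applying this to the derivative of \<open>h (x + r v)\<close> along that field gives its
  square, written out here.
\<close>

lemma darboux_plane:
  fixes h :: "real^3 \<Rightarrow> real"
  assumes h: "has_grad h g UNIV" and H: "\<And>b. has_grad (\<lambda>x. g x \<bullet> b) (H b) UNIV"
    and ab: "a \<bullet> a = 1" "b \<bullet> b = 1" "a \<bullet> b = 0"
  shows "smean (\<lambda>v. r * (r * ((v \<bullet> a)\<^sup>2 * (H b (x + r *\<^sub>R v) \<bullet> b) + (v \<bullet> b)\<^sup>2 * (H a (x + r *\<^sub>R v) \<bullet> a)
       - (v \<bullet> a) * (v \<bullet> b) * (H b (x + r *\<^sub>R v) \<bullet> a + H a (x + r *\<^sub>R v) \<bullet> b))
     - ((g (x + r *\<^sub>R v) \<bullet> a) * (v \<bullet> a) + (g (x + r *\<^sub>R v) \<bullet> b) * (v \<bullet> b)))) = 0"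
proof -
  note G = has_grad_scaled[OF H, where x=x and r=r]
  have f: "has_grad (\<lambda>v. r * ((a \<bullet> v) * (g (x + r *\<^sub>R v) \<bullet> b) - (b \<bullet> v) * (g (x + r *\<^sub>R v) \<bullet> a)))
     (\<lambda>v. r *\<^sub>R (((a \<bullet> v) *\<^sub>R r *\<^sub>R H b (x + r *\<^sub>R v) + (g (x + r *\<^sub>R v) \<bullet> b) *\<^sub>R a)
         - ((b \<bullet> v) *\<^sub>R r *\<^sub>R H a (x + r *\<^sub>R v) + (g (x + r *\<^sub>R v) \<bullet> a) *\<^sub>R b))
       + ((a \<bullet> v) * (g (x + r *\<^sub>R v) \<bullet> b) - (b \<bullet> v) * (g (x + r *\<^sub>R v) \<bullet> a)) *\<^sub>R 0) UNIV"
    by (intro has_grad_mult has_grad_diff has_grad_inner has_grad_const G)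
  have ba: "b \<bullet> a = 0" using ab by (simp add: inner_commute)
  have comm: "a \<bullet> v = v \<bullet> a" "b \<bullet> v = v \<bullet> b" for v by (simp_all add: inner_commute)
  have alg: "(r *\<^sub>R ((p *\<^sub>R r *\<^sub>R Hb + gb *\<^sub>R a) - (q *\<^sub>R r *\<^sub>R Ha + ga *\<^sub>R b)) + c *\<^sub>R 0) \<bullet> (p *\<^sub>R b - q *\<^sub>R a)
     = r * (r * (p\<^sup>2 * (Hb \<bullet> b) + q\<^sup>2 * (Ha \<bullet> a) - p * q * (Hb \<bullet> a + Ha \<bullet> b)) - (ga * p + gb * q))"
    for p q ga gb c :: real and Ha Hb
    unfolding inner_add_left inner_diff_left inner_diff_right inner_scaleR_left inner_scaleR_right
      ab ba inner_zero_left
    by (simp add: power2_eq_square algebra_simps)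
  show ?thesis using smean_rotation[OF f ab] unfolding comm alg .
qed

lemma sphere_first_moment: "smean (\<lambda>v. v \<bullet> w) = 0"
proof -
  have orth: "smean (\<lambda>v. v \<bullet> a) = 0" if ab: "a \<bullet> a = 1" "b \<bullet> b = 1" "a \<bullet> b = 0" for a b :: "real^3"
    using smean_rotation[OF has_grad_inner[of b UNIV] ab] ab
    by (simp add: inner_diff_right inner_commute[of b a])
  have ax: "smean (\<lambda>v. v \<bullet> axis 1 1) = 0" "smean (\<lambda>v. v \<bullet> axis 2 1) = 0" "smean (\<lambda>v. v \<bullet> axis 3 1) = 0"
    using orth[of "axis 1 1" "axis 2 1"] orth[of "axis 2 1" "axis 1 1"] orth[of "axis 3 1" "axis 1 1"]
    by (auto simp: inner_axis_axis)
  have "smean (\<lambda>v. v \<bullet> w) = smean (\<lambda>v. \<Sum>b\<in>Basis. (w \<bullet> b) * (v \<bullet> b))"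
    by (subst euclidean_inner) (simp add: mult.commute)
  also have "\<dots> = (\<Sum>b\<in>Basis. (w \<bullet> b) * smean (\<lambda>v. v \<bullet> b))"
    by (subst smean_sum) (auto intro!: continuous_intros simp: smean_cmult)
  also have "\<dots> = 0" unfolding sum_Basis_3 ax by simp
  finally show ?thesis .
qed

text \<open>
  The sum of the squares of the three rotation fields is the Laplace-Beltrami operator of the
  sphere, and the Laplacian differs from it (divided by \<open>r^2\<close>) exactly by the radial part
  \<open>h_rr + (2/r) h_r\<close>. The mean of the former vanishes, plane by plane.
\<close>

lemma darboux:
  fixes h :: "real^3 \<Rightarrow> real"
  assumes h: "has_grad h g UNIV" and H: "\<And>b. has_grad (\<lambda>x. g x \<bullet> b) (H b) UNIV"
  shows "2 * smean (\<lambda>v. g (x + r *\<^sub>R v) \<bullet> v)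
      + r * smean (\<lambda>v. \<Sum>a\<in>Basis. \<Sum>b\<in>Basis. (v \<bullet> a) * (v \<bullet> b) * (H a (x + r *\<^sub>R v) \<bullet> b))
    = r * smean (\<lambda>v. \<Sum>b\<in>Basis. H b (x + r *\<^sub>R v) \<bullet> b)"
proof (cases "r = 0")
  case True
  then show ?thesis using sphere_first_moment[of "g x"] by (simp add: inner_commute)
next
  case False
  have gc: "continuous_on UNIV (\<lambda>v. g (x + r *\<^sub>R v))" by (rule continuous_on_scaled[OF has_gradD(2)[OF h]])
  have Hc: "continuous_on UNIV (\<lambda>v. H b (x + r *\<^sub>R v))" for b by (rule continuous_on_scaled[OF has_gradD(2)[OF H]])
  \<comment> \<open>Both sides are compared on the unit sphere, where the squares of the coordinates add up to
    1.\<close>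
  define e1 e2 e3 :: "real^3" where "e1 = axis 1 1" and "e2 = axis 2 1" and "e3 = axis 3 1"
  note e = e1_def e2_def e3_def
  have o: "e1 \<bullet> e1 = 1" "e2 \<bullet> e2 = 1" "e3 \<bullet> e3 = 1" "e1 \<bullet> e2 = 0" "e1 \<bullet> e3 = 0" "e2 \<bullet> e3 = 0"
    by (auto simp: e inner_axis_axis)
  define D where "D a b v = r * (r * ((v \<bullet> a)\<^sup>2 * (H b (x + r *\<^sub>R v) \<bullet> b) + (v \<bullet> b)\<^sup>2 * (H a (x + r *\<^sub>R v) \<bullet> a)
       - (v \<bullet> a) * (v \<bullet> b) * (H b (x + r *\<^sub>R v) \<bullet> a + H a (x + r *\<^sub>R v) \<bullet> b))
     - ((g (x + r *\<^sub>R v) \<bullet> a) * (v \<bullet> a) + (g (x + r *\<^sub>R v) \<bullet> b) * (v \<bullet> b)))" for a b v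
  have Dc: "continuous_on UNIV (D a b)" for a b
    unfolding D_def by (intro continuous_intros gc Hc)
  define T where "T v = (\<Sum>b\<in>Basis. H b (x + r *\<^sub>R v) \<bullet> b)" for v
  define Q where "Q v = (\<Sum>a\<in>Basis. \<Sum>b\<in>Basis. (v \<bullet> a) * (v \<bullet> b) * (H a (x + r *\<^sub>R v) \<bullet> b))" for v
  define W where "W v = g (x + r *\<^sub>R v) \<bullet> v" for v
  have TQW: "continuous_on UNIV T" "continuous_on UNIV Q" "continuous_on UNIV W"
    unfolding T_def Q_def W_def by (intro continuous_intros gc Hc)+
  have "smean (\<lambda>v. D e1 e2 v + D e1 e3 v + D e2 e3 v) = smean (D e1 e2) + smean (D e1 e3) + smean (D e2 e3)"
    using Dc by (simp add: smean_add continuous_on_add)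
  also have "\<dots> = 0"
    using darboux_plane[OF h H, of e1 e2 r x] darboux_plane[OF h H, of e1 e3 r x] darboux_plane[OF h H, of e2 e3 r x] o
    by (simp add: D_def[abs_def])
  also have "smean (\<lambda>v. D e1 e2 v + D e1 e3 v + D e2 e3 v) = smean (\<lambda>v. r * (r * T v - r * Q v - 2 * W v))"
  proof (rule smean_cong)
    fix v :: "real^3" assume "norm v = 1"
    then have "v \<bullet> v = 1" by (simp add: norm_eq_sqrt_inner)
    moreover have "v \<bullet> v = (\<Sum>b\<in>Basis. (v \<bullet> b) * (v \<bullet> b))" by (rule euclidean_inner)
    ultimately have vv: "(v \<bullet> e3)\<^sup>2 = 1 - (v \<bullet> e1)\<^sup>2 - (v \<bullet> e2)\<^sup>2" by (simp add: sum_Basis_3 e power2_eq_square)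
    have W: "W v = (g (x + r *\<^sub>R v) \<bullet> e1) * (v \<bullet> e1) + (g (x + r *\<^sub>R v) \<bullet> e2) * (v \<bullet> e2) + (g (x + r *\<^sub>R v) \<bullet> e3) * (v \<bullet> e3)"
      unfolding W_def by (subst euclidean_inner) (simp add: sum_Basis_3 e)
    define h11 h22 h33 where "h11 = H e1 (x + r *\<^sub>R v) \<bullet> e1" and "h22 = H e2 (x + r *\<^sub>R v) \<bullet> e2" and "h33 = H e3 (x + r *\<^sub>R v) \<bullet> e3"
    define v1 v2 v3 where "v1 = v \<bullet> e1" and "v2 = v \<bullet> e2" and "v3 = v \<bullet> e3"
    have v3: "v3\<^sup>2 = 1 - v1\<^sup>2 - v2\<^sup>2" using vv by (simp add: v1_def v2_def v3_def)
    have T: "T v = h11 + h22 + h33" unfolding T_def sum_Basis_3 by (simp add: e h11_def h22_def h33_def)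
    have Q: "Q v = v1\<^sup>2 * h11 + v2\<^sup>2 * h22 + v3\<^sup>2 * h33
       + v1 * v2 * (H e1 (x + r *\<^sub>R v) \<bullet> e2 + H e2 (x + r *\<^sub>R v) \<bullet> e1)
       + v1 * v3 * (H e1 (x + r *\<^sub>R v) \<bullet> e3 + H e3 (x + r *\<^sub>R v) \<bullet> e1)
       + v2 * v3 * (H e2 (x + r *\<^sub>R v) \<bullet> e3 + H e3 (x + r *\<^sub>R v) \<bullet> e2)"
      unfolding Q_def sum_Basis_3 e[symmetric] v1_def v2_def v3_def h11_def h22_def h33_def
      by (simp add: power2_eq_square algebra_simps)
    show "D e1 e2 v + D e1 e3 v + D e2 e3 v = r * (r * T v - r * Q v - 2 * W v)"
      unfolding T Q W D_def v1_def[symmetric] v2_def[symmetric] v3_def[symmetric] h11_def[symmetric] h22_def[symmetric] h33_def[symmetric] v3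
      by (simp add: algebra_simps)
  qed (intro continuous_intros Dc TQW)+
  also have "\<dots> = r * (r * smean T - r * smean Q - 2 * smean W)"
    using TQW by (simp add: smean_cmult smean_diff continuous_on_diff continuous_on_mult)
  finally show ?thesis using False unfolding T_def[abs_def] Q_def[abs_def] W_def[abs_def] by simp
qed

text \<open>
  With \<open>M(r)\<close> the spherical mean of \<open>h\<close> around \<open>x\<close>, the function \<open>r M(r)\<close> solves the
  one-dimensional wave equation in \<open>r\<close>: this is the reason for Kirchhoff's formula.
\<close>

lemma spherical_mean_wave:
  fixes h :: "real^3 \<Rightarrow> real"
  assumes h: "has_grad h g UNIV" and H: "\<And>b. has_grad (\<lambda>x. g x \<bullet> b) (H b) UNIV"
  shows "((\<lambda>r. r * smean (\<lambda>v. h (x + r *\<^sub>R v))) has_real_derivative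
      smean (\<lambda>v. h (x + r *\<^sub>R v)) + r * smean (\<lambda>v. g (x + r *\<^sub>R v) \<bullet> v)) (at r)" (is ?A)
    and "((\<lambda>r. smean (\<lambda>v. h (x + r *\<^sub>R v)) + r * smean (\<lambda>v. g (x + r *\<^sub>R v) \<bullet> v)) has_real_derivative
      r * smean (\<lambda>v. \<Sum>b\<in>Basis. H b (x + r *\<^sub>R v) \<bullet> b)) (at r)" (is ?B)
proof -
  have gc: "continuous_on UNIV (\<lambda>v. g (x + r *\<^sub>R v))" for r by (rule continuous_on_scaled[OF has_gradD(2)[OF h]])
  have Hc: "continuous_on UNIV (\<lambda>v. H b (x + r *\<^sub>R v))" for b r by (rule continuous_on_scaled[OF has_gradD(2)[OF H]])
  have d0: "((\<lambda>r. smean (\<lambda>v. h (x + r *\<^sub>R v))) has_real_derivative smean (\<lambda>v. g (x + r *\<^sub>R v) \<bullet> v)) (at r)"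
    using smean_radial_derivative[OF h continuous_on_const[of _ 1]] by simp
  show ?A using DERIV_mult[OF DERIV_ident d0] by (simp add: add.commute mult.commute)
  have eq: "smean (\<lambda>v. g (x + r *\<^sub>R v) \<bullet> v) = (\<Sum>a\<in>Basis. smean (\<lambda>v. (v \<bullet> a) * (g (x + r *\<^sub>R v) \<bullet> a)))" for r
  proof -
    have "smean (\<lambda>v. g (x + r *\<^sub>R v) \<bullet> v) = smean (\<lambda>v. \<Sum>a\<in>Basis. (v \<bullet> a) * (g (x + r *\<^sub>R v) \<bullet> a))"
      by (subst euclidean_inner) (simp add: mult.commute)
    then show ?thesis by (subst (asm) smean_sum) (auto intro!: continuous_intros gc)
  qed
  have "((\<lambda>r. \<Sum>a\<in>Basis. smean (\<lambda>v. (v \<bullet> a) * (g (x + r *\<^sub>R v) \<bullet> a))) has_real_derivative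
      (\<Sum>a\<in>Basis. smean (\<lambda>v. (v \<bullet> a) * (H a (x + r *\<^sub>R v) \<bullet> v)))) (at r)"
    by (intro DERIV_sum smean_radial_derivative H continuous_intros)
  also have "(\<Sum>a\<in>Basis. smean (\<lambda>v. (v \<bullet> a) * (H a (x + r *\<^sub>R v) \<bullet> v)))
     = smean (\<lambda>v. \<Sum>a\<in>Basis. \<Sum>b\<in>Basis. (v \<bullet> a) * (v \<bullet> b) * (H a (x + r *\<^sub>R v) \<bullet> b))"
  proof -
    have "(v \<bullet> a) * (H a (x + r *\<^sub>R v) \<bullet> v) = (\<Sum>b\<in>Basis. (v \<bullet> a) * (v \<bullet> b) * (H a (x + r *\<^sub>R v) \<bullet> b))" for a v
      by (subst (2) euclidean_inner) (simp add: sum_distrib_left ac_simps)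
    then show ?thesis by (subst smean_sum) (auto intro!: continuous_intros Hc)
  qed
  finally have d1: "((\<lambda>r. smean (\<lambda>v. g (x + r *\<^sub>R v) \<bullet> v)) has_real_derivative
     smean (\<lambda>v. \<Sum>a\<in>Basis. \<Sum>b\<in>Basis. (v \<bullet> a) * (v \<bullet> b) * (H a (x + r *\<^sub>R v) \<bullet> b))) (at r)"
    unfolding eq[symmetric] .
  from DERIV_add[OF d0 DERIV_mult[OF DERIV_ident d1]] darboux[OF h H, of x r]
  show ?B by (simp add: algebra_simps)
qed

lemma smean_continuous:
  fixes f :: "(real^3) \<times> real \<Rightarrow> real"
  assumes f: "continuous_on Slab f" and \<phi>: "continuous_on UNIV \<phi>"
  shows "continuous_on ({-B..B} \<times> {0..B}) (\<lambda>(r, s). smean (\<lambda>v. \<phi> v * f (x + r *\<^sub>R v, s)))"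
proof -
  have cl: "closed Slab" by (intro closed_Times) auto
  obtain N where N: "N > 0" "\<And>z. z \<in> Slab \<Longrightarrow> norm z \<le> norm x + B + B \<Longrightarrow> norm (f z) \<le> N"
    using continuous_on_closed_bounded[OF f cl] by blast
  obtain P where P: "P > 0" "\<And>z. norm z \<le> 1 \<Longrightarrow> norm (\<phi> z) \<le> P"
    using continuous_on_UNIV_bounded[OF \<phi>] by blast
  have [measurable]: "\<phi> \<in> borel_measurable borel"
    by (intro borel_measurable_continuous_onI \<phi>)
  have "continuous_on ({-B..B} \<times> {0..B}) (\<lambda>z. \<integral>y. \<phi> (sgn y) * f (x + fst z *\<^sub>R sgn y, snd z) \<partial>unit_ball)"
  proof (rule continuous_on_integral_dominated[where B="P * N"])
    show "finite_measure unit_ball" by unfold_locales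
    show "(\<lambda>y. \<phi> (sgn y) * f (x + fst z *\<^sub>R sgn y, snd z)) \<in> borel_measurable unit_ball" if "z \<in> {-B..B} \<times> {0..B}" for z
    proof -
      have "continuous_on UNIV (\<lambda>v. f (x + fst z *\<^sub>R v, snd z))"
        by (rule continuous_on_compose2[OF f]) (use that in \<open>auto intro!: continuous_intros\<close>)
      then have [measurable]: "(\<lambda>v. f (x + fst z *\<^sub>R v, snd z)) \<in> borel_measurable borel"
        by (rule borel_measurable_continuous_onI)
      show ?thesis by measurable
    qed
    show "continuous_on ({-B..B} \<times> {0..B}) (\<lambda>z. \<phi> (sgn y) * f (x + fst z *\<^sub>R sgn y, snd z))" for y
      by (intro continuous_intros continuous_on_compose2[OF f]) auto
    show "norm (\<phi> (sgn y) * f (x + fst z *\<^sub>R sgn y, snd z)) \<le> P * N" if z: "z \<in> {-B..B} \<times> {0..B}" for y z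
    proof -
      have "norm (fst z *\<^sub>R sgn y) \<le> \<bar>fst z\<bar> * 1" unfolding norm_scaleR by (intro mult_left_mono norm_sgn_le) auto
      then have "norm (x + fst z *\<^sub>R sgn y) \<le> norm x + B" using norm_triangle_ineq[of x "fst z *\<^sub>R sgn y"] z by auto
      then have "norm (x + fst z *\<^sub>R sgn y, snd z) \<le> norm x + B + B"
        using norm_prod_le[of "(x + fst z *\<^sub>R sgn y, snd z)"] z by auto
      then have "norm (f (x + fst z *\<^sub>R sgn y, snd z)) \<le> N" using N(2) z by auto
      then show ?thesis unfolding norm_mult
        using P(2)[OF norm_sgn_le, of y] P(1) by (intro mult_mono) auto
    qed
  qed
  then show ?thesis by (simp add: smean_def split_beta)
qed

lemma smean_retarded_continuous:
  fixes f :: "(real^3) \<times> real \<Rightarrow> real"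
  assumes f: "continuous_on Slab f" and t: "0 \<le> t"
  shows "continuous_on {0..t} (\<lambda>\<tau>. smean (\<lambda>v. f (x + (t - \<tau>) *\<^sub>R v, \<tau>)))"
proof -
  have "continuous_on {0..t} (\<lambda>\<tau>. (\<lambda>(r, s). smean (\<lambda>v. 1 * f (x + r *\<^sub>R v, s))) (t - \<tau>, \<tau>))"
    by (rule continuous_on_compose2[OF smean_continuous[OF f, of "\<lambda>_. 1" t x]])
      (use t in \<open>auto intro!: continuous_intros\<close>)
  then show ?thesis by simp
qed

section \<open>The Duhamel integral solves the wave equation\<close>

lemma integral_unit_interval:
  fixes J :: "real \<Rightarrow> real"
  assumes J: "continuous_on UNIV J"
  shows "(\<integral>s. J s \<partial>uniform_measure lborel {0..1}) = integral {0..1} J"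
proof -
  have [measurable]: "J \<in> borel_measurable borel" using J by (rule borel_measurable_continuous_onI)
  have "uniform_measure lborel {0..1::real} = density lborel (\<lambda>s. ennreal (indicator {0..1} s))"
    unfolding uniform_measure_def by (intro density_cong) (auto simp: indicator_def)
  then have "(\<integral>s. J s \<partial>uniform_measure lborel {0..1}) = (\<integral>s. indicator {0..1} s *\<^sub>R J s \<partial>lborel)"
    by (simp add: integral_density)
  also have "\<dots> = integral {0..1} J"
    using set_borel_integral_eq_integral(2)[OF borel_integrable_atLeastAtMost'[of 0 1 J]] continuous_on_subset[OF J]
    by (simp add: set_lebesgue_integral_def)
  finally show ?thesis .
qed

text \<open>
  Fubini in the two parameters of the cone, and the substitution \<open>\<tau> = t (1 - s)\<close>.
\<close>

lemma duhamel_eq_integral: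
  assumes F: "continuous_on Slab F" and t: "0 \<le> t"
  shows "wave.duhamel F (x, t) = integral {0..t} (\<lambda>\<tau>. (t - \<tau>) * smean (\<lambda>v. F (x + (t - \<tau>) *\<^sub>R v, \<tau>)))"
proof (cases "t = 0")
  case True
  then show ?thesis by (simp add: wave.duhamel_def inner_prod_def)
next
  case False
  with t have t: "0 < t" by simp
  define q where "q \<tau> = (t - \<tau>) * smean (\<lambda>v. F (x + (t - \<tau>) *\<^sub>R v, \<tau>))" for \<tau>
  have qc: "continuous_on {0..t} q"
    unfolding q_def using t by (intro continuous_intros smean_retarded_continuous F) auto
  define cl where "cl s = max 0 (min 1 s)" for s :: real
  define J where "J s = q (t * (1 - cl s)) / t" for s
  have Jc: "continuous_on UNIV J" unfolding J_def
    by (intro continuous_on_divide continuous_intros continuous_on_compose2[OF qc])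
      (use t in \<open>auto simp: cl_def intro!: continuous_intros mult_left_le\<close>)
  have "wave.avg F (x, t) = (\<integral>p. retard p * F (cone_map p (x, t)) \<partial>cone_measure)"
    by (simp add: wave.avg_def)
  also have "\<dots> = (\<integral>s. (\<integral>y. retard (s, y) * F (cone_map (s, y) (x, t)) \<partial>unit_ball) \<partial>uniform_measure lborel {0..1})"
    unfolding cone_measure_def
    by (rule pp.integral_fst'[symmetric], fold cone_measure_def, rule wave.avg_integrable[OF F]) (use t in auto)
  also have "(\<lambda>s. \<integral>y. retard (s, y) * F (cone_map (s, y) (x, t)) \<partial>unit_ball) = J"
  proof
    fix s
    show "(\<integral>y. retard (s, y) * F (cone_map (s, y) (x, t)) \<partial>unit_ball) = J s"
      using t by (simp add: retard_def cone_map_def cl_def J_def q_def smean_def algebra_simps)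
  qed
  also have "(\<integral>s. J s \<partial>uniform_measure lborel {0..1}) = integral {0..1} J"
    by (rule integral_unit_interval[OF Jc])
  also have "\<dots> = integral {0..1} (\<lambda>s. q (- t * s + t) / t)"
    by (rule integral_cong) (simp add: J_def cl_def algebra_simps)
  also have "\<dots> = integral {0..t} q / t\<^sup>2"
  proof -
    have "(q has_integral integral {0..t} q) (cbox 0 t)"
      using qc by (simp add: integrable_continuous_real integrable_integral)
    from has_integral_affinity[OF this, of "-t" t] t
    have "((\<lambda>s. q (- t * s + t)) has_integral (1 / t) * integral {0..t} q) ((\<lambda>s. - s / t + 1) ` {0..t})"
      by (simp add: divide_inverse mult.commute)
    moreover have "(\<lambda>s. - s / t + 1) ` {0..t} = {0..1}"
    proof
      show "{0..1} \<subseteq> (\<lambda>s. - s / t + 1) ` {0..t}"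
      proof
        fix y :: real assume "y \<in> {0..1}"
        then show "y \<in> (\<lambda>s. - s / t + 1) ` {0..t}"
          using t by (intro image_eqI[of _ _ "t * (1 - y)"]) (auto simp: mult_left_le)
      qed
    qed (use t in auto)
    ultimately have "((\<lambda>s. q (- t * s + t)) has_integral (1 / t) * integral {0..t} q) {0..1}" by simp
    from integral_unique[OF has_integral_divide[OF this, of t]]
    show ?thesis by (simp add: power2_eq_square)
  qed
  finally show ?thesis using t unfolding wave.duhamel_def q_def by (simp add: inner_prod_def)
qed

lemma has_grad_space_slice:
  assumes "has_grad f G Slab" "0 \<le> s"
  shows "has_grad (\<lambda>x. f (x, s)) (\<lambda>x. fst (G (x, s))) UNIV"
proof -
  have "has_grad (\<lambda>x. f ((0, s) + (x, 0))) (\<lambda>x. fst (G ((0, s) + (x, 0)))) UNIV"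
    by (rule has_grad_affine_compose[OF assms(1)])
      (use assms(2) in \<open>auto simp: inner_prod_def intro!: continuous_intros bounded_linear_Pair bounded_linear_ident bounded_linear_zero\<close>)
  then show ?thesis by simp
qed

lemma has_grad_time_derivative:
  assumes f: "has_grad f G Slab" and t: "0 \<le> t"
  shows "((\<lambda>s. f (x, s)) has_real_derivative G (x, t) \<bullet> (0, 1)) (at t within {0..})"
proof -
  have "((\<lambda>s. (x, s)) has_derivative (\<lambda>h. (0, h))) (at t within {0..})"
    by (intro has_derivative_Pair derivative_intros)
  from has_derivative_in_compose[OF this, of f "\<lambda>h. G (x, t) \<bullet> h"] has_derivative_subset[OF has_gradD(1)[OF f, of "(x, t)"], of "Pair x ` {0..}"] t
  show ?thesis by (auto simp: has_field_derivative_def inner_prod_def)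
qed

lemma time_deriv_eqI:
  assumes "(u x has_real_derivative d) (at t within {0..})" "0 \<le> t"
  shows "time_deriv u x t = d"
proof -
  have "at_right t \<le> at t within {0..}" using assms(2) by (intro at_le) auto
  then have "at t within {0..} \<noteq> bot" using trivial_limit_at_right_real[of t] by (metis bot.extremum_uniqueI)
  then show ?thesis using assms(1) unfolding time_deriv_def
    by (simp add: vector_derivative_within has_real_derivative_iff_has_vector_derivative)
qed

lemma partial_deriv_Slab:
  assumes "has_grad f G Slab" "0 \<le> t"
  shows "partial_deriv b (\<lambda>y. f (y, t)) x = G (x, t) \<bullet> (b, 0)"
proof -
  have "((\<lambda>s. x + s *\<^sub>R b) has_derivative (\<lambda>h. h *\<^sub>R b)) (at 0)"
    by (auto intro!: derivative_eq_intros)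
  from has_derivative_compose[OF this, of "\<lambda>y. f (y, t)" "\<lambda>h. fst (G (x, t)) \<bullet> h"] has_gradD(1)[OF has_grad_space_slice[OF assms], of x]
  have "((\<lambda>s. f (x + s *\<^sub>R b, t)) has_derivative (\<lambda>h. fst (G (x, t)) \<bullet> (h *\<^sub>R b))) (at 0)" by simp
  then have "((\<lambda>s. f (x + s *\<^sub>R b, t)) has_real_derivative (fst (G (x, t)) \<bullet> b)) (at 0)"
    unfolding has_field_derivative_def by (rule has_derivative_eq_rhs) (simp add: fun_eq_iff)
  then show ?thesis unfolding partial_deriv_def by (simp add: DERIV_imp_deriv inner_prod_def)
qed

lemma laplacian_Slab:
  assumes "has_grad f G Slab" "\<And>b. has_grad (\<lambda>z. G z \<bullet> (b, 0)) (H b) Slab" "0 \<le> t"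
  shows "laplacian (\<lambda>y. f (y, t)) x = (\<Sum>b\<in>Basis. H b (x, t) \<bullet> (b, 0))"
proof -
  have "partial_deriv b (\<lambda>y. f (y, t)) = (\<lambda>y. G (y, t) \<bullet> (b, 0))" for b
    using partial_deriv_Slab[OF assms(1,3)] by auto
  then show ?thesis
    unfolding laplacian_def using partial_deriv_Slab[OF assms(2,3)] by simp
qed

lemma cone_map_space: "cone_map p (b, 0) = (b, 0)"
  by (simp add: cone_map_def)

text \<open>
  Purely spatial vectors are fixed by the cone maps, so the Duhamel operator commutes with
  derivatives in the space variables.
\<close>

lemma duhamel_grad_space:
  assumes F: "has_grad F G Slab" and z: "z \<in> Slab"
  shows "wave.duhamel_grad F G z \<bullet> (b, 0) = wave.duhamel (\<lambda>z. G z \<bullet> (b, 0)) z"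
proof -
  have "wave.avg_adj G z \<bullet> (b, 0) = (\<integral>p. (retard p *\<^sub>R adjoint (cone_map p) (G (cone_map p z))) \<bullet> (b, 0) \<partial>cone_measure)"
    unfolding wave.avg_adj_def
    by (rule integral_inner_left[symmetric]) (rule wave.avg_adj_integrable[OF has_gradD(2)[OF F] z])
  also have "\<dots> = wave.avg (\<lambda>z. G z \<bullet> (b, 0)) z"
    unfolding wave.avg_def
    using adjoint_works[OF cone_map_linear, of "(b, 0)"]
    by (simp add: cone_map_space inner_commute[of _ "(b, 0)"])
  finally show ?thesis
    by (simp add: wave.duhamel_grad_def wave.duhamel_def inner_add_left)
qed

lemma duhamel_sum:
  assumes "\<And>i. i \<in> I \<Longrightarrow> continuous_on Slab (f i)" "z \<in> Slab"
  shows "wave.duhamel (\<lambda>z. \<Sum>i\<in>I. f i z) z = (\<Sum>i\<in>I. wave.duhamel (f i) z)"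
proof -
  have "wave.avg (\<lambda>z. \<Sum>i\<in>I. f i z) z = (\<Sum>i\<in>I. wave.avg (f i) z)"
    using wave.avg_integrable[OF assms] by (simp add: wave.avg_def sum_distrib_left)
  then show ?thesis by (simp add: wave.duhamel_def sum_distrib_left)
qed

text \<open>
  By Darboux, \<open>V(r, \<tau>) = r M(r, \<tau>)\<close> has \<open>V_rr = r M[\<Delta>F]\<close>, and \<open>V = 0\<close>, \<open>V_r = F(x, \<tau>)\<close> at
  \<open>r = 0\<close>. Differentiating the integral of \<open>V(t - \<tau>, \<tau>)\<close> over \<open>0 \<le> \<tau> \<le> t\<close> twice in \<open>t\<close>
  produces the boundary terms \<open>0\<close> and \<open>F(x, t)\<close>.
\<close>

lemma duhamel_time_derivatives:
  assumes F: "has_grad F G Slab" and H: "\<And>v. has_grad (\<lambda>z. G z \<bullet> v) (H v) Slab"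
  shows "\<exists>D. D 0 = 0 \<and> (\<forall>t\<ge>0. ((\<lambda>s. wave.duhamel F (x, s)) has_real_derivative D t) (at t within {0..}) \<and>
     (D has_real_derivative F (x, t) + wave.duhamel (\<lambda>z. \<Sum>b\<in>Basis. H (b, 0) z \<bullet> (b, 0)) (x, t)) (at t within {0..}))"
proof -
  define lap where "lap z = (\<Sum>b\<in>Basis. H (b, 0) z \<bullet> (b, 0))" for z
  define V where "V r \<tau> = r * smean (\<lambda>v. F (x + r *\<^sub>R v, \<tau>))" for r \<tau>
  define V1 where "V1 r \<tau> = smean (\<lambda>v. F (x + r *\<^sub>R v, \<tau>)) + r * smean (\<lambda>v. fst (G (x + r *\<^sub>R v, \<tau>)) \<bullet> v)" for r \<tau>
  define V2 where "V2 r \<tau> = r * smean (\<lambda>v. lap (x + r *\<^sub>R v, \<tau>))" for r \<tau>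
  define D where "D t = integral {0..t} (\<lambda>\<tau>. V1 (t - \<tau>) \<tau>)" for t
  have lapc: "continuous_on Slab lap" unfolding lap_def
    by (intro continuous_intros has_gradD(2)[OF H])
  have dV: "((\<lambda>r. V r \<tau>) has_real_derivative V1 r \<tau>) (at r)" and dV1: "((\<lambda>r. V1 r \<tau>) has_real_derivative V2 r \<tau>) (at r)"
    if \<tau>: "0 \<le> \<tau>" for r \<tau>
  proof -
    have Hs: "has_grad (\<lambda>y. fst (G (y, \<tau>)) \<bullet> b) (\<lambda>y. fst (H (b, 0) (y, \<tau>))) UNIV" for b
      using has_grad_space_slice[OF H[of "(b, 0)"] \<tau>] by (simp add: inner_prod_def)
    note * = spherical_mean_wave[OF has_grad_space_slice[OF F \<tau>] Hs]
    show "((\<lambda>r. V r \<tau>) has_real_derivative V1 r \<tau>) (at r)" unfolding V_def V1_def by (rule *(1))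
    show "((\<lambda>r. V1 r \<tau>) has_real_derivative V2 r \<tau>) (at r)"
      unfolding V1_def V2_def lap_def using *(2)[of x r] by (simp add: inner_prod_def)
  qed
  have Vc: "continuous_on ({-B..B} \<times> {0..B}) (\<lambda>(r, \<tau>). V r \<tau>)" for B
    using smean_continuous[OF F[THEN has_gradD(3)], of "\<lambda>_. 1" B x]
    unfolding V_def by (auto intro!: continuous_intros simp: split_beta)
  have V2c: "continuous_on ({-B..B} \<times> {0..B}) (\<lambda>(r, \<tau>). V2 r \<tau>)" for B
    using smean_continuous[OF lapc, of "\<lambda>_. 1" B x]
    unfolding V2_def by (auto intro!: continuous_intros simp: split_beta)
  have V1c: "continuous_on ({-B..B} \<times> {0..B}) (\<lambda>(r, \<tau>). V1 r \<tau>)" for B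
  proof -
    have "smean (\<lambda>v. fst (G (x + r *\<^sub>R v, \<tau>)) \<bullet> v) = (\<Sum>a\<in>Basis. smean (\<lambda>v. (v \<bullet> a) * (G (x + r *\<^sub>R v, \<tau>) \<bullet> (a, 0))))"
      if "0 \<le> \<tau>" for r \<tau>
    proof -
      have "smean (\<lambda>v. fst (G (x + r *\<^sub>R v, \<tau>)) \<bullet> v) = smean (\<lambda>v. \<Sum>a\<in>Basis. (v \<bullet> a) * (G (x + r *\<^sub>R v, \<tau>) \<bullet> (a, 0)))"
        by (subst euclidean_inner) (simp add: mult.commute inner_prod_def)
      then show ?thesis
        by (subst (asm) smean_sum)
          (use that in \<open>auto intro!: continuous_intros continuous_on_compose2[OF has_gradD(2)[OF F]]\<close>)
    qed
    moreover have "continuous_on ({-B..B} \<times> {0..B}) (\<lambda>z. \<Sum>a\<in>Basis. smean (\<lambda>v. (v \<bullet> a) * (G (x + fst z *\<^sub>R v, snd z) \<bullet> (a, 0))))"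
    proof (intro continuous_on_sum)
      fix a :: "real^3"
      have "continuous_on Slab (\<lambda>z. G z \<bullet> (a, 0))" by (intro continuous_intros has_gradD(2)[OF F])
      moreover have "continuous_on UNIV (\<lambda>v. v \<bullet> a)" by (intro continuous_intros)
      ultimately have "continuous_on ({-B..B} \<times> {0..B}) (\<lambda>(r, s). smean (\<lambda>v. (v \<bullet> a) * (G (x + r *\<^sub>R v, s) \<bullet> (a, 0))))"
        by (rule smean_continuous)
      then
      show "continuous_on ({-B..B} \<times> {0..B}) (\<lambda>z. smean (\<lambda>v. (v \<bullet> a) * (G (x + fst z *\<^sub>R v, snd z) \<bullet> (a, 0))))"
        by (simp add: split_beta)
    qed
    ultimately have "continuous_on ({-B..B} \<times> {0..B}) (\<lambda>z. smean (\<lambda>v. fst (G (x + fst z *\<^sub>R v, snd z)) \<bullet> v))"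
      by (subst continuous_on_cong[OF refl]) auto
    then show ?thesis
      using smean_continuous[OF F[THEN has_gradD(3)], of "\<lambda>_. 1" B x]
      unfolding V1_def by (auto intro!: continuous_intros simp: split_beta)
  qed
  have shift: "continuous_on ({0..B} \<times> {0..B}) (\<lambda>(t, \<tau>). f (t - \<tau>) \<tau>)"
    if "continuous_on ({-B..B} \<times> {0..B}) (\<lambda>(r, \<tau>). f r \<tau>)" for B and f :: "real \<Rightarrow> real \<Rightarrow> real"
  proof -
    have "continuous_on ({0..B} \<times> {0..B}) (\<lambda>z. (\<lambda>(r, \<tau>). f r \<tau>) (fst z - snd z, snd z))"
      by (rule continuous_on_compose2[OF that]) (auto intro!: continuous_intros)
    then show ?thesis by (simp add: split_beta)
  qed
  have nhd: "at t within {0..} = at t within {0..t + 1}" if "0 \<le> t" for t :: real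
    by (rule at_within_nhd[of _ "{..<t + 1}"]) (use that in auto)
  have chain: "((\<lambda>t. f (t - \<tau>) \<tau>) has_real_derivative f' (t - \<tau>) \<tau>) (at t within X)"
    if "((\<lambda>r. f r \<tau>) has_real_derivative f' (t - \<tau>) \<tau>) (at (t - \<tau>))" for f f' :: "real \<Rightarrow> real \<Rightarrow> real" and t \<tau> X
  proof -
    have "((\<lambda>t. t - \<tau>) has_real_derivative 1) (at t within X)" by (auto intro!: derivative_eq_intros)
    from DERIV_chain2[where f="\<lambda>r. f r \<tau>" and g="\<lambda>t. t - \<tau>" and x=t and s=X and Db=1, OF that this]
    show ?thesis by simp
  qed
  have 1: "((\<lambda>t. integral {0..t} (\<lambda>\<tau>. V (t - \<tau>) \<tau>)) has_real_derivative D t) (at t within {0..})" if t: "0 \<le> t" for t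
  proof -
    have "((\<lambda>t. integral {0..t} (\<lambda>\<tau>. V (t - \<tau>) \<tau>)) has_real_derivative
        1 * V (t - t) t + integral {0..t} (\<lambda>\<tau>. V1 (t - \<tau>) \<tau>)) (at t within {0..t + 1})"
      by (rule leibniz_variable_limit[where B="t + 1" and b="\<lambda>t. t"])
        (use t in \<open>auto intro!: chain dV shift Vc V1c\<close>)
    then show ?thesis by (simp add: nhd[OF t] D_def V_def)
  qed
  have 2: "(D has_real_derivative F (x, t) + integral {0..t} (\<lambda>\<tau>. V2 (t - \<tau>) \<tau>)) (at t within {0..})" if t: "0 \<le> t" for t
  proof -
    have "((\<lambda>t. integral {0..t} (\<lambda>\<tau>. V1 (t - \<tau>) \<tau>)) has_real_derivative
        1 * V1 (t - t) t + integral {0..t} (\<lambda>\<tau>. V2 (t - \<tau>) \<tau>)) (at t within {0..t + 1})"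
      by (rule leibniz_variable_limit[where B="t + 1" and b="\<lambda>t. t"])
        (use t in \<open>auto intro!: chain dV1 shift V1c V2c\<close>)
    then show ?thesis by (simp add: nhd[OF t] D_def[abs_def] V1_def smean_const)
  qed
  show ?thesis
  proof (intro exI[of _ D] conjI allI impI)
    show "D 0 = 0" by (simp add: D_def)
    fix t :: real assume t: "0 \<le> t"
    show "((\<lambda>s. wave.duhamel F (x, s)) has_real_derivative D t) (at t within {0..})"
      by (rule has_field_derivative_transform_within[OF 1[OF t] zero_less_one])
        (use t in \<open>auto simp: duhamel_eq_integral[OF has_gradD(3)[OF F]] V_def\<close>)
    show "(D has_real_derivative F (x, t) + wave.duhamel (\<lambda>z. \<Sum>b\<in>Basis. H (b, 0) z \<bullet> (b, 0)) (x, t)) (at t within {0..})"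
      using 2[OF t] duhamel_eq_integral[OF lapc t, of x] unfolding V2_def lap_def by simp
  qed
qed

theorem duhamel_solves_wave:
  fixes w u :: "real^3 \<Rightarrow> real \<Rightarrow> real"
  assumes w: "C2 Slab (\<lambda>(x, t). w x t)"
    and wave: "\<And>x t. 0 \<le> t \<Longrightarrow> time_deriv (time_deriv w) x t - laplacian (\<lambda>y. w y t) x = 0"
    and F: "C2 Slab F"
    and u: "\<And>x t. 0 \<le> t \<Longrightarrow> u x t = \<epsilon> * w x t - wave.duhamel F (x, t)"
  shows "0 \<le> t \<Longrightarrow> time_deriv (time_deriv u) x t - laplacian (\<lambda>y. u y t) x = - F (x, t)"
    and "time_deriv u x 0 = \<epsilon> * time_deriv w x 0"
proof -
  obtain Gw Hw where Gw: "has_grad (\<lambda>(x, t). w x t) Gw Slab" and Hw: "\<And>v. has_grad (\<lambda>z. Gw z \<bullet> v) (Hw v) Slab"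
    using w unfolding C2_def C1_def by metis
  obtain G H where G: "has_grad F G Slab" and H: "\<And>v. has_grad (\<lambda>z. G z \<bullet> v) (H v) Slab"
    using F unfolding C2_def C1_def by metis
  define lap where "lap z = (\<Sum>b\<in>Basis. H (b, 0) z \<bullet> (b, 0))" for z
  obtain D where D0: "D 0 = 0"
    and D1: "\<And>t. 0 \<le> t \<Longrightarrow> ((\<lambda>s. wave.duhamel F (x, s)) has_real_derivative D t) (at t within {0..})"
    and D2: "\<And>t. 0 \<le> t \<Longrightarrow> (D has_real_derivative F (x, t) + wave.duhamel lap (x, t)) (at t within {0..})"
    using duhamel_time_derivatives[OF G H, of x, folded lap_def] by blast
  have w1: "(w x has_real_derivative Gw (x, t) \<bullet> (0, 1)) (at t within {0..})" if "0 \<le> t" for t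
    using has_grad_time_derivative[OF Gw that, of x] by simp
  have tw: "time_deriv w x t = Gw (x, t) \<bullet> (0, 1)" if "0 \<le> t" for t
    by (rule time_deriv_eqI[OF _ that]) (rule w1[OF that])
  have w2: "(time_deriv w x has_real_derivative Hw (0, 1) (x, t) \<bullet> (0, 1)) (at t within {0..})" if "0 \<le> t" for t
    by (rule has_field_derivative_transform_within[OF has_grad_time_derivative[OF Hw that] zero_less_one])
      (use that in \<open>auto simp: tw\<close>)
  have u1: "(u x has_real_derivative \<epsilon> * time_deriv w x t - D t) (at t within {0..})" if t: "0 \<le> t" for t
  proof (rule has_field_derivative_transform_within[OF _ zero_less_one])
    show "((\<lambda>s. \<epsilon> * w x s - wave.duhamel F (x, s)) has_real_derivative \<epsilon> * time_deriv w x t - D t) (at t within {0..})"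
      unfolding tw[OF t] by (intro DERIV_diff DERIV_cmult w1 D1 t)
  qed (use t in \<open>auto simp: u\<close>)
  have tu: "time_deriv u x t = \<epsilon> * time_deriv w x t - D t" if "0 \<le> t" for t
    by (rule time_deriv_eqI[OF _ that]) (rule u1[OF that])
  show "time_deriv u x 0 = \<epsilon> * time_deriv w x 0" using tu[of 0] D0 by simp
  assume t: "0 \<le> t"
  have "(time_deriv u x has_real_derivative \<epsilon> * (Hw (0, 1) (x, t) \<bullet> (0, 1)) - (F (x, t) + wave.duhamel lap (x, t))) (at t within {0..})"
  proof (rule has_field_derivative_transform_within[OF _ zero_less_one])
    show "((\<lambda>s. \<epsilon> * time_deriv w x s - D s) has_real_derivative \<epsilon> * (Hw (0, 1) (x, t) \<bullet> (0, 1)) - (F (x, t) + wave.duhamel lap (x, t))) (at t within {0..})"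
      by (intro DERIV_diff DERIV_cmult w2 D2 t)
  qed (use t in \<open>auto simp: tu\<close>)
  then have ttu: "time_deriv (time_deriv u) x t = \<epsilon> * (Hw (0, 1) (x, t) \<bullet> (0, 1)) - (F (x, t) + wave.duhamel lap (x, t))"
    by (rule time_deriv_eqI[OF _ t])
  have ttw: "time_deriv (time_deriv w) x t = Hw (0, 1) (x, t) \<bullet> (0, 1)" by (rule time_deriv_eqI[OF _ t]) (rule w2[OF t])
  have lapw: "laplacian (\<lambda>y. w y t) x = (\<Sum>b\<in>Basis. Hw (b, 0) (x, t) \<bullet> (b, 0))"
    using laplacian_Slab[OF Gw Hw t, of x] by simp
  have "has_grad (\<lambda>z. \<epsilon> * (\<lambda>(x, t). w x t) z - wave.duhamel F z) (\<lambda>z. (\<epsilon> *\<^sub>R Gw z + (\<lambda>(x, t). w x t) z *\<^sub>R 0) - wave.duhamel_grad F G z) Slab"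
    by (intro has_grad_diff has_grad_mult has_grad_const Gw wave.duhamel_has_grad G)
  then have Gu: "has_grad (\<lambda>(x, t). u x t) (\<lambda>z. (\<epsilon> *\<^sub>R Gw z + (\<lambda>(x, t). w x t) z *\<^sub>R 0) - wave.duhamel_grad F G z) Slab"
    by (rule has_grad_cong) (auto simp: u)
  have Hu: "has_grad (\<lambda>z. ((\<epsilon> *\<^sub>R Gw z + (\<lambda>(x, t). w x t) z *\<^sub>R 0) - wave.duhamel_grad F G z) \<bullet> (b, 0))
      (\<lambda>z. (\<epsilon> *\<^sub>R Hw (b, 0) z + (Gw z \<bullet> (b, 0)) *\<^sub>R 0) - wave.duhamel_grad (\<lambda>z. G z \<bullet> (b, 0)) (H (b, 0)) z) Slab" for b
  proof (rule has_grad_cong)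
    show "has_grad (\<lambda>z. \<epsilon> * (Gw z \<bullet> (b, 0)) - wave.duhamel (\<lambda>z. G z \<bullet> (b, 0)) z)
        (\<lambda>z. (\<epsilon> *\<^sub>R Hw (b, 0) z + (Gw z \<bullet> (b, 0)) *\<^sub>R 0) - wave.duhamel_grad (\<lambda>z. G z \<bullet> (b, 0)) (H (b, 0)) z) Slab"
      by (intro has_grad_diff has_grad_mult has_grad_const Hw wave.duhamel_has_grad H)
  qed (simp add: inner_diff_left duhamel_grad_space[OF G])
  have lapu: "laplacian (\<lambda>y. u y t) x = \<epsilon> * laplacian (\<lambda>y. w y t) x - wave.duhamel lap (x, t)"
  proof -
    have "laplacian (\<lambda>y. u y t) x = (\<Sum>b\<in>Basis. ((\<epsilon> *\<^sub>R Hw (b, 0) (x, t) + (Gw (x, t) \<bullet> (b, 0)) *\<^sub>R 0) - wave.duhamel_grad (\<lambda>z. G z \<bullet> (b, 0)) (H (b, 0)) (x, t)) \<bullet> (b, 0))"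
      using laplacian_Slab[OF Gu Hu t, of x] by simp
    also have "\<dots> = (\<Sum>b\<in>Basis. \<epsilon> * (Hw (b, 0) (x, t) \<bullet> (b, 0)) - wave.duhamel (\<lambda>z. H (b, 0) z \<bullet> (b, 0)) (x, t))"
      using t by (intro sum.cong refl) (simp add: inner_diff_left duhamel_grad_space[OF H])
    also have "\<dots> = \<epsilon> * laplacian (\<lambda>y. w y t) x - wave.duhamel lap (x, t)"
      unfolding lapw lap_def
      using t by (subst duhamel_sum) (auto simp: sum_subtractf sum_distrib_left intro!: continuous_intros has_gradD(2)[OF H])
    finally show ?thesis .
  qed
  show "time_deriv (time_deriv u) x t - laplacian (\<lambda>y. u y t) x = - F (x, t)"
    using wave[OF t, of x] unfolding ttu lapu ttw[symmetric] by (simp flip: right_diff_distrib add: algebra_simps)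
qed

section \<open>Divergence and mixed derivatives\<close>

lemma has_grad_line_derivative:
  assumes f: "has_grad f G Slab" and s: "0 \<le> s"
  shows "((\<lambda>h. f (x + h *\<^sub>R b, s)) has_real_derivative G (x + h *\<^sub>R b, s) \<bullet> (b, 0)) (at h)"
proof -
  have "((\<lambda>h. x + h *\<^sub>R b) has_derivative (\<lambda>d. d *\<^sub>R b)) (at h)"
    by (auto intro!: derivative_eq_intros)
  from has_derivative_compose[OF this, of "\<lambda>y. f (y, s)" "\<lambda>d. fst (G (x + h *\<^sub>R b, s)) \<bullet> d"]
    has_gradD(1)[OF has_grad_space_slice[OF f s], of "x + h *\<^sub>R b"]
  have "((\<lambda>h. f (x + h *\<^sub>R b, s)) has_derivative (\<lambda>d. fst (G (x + h *\<^sub>R b, s)) \<bullet> (d *\<^sub>R b))) (at h)" by simp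
  then show ?thesis
    unfolding has_field_derivative_def by (rule has_derivative_eq_rhs) (simp add: fun_eq_iff inner_prod_def)
qed

lemma continuous_on_space_time:
  fixes f :: "(real^3) \<times> real \<Rightarrow> real"
  assumes "continuous_on Slab f" "B \<subseteq> {0..}"
  shows "continuous_on (I \<times> B) (\<lambda>(h, s). f (x + h *\<^sub>R b, s))"
proof -
  have "continuous_on (I \<times> B) (\<lambda>z. f (x + fst z *\<^sub>R b, snd z))"
    by (rule continuous_on_compose2[OF assms(1)]) (use assms(2) in \<open>auto intro!: continuous_intros\<close>)
  then show ?thesis by (simp add: split_beta)
qed

lemma continuous_on_time_line:
  fixes f :: "(real^3) \<times> real \<Rightarrow> 'b::topological_space"
  assumes "continuous_on Slab f" "B \<subseteq> {0..}"
  shows "continuous_on B (\<lambda>s. f (x, s))"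
  by (rule continuous_on_compose2[OF assms(1)]) (use assms(2) in \<open>auto intro!: continuous_intros\<close>)

lemma integral_time_derivative:
  assumes f: "has_grad f G Slab" and t: "0 \<le> t"
  shows "integral {0..t} (\<lambda>s. G (x, s) \<bullet> (0, 1)) = f (x, t) - f (x, 0)"
proof (rule integral_unique, rule fundamental_theorem_of_calculus[OF t])
  fix s assume s: "s \<in> {0..t}"
  have "((\<lambda>s. f (x, s)) has_real_derivative G (x, s) \<bullet> (0, 1)) (at s within {0..t})"
    by (rule DERIV_subset[OF has_grad_time_derivative[OF f]]) (use s in auto)
  then show "((\<lambda>s. f (x, s)) has_vector_derivative G (x, s) \<bullet> (0, 1)) (at s within {0..t})"
    by (simp add: has_real_derivative_iff_has_vector_derivative)
qed

text \<open>
  Differentiate \<open>u(x, t) - u(x, 0) = \<integral> u_t(x, s) ds\<close> in the direction \<open>b\<close> under the integral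
  sign, then in \<open>t\<close>. This covers the boundary points \<open>t = 0\<close> as well.
\<close>

lemma mixed_derivatives_commute:
  assumes u: "has_grad u G Slab" and H: "\<And>v. has_grad (\<lambda>z. G z \<bullet> v) (H v) Slab" and t: "0 \<le> t"
  shows "H (0, 1) (x, t) \<bullet> (b, 0) = H (b, 0) (x, t) \<bullet> (0, 1)"
proof -
  define \<Phi> where "\<Phi> t = integral {0..t} (\<lambda>s. H (0, 1) (x, s) \<bullet> (b, 0))" for t
  have utc: "continuous_on Slab (\<lambda>z. G z \<bullet> (0, 1))" by (intro continuous_intros has_gradD(2)[OF u])
  have Hc: "continuous_on Slab (\<lambda>z. H (0, 1) z \<bullet> (b, 0))" by (intro continuous_intros has_gradD(2)[OF H])
  have eq: "G (x, t) \<bullet> (b, 0) = G (x, 0) \<bullet> (b, 0) + \<Phi> t" if t: "0 \<le> t" for t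
  proof -
    have "((\<lambda>h. integral {0..t} (\<lambda>s. G (x + h *\<^sub>R b, s) \<bullet> (0, 1))) has_real_derivative
       0 * (G (x + 0 *\<^sub>R b, t) \<bullet> (0, 1)) + integral {0..t} (\<lambda>s. H (0, 1) (x + 0 *\<^sub>R b, s) \<bullet> (b, 0))) (at 0 within UNIV)"
      by (rule leibniz_variable_limit[where B=t and b="\<lambda>_. t" and k="\<lambda>h s. G (x + h *\<^sub>R b, s) \<bullet> (0, 1)" and k'="\<lambda>h s. H (0, 1) (x + h *\<^sub>R b, s) \<bullet> (b, 0)"])
        (use t in \<open>auto intro!: has_grad_line_derivative[OF H] continuous_on_space_time[OF utc] continuous_on_space_time[OF Hc]\<close>)
    then have 1: "((\<lambda>h. integral {0..t} (\<lambda>s. G (x + h *\<^sub>R b, s) \<bullet> (0, 1))) has_real_derivative \<Phi> t) (at 0)"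
      by (simp add: \<Phi>_def)
    have "((\<lambda>h. u (x + h *\<^sub>R b, t) - u (x + h *\<^sub>R b, 0)) has_real_derivative G (x + 0 *\<^sub>R b, t) \<bullet> (b, 0) - G (x + 0 *\<^sub>R b, 0) \<bullet> (b, 0)) (at 0)"
      by (intro DERIV_diff has_grad_line_derivative[OF u] t) simp
    then have 2: "((\<lambda>h. integral {0..t} (\<lambda>s. G (x + h *\<^sub>R b, s) \<bullet> (0, 1))) has_real_derivative G (x, t) \<bullet> (b, 0) - G (x, 0) \<bullet> (b, 0)) (at 0)"
      unfolding integral_time_derivative[OF u t] by simp
    show ?thesis using DERIV_unique[OF 1 2] by simp
  qed
  have "(\<Phi> has_real_derivative H (0, 1) (x, t) \<bullet> (b, 0)) (at t within {0..t + 1})"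
    unfolding \<Phi>_def by (rule integral_has_real_derivative[OF continuous_on_time_line[OF Hc]]) (use t in auto)
  moreover have "at t within {0..} = at t within {0..t + 1}"
    by (rule at_within_nhd[of _ "{..<t + 1}"]) (use t in auto)
  ultimately have d: "(\<Phi> has_real_derivative H (0, 1) (x, t) \<bullet> (b, 0)) (at t within {0..})" by simp
  have 1: "((\<lambda>s. G (x, 0) \<bullet> (b, 0) + \<Phi> s) has_real_derivative H (0, 1) (x, t) \<bullet> (b, 0)) (at t within {0..})"
    using DERIV_add[OF DERIV_const d] by simp
  have "((\<lambda>s. G (x, s) \<bullet> (b, 0)) has_real_derivative H (0, 1) (x, t) \<bullet> (b, 0)) (at t within {0..})"
  proof (rule has_field_derivative_transform_within[OF 1 zero_less_one])
    show "G (x, 0) \<bullet> (b, 0) + \<Phi> s = G (x, s) \<bullet> (b, 0)" if "s \<in> {0..}" for s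
      by (rule eq[symmetric]) (use that in simp)
  qed (use t in simp)
  then have "time_deriv (\<lambda>x s. G (x, s) \<bullet> (b, 0)) x t = H (0, 1) (x, t) \<bullet> (b, 0)"
    by (rule time_deriv_eqI[OF _ t])
  moreover have "time_deriv (\<lambda>x s. G (x, s) \<bullet> (b, 0)) x t = H (b, 0) (x, t) \<bullet> (0, 1)"
    by (rule time_deriv_eqI[OF _ t]) (rule has_grad_time_derivative[OF H t])
  ultimately show ?thesis by simp
qed

text \<open>
  The integral of a difference quotient vanishes because Lebesgue measure is translation
  invariant; the Lipschitz bound and the compact support allow passing to the limit. In this
  form the divergence theorem tolerates the kinks of the function to which it will be applied.
  The function \<open>d'\<close> is a measurable version of \<open>d\<close>, as \<open>d\<close> itself is tied to \<open>Q\<close> only almost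
  everywhere.
\<close>

lemma integral_directional_derivative_eq_0:
  fixes Q :: "'a::euclidean_space \<Rightarrow> real"
  assumes Qc: "continuous_on UNIV Q" and supp: "\<And>y. T \<le> norm y \<Longrightarrow> Q y = 0" and b: "norm b = 1"
    and lip: "\<And>y h. \<bar>h\<bar> \<le> 1 \<Longrightarrow> \<bar>Q (y + h *\<^sub>R b) - Q y\<bar> \<le> C * \<bar>h\<bar>"
    and deriv: "AE y in lborel. ((\<lambda>h. Q (y + h *\<^sub>R b)) has_real_derivative d y) (at 0)"
  shows "\<exists>d'. integrable lborel d' \<and> (\<integral>y. d' y \<partial>lborel) = 0 \<and> (AE y in lborel. d' y = d y)"
proof -
  \<comment> \<open>Difference quotients with step 1 / (n + 1).\<close>
  define r where "r n y = (Q (y + (1 / real (Suc n)) *\<^sub>R b) - Q y) * real (Suc n)" for n y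
  have Qm [measurable]: "Q \<in> borel_measurable borel" using Qc by (rule borel_measurable_continuous_onI)
  have C: "0 \<le> C" using lip[of 1 undefined] by simp
  have rm [measurable]: "r n \<in> borel_measurable lborel" for n unfolding r_def by measurable
  define d' where "d' y = lim (\<lambda>n. r n y)" for y
  have d'm: "d' \<in> borel_measurable lborel" unfolding d'_def by (rule borel_measurable_lim_metric) (rule rm)
  have tend: "AE y in lborel. (\<lambda>n. r n y) \<longlonglongrightarrow> d y"
    using deriv
  proof eventually_elim
    case (elim y)
    then have "((\<lambda>h. (Q (y + h *\<^sub>R b) - Q y) / h) \<longlongrightarrow> d y) (at 0)"
      by (simp add: has_field_derivative_iff)
    moreover have "filterlim (\<lambda>n. 1 / real (Suc n)) (at 0) sequentially"
      unfolding filterlim_at using LIMSEQ_inverse_real_of_nat by (simp add: inverse_eq_divide)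
    ultimately have "(\<lambda>n. (Q (y + (1 / real (Suc n)) *\<^sub>R b) - Q y) / (1 / real (Suc n))) \<longlonglongrightarrow> d y"
      by (rule filterlim_compose)
    then show ?case by (simp add: r_def)
  qed
  then have eq: "AE y in lborel. d' y = d y" by eventually_elim (simp add: d'_def limI)
  define w where "w y = C * indicator (cball 0 (T + 1)) y" for y :: 'a
  have w: "integrable lborel w" unfolding w_def
    by (intro integrable_mult_right integrable_real_indicator) (use emeasure_lborel_cball_finite[of "0::'a" "T + 1"] in auto)
  have bound: "norm (r n y) \<le> w y" for n y
  proof (cases "norm y \<le> T + 1")
    case True
    have "\<bar>Q (y + (1 / real (Suc n)) *\<^sub>R b) - Q y\<bar> \<le> C * \<bar>1 / real (Suc n)\<bar>"
      by (rule lip) (simp add: divide_le_eq)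
    then have "\<bar>Q (y + (1 / real (Suc n)) *\<^sub>R b) - Q y\<bar> * real (Suc n) \<le> C"
      by (simp add: field_simps)
    then show ?thesis using True by (simp add: w_def r_def abs_mult)
  next
    case False
    have "norm ((1 / real (Suc n)) *\<^sub>R b) \<le> 1" using b by (simp add: divide_le_eq)
    then have "T \<le> norm (y + (1 / real (Suc n)) *\<^sub>R b)"
      using False norm_diff_ineq[of y "(1 / real (Suc n)) *\<^sub>R b"] by linarith
    then show ?thesis using supp False by (simp add: r_def w_def)
  qed
  have lim: "AE y in lborel. (\<lambda>n. r n y) \<longlonglongrightarrow> d' y"
    using tend eq by eventually_elim simp
  have Qi: "integrable lborel Q"
  proof -
    have "integrable lborel (\<lambda>y. indicator (cball 0 T) y *\<^sub>R Q y)"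
      by (rule borel_integrable_compact) (auto intro: continuous_on_subset[OF Qc])
    moreover have "(\<lambda>y. indicator (cball 0 T) y *\<^sub>R Q y) = Q"
      using supp by (auto simp: fun_eq_iff indicator_def)
    ultimately show ?thesis by simp
  qed
  have shift: "integrable lborel (\<lambda>y. Q (y + v))" "(\<integral>y. Q (y + v) \<partial>lborel) = (\<integral>y. Q y \<partial>lborel)" for v
  proof -
    have "integrable (distr lborel borel ((+) v)) Q" using Qi by (simp add: lborel_distr_plus)
    then show "integrable lborel (\<lambda>y. Q (y + v))"
      by (subst (asm) integrable_distr_eq) (auto simp: add.commute)
    have "(\<integral>y. Q y \<partial>lborel) = (\<integral>y. Q y \<partial>distr lborel borel ((+) v))" by (simp add: lborel_distr_plus)
    also have "\<dots> = (\<integral>y. Q (y + v) \<partial>lborel)" by (subst integral_distr) (auto simp: add.commute)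
    finally show "(\<integral>y. Q (y + v) \<partial>lborel) = (\<integral>y. Q y \<partial>lborel)" by simp
  qed
  have "(\<integral>y. r n y \<partial>lborel) = 0" for n
    unfolding r_def using shift Qi by simp
  moreover have "(\<lambda>n. \<integral>y. r n y \<partial>lborel) \<longlonglongrightarrow> (\<integral>y. d' y \<partial>lborel)"
    by (rule integral_dominated_convergence[OF d'm rm w lim]) (use bound in auto)
  ultimately have "(\<integral>y. d' y \<partial>lborel) = 0" by (simp add: LIMSEQ_const_iff)
  moreover have "integrable lborel d'"
    by (rule integrable_dominated_convergence[OF d'm rm w lim]) (use bound in auto)
  ultimately show ?thesis using eq by blast
qed

lemma integral_upper_limit_lipschitz:
  fixes g :: "real \<Rightarrow> real"
  assumes "continuous_on {0..T} g" "\<And>s. s \<in> {0..T} \<Longrightarrow> \<bar>g s\<bar> \<le> N" "a \<in> {0..T}" "c \<in> {0..T}"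
  shows "\<bar>integral {0..a} g - integral {0..c} g\<bar> \<le> N * \<bar>a - c\<bar>"
proof -
  have "norm (integral {0..a} g - integral {0..c} g) \<le> N * norm (a - c)"
    by (rule field_differentiable_bound[where S="{0..T}" and f="\<lambda>a. integral {0..a} g" and f'=g])
      (use assms integral_has_real_derivative[OF assms(1)] in auto)
  then show ?thesis by simp
qed

section \<open>The energy flux through the light cone\<close>

text \<open>
  The height over \<open>y\<close> of the backward cone with vertex at time \<open>T\<close>, cut off at 0 outside its
  base.
\<close>

definition retarded_height :: "real \<Rightarrow> real^3 \<Rightarrow> real" where
  "retarded_height T y = max 0 (T - norm y)"

lemma retarded_height_lipschitz: "\<bar>retarded_height T (y + v) - retarded_height T y\<bar> \<le> norm v"
  unfolding retarded_height_def using norm_triangle_ineq[of y v] norm_diff_ineq[of y v] by linarith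

lemma retarded_height_derivative:
  assumes "y \<noteq> 0" "norm y \<noteq> T" "0 < T"
  shows "((\<lambda>h. retarded_height T (y + h *\<^sub>R b)) has_real_derivative
     (if norm y < T then - (y \<bullet> b) / norm y else 0)) (at 0)"
proof (cases "norm y < T")
  case True
  have "((\<lambda>h. norm (y + h *\<^sub>R b)) has_derivative (\<lambda>h. sgn y \<bullet> (h *\<^sub>R b))) (at 0)"
  proof -
    have "((\<lambda>h. y + h *\<^sub>R b) has_derivative (\<lambda>h. h *\<^sub>R b)) (at 0)"
      by (auto intro!: derivative_eq_intros)
    from has_derivative_compose[OF this, of norm "\<lambda>h. h \<bullet> sgn y"] assms(1)
    show ?thesis by (simp add: has_derivative_norm inner_commute)
  qed
  then have "((\<lambda>h. T - norm (y + h *\<^sub>R b)) has_derivative (\<lambda>h. 0 - sgn y \<bullet> (h *\<^sub>R b))) (at 0)"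
    by (intro has_derivative_diff has_derivative_const)
  then have "((\<lambda>h. T - norm (y + h *\<^sub>R b)) has_real_derivative - (y \<bullet> b) / norm y) (at 0)"
    unfolding has_field_derivative_def by (rule has_derivative_eq_rhs) (simp add: fun_eq_iff sgn_div_norm divide_inverse ac_simps)
  moreover have "\<forall>\<^sub>F h in nhds 0. retarded_height T (y + h *\<^sub>R b) = T - norm (y + h *\<^sub>R b)"
  proof -
    have "isCont (\<lambda>h. norm (y + h *\<^sub>R b)) (0::real)" by (intro continuous_intros)
    then have "((\<lambda>h. norm (y + h *\<^sub>R b)) \<longlongrightarrow> norm y) (nhds (0::real))"
      using tendsto_nhds_iff[of "\<lambda>h. norm (y + h *\<^sub>R b)" _ 0] by (simp add: isCont_def)
    from order_tendstoD(2)[OF this True] show ?thesis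
      by eventually_elim (simp add: retarded_height_def)
  qed
  ultimately show ?thesis using True by (simp add: DERIV_cong_ev[OF refl])
next
  case False
  then have "T < norm y" using assms by simp
  have "isCont (\<lambda>h. norm (y + h *\<^sub>R b)) (0::real)" by (intro continuous_intros)
  then have "((\<lambda>h. norm (y + h *\<^sub>R b)) \<longlongrightarrow> norm y) (nhds (0::real))"
    using tendsto_nhds_iff[of "\<lambda>h. norm (y + h *\<^sub>R b)" _ 0] by (simp add: isCont_def)
  from order_tendstoD(1)[OF this \<open>T < norm y\<close>]
  have "\<forall>\<^sub>F h in nhds 0. retarded_height T (y + h *\<^sub>R b) = 0"
    by eventually_elim (simp add: retarded_height_def)
  then show ?thesis using False by (simp add: DERIV_cong_ev[OF refl])
qed

text \<open>
  Integrating a flux density over the vertical segment below the cone gives a Lipschitz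
  function with compact support, differentiable away from the axis and from the rim of the
  cone.
\<close>

lemma retarded_flux_potential:
  fixes x :: "real^3"
  assumes q: "has_grad q Gq Slab" and T: "0 < T"
  defines "Q \<equiv> \<lambda>y. integral {0..retarded_height T y} (\<lambda>s. q (x + y, s))"
  shows "continuous_on UNIV Q" and "T \<le> norm y \<Longrightarrow> Q y = 0"
    and "\<exists>C. \<forall>y v. norm v \<le> 1 \<longrightarrow> \<bar>Q (y + v) - Q y\<bar> \<le> C * norm v"
    and "y \<noteq> 0 \<Longrightarrow> norm y \<noteq> T \<Longrightarrow> ((\<lambda>h. Q (y + h *\<^sub>R b)) has_real_derivative
      (if norm y < T then - (y \<bullet> b) / norm y else 0) * q (x + y, retarded_height T y)
        + integral {0..retarded_height T y} (\<lambda>s. Gq (x + y, s) \<bullet> (b, 0))) (at 0)"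
proof -
  have qc: "continuous_on Slab q" and Gqc: "continuous_on Slab Gq" using has_gradD[OF q] by auto
  have cl: "closed Slab" by (intro closed_Times) auto
  have rh: "retarded_height T y \<in> {0..T}" for y using T by (auto simp: retarded_height_def)
  define K where "K = cball x (T + 2) \<times> {0..T}"
  have K: "convex K" "K \<subseteq> Slab" "compact K" unfolding K_def by (auto intro!: convex_Times compact_Times)
  obtain N where N: "N > 0" "\<And>z. z \<in> K \<Longrightarrow> norm (q z) \<le> N"
    using compact_imp_bounded[OF compact_continuous_image[OF continuous_on_subset[OF qc K(2)] K(3)]]
    unfolding bounded_pos by auto
  obtain N' where N': "N' > 0" "\<And>z. z \<in> K \<Longrightarrow> norm (Gq z) \<le> N'"
    using compact_imp_bounded[OF compact_continuous_image[OF continuous_on_subset[OF Gqc K(2)] K(3)]]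
    unfolding bounded_pos by auto
  have tl: "continuous_on {0..a} (\<lambda>s. q (y, s))" for y a
    by (rule continuous_on_time_line[OF qc]) auto
  show zero: "Q y = 0" if "T \<le> norm y" for y
    using that by (simp add: Q_def retarded_height_def max_def)
  have lip: "\<bar>Q (y + v) - Q y\<bar> \<le> (N + N' * T) * norm v" if v: "norm v \<le> 1" for y v
  proof (cases "norm y \<le> T + 1")
    case True
    have yv: "norm (y + v) \<le> T + 2" using norm_triangle_ineq[of y v] True v by simp
    have inK: "(x + w, s) \<in> K" if "norm w \<le> T + 2" "s \<in> {0..T}" for w s
      using that by (auto simp: K_def dist_norm)
    have K1: "(x + (y + v), s) \<in> K" "(x + y, s) \<in> K" if "s \<in> {0..T}" for s
      using inK[OF yv that] inK[of y s] True that by auto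
    have 1: "\<bar>Q (y + v) - integral {0..retarded_height T y} (\<lambda>s. q (x + (y + v), s))\<bar> \<le> N * norm v"
    proof -
      have "\<bar>Q (y + v) - integral {0..retarded_height T y} (\<lambda>s. q (x + (y + v), s))\<bar>
          \<le> N * \<bar>retarded_height T (y + v) - retarded_height T y\<bar>"
        unfolding Q_def by (rule integral_upper_limit_lipschitz[OF tl _ rh rh]) (use N K1 in auto)
      also have "\<dots> \<le> N * norm v" using retarded_height_lipschitz N by (intro mult_left_mono) auto
      finally show ?thesis .
    qed
    have 2: "\<bar>integral {0..retarded_height T y} (\<lambda>s. q (x + (y + v), s)) - Q y\<bar> \<le> N' * T * norm v"
    proof -
      have "integral {0..retarded_height T y} (\<lambda>s. q (x + (y + v), s)) - Q y
          = integral {0..retarded_height T y} (\<lambda>s. q (x + (y + v), s) - q (x + y, s))"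
        unfolding Q_def by (intro integral_diff[symmetric] integrable_continuous_real tl)
      also have "norm \<dots> \<le> (N' * norm v) * (retarded_height T y - 0)"
      proof (rule integral_bound)
        fix s assume "s \<in> {0..retarded_height T y}"
        then have s: "s \<in> {0..T}" using rh[of y] by auto
        have "\<bar>q (x + (y + v), s) - q (x + y, s)\<bar> \<le> N' * norm ((x + (y + v), s) - (x + y, s))"
          by (rule has_grad_lipschitz[OF q K(1,2) N'(2) K1(1)[OF s] K1(2)[OF s]])
        then show "norm (q (x + (y + v), s) - q (x + y, s)) \<le> N' * norm v" by (simp add: norm_Pair)
      qed (use rh[of y] tl in \<open>auto intro!: continuous_intros\<close>)
      also have "\<dots> \<le> (N' * norm v) * T" using rh[of y] N' by (intro mult_left_mono) auto
      finally show ?thesis by (simp add: ac_simps)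
    qed
    have "\<bar>Q (y + v) - Q y\<bar> \<le> N * norm v + N' * T * norm v" using 1 2 by linarith
    then show ?thesis by (simp add: algebra_simps)
  next
    case False
    then have "T \<le> norm (y + v)" "T \<le> norm y" using norm_diff_ineq[of y v] v by auto
    then show ?thesis using zero N N' T by simp
  qed
  then show "\<exists>C. \<forall>y v. norm v \<le> 1 \<longrightarrow> \<bar>Q (y + v) - Q y\<bar> \<le> C * norm v" by blast
  show "continuous_on UNIV Q"
    unfolding continuous_on_iff
  proof (intro ballI allI impI)
    fix y :: "real^3" and \<epsilon> :: real assume "0 < \<epsilon>"
    define C where "C = N + N' * T"
    have C: "C > 0" using N N' T by (simp add: C_def add_pos_pos)
    show "\<exists>d>0. \<forall>x'\<in>UNIV. dist x' y < d \<longrightarrow> dist (Q x') (Q y) < \<epsilon>"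
    proof (intro exI[of _ "min 1 (\<epsilon> / C)"] conjI ballI impI)
      fix x' assume *: "dist x' y < min 1 (\<epsilon> / C)"
      have "\<bar>Q (y + (x' - y)) - Q y\<bar> \<le> C * norm (x' - y)"
        unfolding C_def by (rule lip) (use * in \<open>auto simp: dist_norm\<close>)
      also have "\<dots> < \<epsilon>" using * C by (simp add: dist_norm pos_less_divide_eq mult.commute)
      finally show "dist (Q x') (Q y) < \<epsilon>" by (simp add: dist_norm)
    qed (use C \<open>0 < \<epsilon>\<close> in auto)
  qed
  assume y: "y \<noteq> 0" "norm y \<noteq> T"
  have Gqb: "continuous_on Slab (\<lambda>z. Gq z \<bullet> (b, 0))" by (intro continuous_intros Gqc)
  have "((\<lambda>h. integral {0..retarded_height T (y + h *\<^sub>R b)} (\<lambda>s. q ((x + y) + h *\<^sub>R b, s))) has_real_derivative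
      (if norm y < T then - (y \<bullet> b) / norm y else 0) * q ((x + y) + 0 *\<^sub>R b, retarded_height T (y + 0 *\<^sub>R b))
        + integral {0..retarded_height T (y + 0 *\<^sub>R b)} (\<lambda>s. Gq ((x + y) + 0 *\<^sub>R b, s) \<bullet> (b, 0))) (at 0 within UNIV)"
  proof (rule leibniz_variable_limit[where B=T and b="\<lambda>h. retarded_height T (y + h *\<^sub>R b)" and
        k="\<lambda>h s. q ((x + y) + h *\<^sub>R b, s)" and k'="\<lambda>h s. Gq ((x + y) + h *\<^sub>R b, s) \<bullet> (b, 0)"])
    show "((\<lambda>h. retarded_height T (y + h *\<^sub>R b)) has_real_derivative (if norm y < T then - (y \<bullet> b) / norm y else 0)) (at 0)"
      by (rule retarded_height_derivative[OF y T])
    show "((\<lambda>h. q ((x + y) + h *\<^sub>R b, s)) has_real_derivative Gq ((x + y) + h *\<^sub>R b, s) \<bullet> (b, 0)) (at h)" if "s \<in> {0..T}" for h s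
      by (rule has_grad_line_derivative[OF q]) (use that in auto)
  qed (use rh in \<open>auto intro!: continuous_on_space_time[OF qc] continuous_on_space_time[OF Gqb]\<close>)
  then show "((\<lambda>h. Q (y + h *\<^sub>R b)) has_real_derivative
      (if norm y < T then - (y \<bullet> b) / norm y else 0) * q (x + y, retarded_height T y)
        + integral {0..retarded_height T y} (\<lambda>s. Gq (x + y, s) \<bullet> (b, 0))) (at 0)"
    by (simp add: Q_def add.assoc)
qed

text \<open>
  Let \<open>e\<close> be the energy density and \<open>q = u_t \<nabla>u\<close>, so that \<open>e_t = div q\<close> by the equation.
  Integrated over the vertical segments below the cone, \<open>q\<close> becomes a compactly supported
  vector field \<open>Q\<close> on the base with \<open>div Q = e(mantle) - e(base) - (y / |y|) \<bullet> q(mantle)\<close>, and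
  the integral of \<open>div Q\<close> is 0. On the mantle \<open>(y / |y|) \<bullet> q\<close> is at most the quadratic part of
  \<open>e\<close>, so that the potential energy on the mantle is at most the energy on the base.
\<close>

theorem cone_energy_flux:
  fixes u :: "(real^3) \<times> real \<Rightarrow> real" and k P :: "real \<Rightarrow> real"
  assumes u: "has_grad u G Slab" and H: "\<And>v. has_grad (\<lambda>z. G z \<bullet> v) (H v) Slab"
    and P: "\<And>v. (P has_real_derivative k v) (at v)" and k: "continuous_on UNIV k"
    and eq: "\<And>z. z \<in> Slab \<Longrightarrow> H (0, 1) z \<bullet> (0, 1) - (\<Sum>b\<in>Basis. H (b, 0) z \<bullet> (b, 0)) = - k (u z)"
    and T: "0 < T"
  defines "e \<equiv> \<lambda>z. ((G z \<bullet> (0, 1))\<^sup>2 + (\<Sum>b\<in>Basis. (G z \<bullet> (b, 0))\<^sup>2)) / 2 + P (u z)"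
  shows "(\<integral>y. indicator (cball 0 T) y *\<^sub>R P (u (x + y, T - norm y)) \<partial>lborel)
     \<le> (\<integral>y. indicator (cball 0 T) y *\<^sub>R e (x + y, 0) \<partial>lborel)"
proof -
  define ut where "ut z = G z \<bullet> (0, 1)" for z
  define us where "us b z = G z \<bullet> (b, 0)" for b z
  define q where "q b z = ut z * us b z" for b z
  define Gq where "Gq b z = ut z *\<^sub>R H (b, 0) z + us b z *\<^sub>R H (0, 1) z" for b z
  have qg: "has_grad (q b) (Gq b) Slab" for b
    unfolding q_def Gq_def ut_def us_def by (intro has_grad_mult H)
  define Q where "Q b y = integral {0..retarded_height T y} (\<lambda>s. q b (x + y, s))" for b y
  define dQ where "dQ b y = (if norm y < T then - (y \<bullet> b) / norm y else 0) * q b (x + y, retarded_height T y)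
        + integral {0..retarded_height T y} (\<lambda>s. Gq b (x + y, s) \<bullet> (b, 0))" for b y
  have AE: "AE y in lborel. y \<noteq> (0::real^3) \<and> norm y \<noteq> T"
  proof -
    have "sphere (0::real^3) T \<in> null_sets lebesgue"
      using negligible_sphere negligible_iff_null_sets by blast
    then have "AE y in lebesgue. y \<notin> sphere (0::real^3) T" by (rule AE_not_in)
    moreover have "{y. norm y \<noteq> T} \<in> sets (borel :: (real^3) measure)" by measurable
    ultimately have 1: "AE y in lborel. norm (y::real^3) \<noteq> T" by (subst (asm) AE_completion_iff) auto
    have 2: "AE y in lborel. y \<noteq> (0::real^3)" by (rule AE_lborel_singleton)
    from 1 2 show ?thesis by eventually_elim simp
  qed
  have "\<exists>d'. integrable lborel d' \<and> (\<integral>y. d' y \<partial>lborel) = 0 \<and> (AE y in lborel. d' y = dQ b y)" if b: "b \<in> Basis" for b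
  proof -
    note rf = retarded_flux_potential[OF qg[of b] T, where x=x]
    obtain C where C: "\<And>y v. norm v \<le> 1 \<Longrightarrow> \<bar>Q b (y + v) - Q b y\<bar> \<le> C * norm v"
      using rf(3) unfolding Q_def by blast
    show ?thesis
    proof (rule integral_directional_derivative_eq_0[of "Q b" T b C])
      show "continuous_on UNIV (Q b)" unfolding Q_def by (rule rf(1))
      show "Q b y = 0" if "T \<le> norm y" for y unfolding Q_def by (rule rf(2)[OF that])
      show "norm b = 1" using b by simp
      show "\<bar>Q b (y + h *\<^sub>R b) - Q b y\<bar> \<le> C * \<bar>h\<bar>" if "\<bar>h\<bar> \<le> 1" for y h
        using C[of "h *\<^sub>R b" y] that b by simp
      show "AE y in lborel. ((\<lambda>h. Q b (y + h *\<^sub>R b)) has_real_derivative dQ b y) (at 0)"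
        using AE by eventually_elim (use rf(4)[where b=b] in \<open>auto simp: Q_def dQ_def\<close>)
    qed
  qed
  then obtain d' where d': "\<And>b. b \<in> Basis \<Longrightarrow> integrable lborel (d' b)"
    "\<And>b. b \<in> Basis \<Longrightarrow> (\<integral>y. d' b y \<partial>lborel) = 0" "\<And>b. b \<in> Basis \<Longrightarrow> AE y in lborel. d' b y = dQ b y"
    by metis
  have Gc: "continuous_on Slab G" and uc: "continuous_on Slab u" using has_gradD[OF u] by auto
  have Pc: "continuous_on UNIV P" by (rule continuous_on_UNIV_DERIV[OF P])
  have ec: "continuous_on Slab e" unfolding e_def
    by (intro continuous_intros Gc continuous_on_compose2[OF Pc uc]) auto
  have div: "(\<Sum>b\<in>Basis. Gq b (y, s) \<bullet> (b, 0)) = ut (y, s) * (H (0, 1) (y, s) \<bullet> (0, 1))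
      + (\<Sum>b\<in>Basis. us b (y, s) * (H (b, 0) (y, s) \<bullet> (0, 1))) + k (u (y, s)) * ut (y, s)" if "0 \<le> s" for y s
  proof -
    have "(\<Sum>b\<in>Basis. Gq b (y, s) \<bullet> (b, 0)) = ut (y, s) * (\<Sum>b\<in>Basis. H (b, 0) (y, s) \<bullet> (b, 0))
        + (\<Sum>b\<in>Basis. us b (y, s) * (H (b, 0) (y, s) \<bullet> (0, 1)))"
      by (simp add: Gq_def inner_add_left sum.distrib sum_distrib_left mixed_derivatives_commute[OF u H that])
    moreover have "(\<Sum>b\<in>Basis. H (b, 0) (y, s) \<bullet> (b, 0)) = H (0, 1) (y, s) \<bullet> (0, 1) + k (u (y, s))"
      using eq[of "(y, s)"] that by simp
    ultimately show ?thesis by (simp add: algebra_simps)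
  qed
  have energy: "integral {0..a} (\<lambda>s. \<Sum>b\<in>Basis. Gq b (y, s) \<bullet> (b, 0)) = e (y, a) - e (y, 0)" if a: "0 \<le> a" for y a
  proof (rule integral_unique, rule fundamental_theorem_of_calculus[OF a])
    fix s assume s: "s \<in> {0..a}"
    have td: "((\<lambda>s. f (y, s)) has_real_derivative Gf (y, s) \<bullet> (0, 1)) (at s within {0..a})" if "has_grad f Gf Slab" for f Gf
      by (rule DERIV_subset[OF has_grad_time_derivative[OF that]]) (use s in auto)
    have 1: "((\<lambda>s. (G (y, s) \<bullet> v)\<^sup>2) has_real_derivative 2 * (G (y, s) \<bullet> v) * (H v (y, s) \<bullet> (0, 1))) (at s within {0..a})" for v
      using DERIV_power[OF td[OF H[of v]], of 2] by (simp add: ac_simps)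
    have 2: "((\<lambda>s. P (u (y, s))) has_real_derivative k (u (y, s)) * (G (y, s) \<bullet> (0, 1))) (at s within {0..a})"
      by (rule DERIV_chain2[OF P td[OF u]])
    have "((\<lambda>s. e (y, s)) has_real_derivative
        (2 * (G (y, s) \<bullet> (0, 1)) * (H (0, 1) (y, s) \<bullet> (0, 1)) + (\<Sum>b\<in>Basis. 2 * (G (y, s) \<bullet> (b, 0)) * (H (b, 0) (y, s) \<bullet> (0, 1)))) / 2
        + k (u (y, s)) * (G (y, s) \<bullet> (0, 1))) (at s within {0..a})"
      unfolding e_def by (intro DERIV_add DERIV_cdivide DERIV_sum 1 2)
    also have "(2 * (G (y, s) \<bullet> (0, 1)) * (H (0, 1) (y, s) \<bullet> (0, 1)) + (\<Sum>b\<in>Basis. 2 * (G (y, s) \<bullet> (b, 0)) * (H (b, 0) (y, s) \<bullet> (0, 1)))) / 2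
        + k (u (y, s)) * (G (y, s) \<bullet> (0, 1)) = (\<Sum>b\<in>Basis. Gq b (y, s) \<bullet> (b, 0))"
      using s by (simp add: div ut_def us_def add_divide_distrib sum_divide_distrib)
    finally show "((\<lambda>s. e (y, s)) has_vector_derivative (\<Sum>b\<in>Basis. Gq b (y, s) \<bullet> (b, 0))) (at s within {0..a})"
      by (simp add: has_real_derivative_iff_has_vector_derivative)
  qed
  define L where "L y = indicator (cball 0 T) y *\<^sub>R P (u (x + y, T - norm y))" for y
  define R where "R y = indicator (cball 0 T) y *\<^sub>R e (x + y, 0)" for y
  have Li: "integrable lborel L" unfolding L_def
    by (rule borel_integrable_compact)
      (auto intro!: continuous_on_compose2[OF Pc] continuous_on_compose2[OF uc] continuous_intros)
  have Ri: "integrable lborel R" unfolding R_def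
    by (rule borel_integrable_compact) (auto intro!: continuous_on_compose2[OF ec] continuous_intros)
  have pointwise: "AE y in lborel. L y - R y \<le> (\<Sum>b\<in>Basis. d' b y)"
  proof -
    have "AE y in lborel. \<forall>b\<in>Basis. d' b y = dQ b y" by (rule AE_finite_allI) (use d'(3) in auto)
    with AE show ?thesis
    proof eventually_elim
      case (elim y)
      then have sum: "(\<Sum>b\<in>Basis. d' b y) = (\<Sum>b\<in>Basis. dQ b y)" by simp
      have rh: "0 \<le> retarded_height T y" by (simp add: retarded_height_def)
      have "(\<Sum>b\<in>Basis. integral {0..retarded_height T y} (\<lambda>s. Gq b (x + y, s) \<bullet> (b, 0)))
          = integral {0..retarded_height T y} (\<lambda>s. \<Sum>b\<in>Basis. Gq b (x + y, s) \<bullet> (b, 0))"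
        by (intro integral_sum[symmetric] integrable_continuous_real continuous_intros
              continuous_on_time_line[OF has_gradD(2)[OF qg]]) auto
      also have "\<dots> = e (x + y, retarded_height T y) - e (x + y, 0)" by (rule energy[OF rh])
      finally have dQsum: "(\<Sum>b\<in>Basis. dQ b y) = (\<Sum>b\<in>Basis. (if norm y < T then - (y \<bullet> b) / norm y else 0) * q b (x + y, retarded_height T y))
          + (e (x + y, retarded_height T y) - e (x + y, 0))"
        unfolding dQ_def by (simp add: sum.distrib)
      show ?case
      proof (cases "norm y < T")
        case True
        define Z where "Z = (x + y, T - norm y)"
        have rhT: "retarded_height T y = T - norm y" using True by (simp add: retarded_height_def)
        define g :: "real^3" where "g = (\<Sum>b\<in>Basis. us b Z *\<^sub>R b)"
        have gb: "g \<bullet> b = us b Z" if "b \<in> Basis" for b using that by (simp add: g_def inner_sum_left inner_Basis if_distrib cong: if_cong)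
        have gg: "(norm g)\<^sup>2 = (\<Sum>b\<in>Basis. (us b Z)\<^sup>2)"
          unfolding power2_norm_eq_inner by (subst euclidean_inner) (simp add: gb power2_eq_square)
        have "(\<Sum>b\<in>Basis. (y \<bullet> b) / norm y * q b Z) = ut Z * (sgn y \<bullet> g)"
          by (subst (2) euclidean_inner) (simp add: q_def gb sgn_div_norm sum_distrib_left divide_inverse ac_simps)
        also have "\<dots> \<le> \<bar>ut Z\<bar> * norm g"
        proof -
          have "\<bar>sgn y \<bullet> g\<bar> \<le> 1 * norm g"
            by (rule order_trans[OF Cauchy_Schwarz_ineq2]) (intro mult_right_mono norm_sgn_le norm_ge_zero)
          then have "\<bar>ut Z * (sgn y \<bullet> g)\<bar> \<le> \<bar>ut Z\<bar> * norm g" unfolding abs_mult by (intro mult_left_mono) auto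
          then show ?thesis by linarith
        qed
        also have "\<dots> \<le> ((ut Z)\<^sup>2 + (norm g)\<^sup>2) / 2"
          using sum_squares_bound[of "\<bar>ut Z\<bar>" "norm g"] by (simp add: power2_eq_square)
        also have "\<dots> = e Z - P (u Z)" by (simp add: gg e_def ut_def us_def)
        finally have "(\<Sum>b\<in>Basis. (y \<bullet> b) / norm y * q b Z) \<le> e Z - P (u Z)" .
        moreover have "(\<Sum>b\<in>Basis. dQ b y) = - (\<Sum>b\<in>Basis. (y \<bullet> b) / norm y * q b Z) + (e Z - e (x + y, 0))"
          unfolding dQsum rhT Z_def[symmetric] using True by (simp add: sum_negf)
        ultimately show ?thesis using True unfolding sum L_def R_def Z_def[symmetric] by simp
      next
        case False
        then have "T < norm y" using elim by auto
        then show ?thesis unfolding sum dQsum by (simp add: L_def R_def retarded_height_def)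
      qed
    qed
  qed
  have "(\<integral>y. L y - R y \<partial>lborel) \<le> (\<integral>y. (\<Sum>b\<in>Basis. d' b y) \<partial>lborel)"
    by (rule integral_mono_AE[OF _ _ pointwise]) (use Li Ri d'(1) in auto)
  also have "\<dots> = 0" using d'(1,2) by simp
  finally show ?thesis using Li Ri unfolding L_def[abs_def] R_def[abs_def] by simp
qed

section \<open>The truncated nonlinearity\<close>

lemma DERIV_mult_abs_powr:
  fixes a :: real assumes a: "0 < a"
  shows "((\<lambda>v. v * \<bar>v\<bar> powr a) has_real_derivative (a + 1) * \<bar>v\<bar> powr a) (at v)"
proof -
  have pos: "((\<lambda>v. v * \<bar>v\<bar> powr a) has_real_derivative (a + 1) * \<bar>v\<bar> powr a) (at v)" if v: "0 < v" for v
  proof -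
    have "((\<lambda>v. v powr (a + 1)) has_real_derivative (a + 1) * v powr (a + 1 - 1)) (at v)"
      using v by (rule has_real_derivative_powr)
    then have "((\<lambda>v. v powr (a + 1)) has_real_derivative (a + 1) * \<bar>v\<bar> powr a) (at v)" using v by simp
    moreover have "\<forall>\<^sub>F x in nhds v. x powr (a + 1) = x * \<bar>x\<bar> powr a"
      using eventually_gt_at_top eventually_nhds_in_open[of "{0<..}" v] v
      by (auto elim!: eventually_mono simp: powr_add mult.commute)
    ultimately show ?thesis by (simp add: DERIV_cong_ev[OF refl])
  qed
  consider "0 < v" | "v < 0" | "v = 0" by linarith
  then show ?thesis
  proof cases
    case 1 then show ?thesis by (rule pos)
  next
    case 2
    then have "((\<lambda>x. - (- x * \<bar>- x\<bar> powr a)) has_real_derivative - ((a + 1) * \<bar>- v\<bar> powr a * - 1)) (at v)"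
      by (intro DERIV_minus DERIV_chain2[OF pos]) (auto intro!: derivative_eq_intros)
    then show ?thesis by simp
  next
    case 3
    have "isCont (\<lambda>h::real. \<bar>h\<bar> powr a) 0"
      using a by (intro continuous_intros) auto
    then have "((\<lambda>h::real. \<bar>h\<bar> powr a) \<longlongrightarrow> 0) (at 0)"
      using a by (simp add: isCont_def)
    then have "((\<lambda>h::real. (h * \<bar>h\<bar> powr a) / h) \<longlongrightarrow> 0) (at 0)"
      by (rule Lim_transform_eventually) (auto simp: eventually_at_filter)
    then show ?thesis using 3 a by (simp add: DERIV_def)
  qed
qed

text \<open>
  The derivative vanishes at the point where the two branches meet, so they fit together.
\<close>

lemma DERIV_max_0:
  fixes g g' :: "real \<Rightarrow> real"
  assumes g: "\<And>x. (g has_real_derivative g' x) (at x)" and g0: "g' 0 = 0"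
  shows "((\<lambda>x. g (max 0 x)) has_real_derivative g' (max 0 x)) (at x)"
proof -
  consider "0 < x" | "x < 0" | "x = 0" by linarith
  then show ?thesis
  proof cases
    case 1
    have "\<forall>\<^sub>F y in nhds x. g y = g (max 0 y)"
      using eventually_nhds_in_open[of "{0<..}" x] 1 by (auto elim!: eventually_mono)
    then show ?thesis using g[of x] 1 by (simp add: DERIV_cong_ev[OF refl])
  next
    case 2
    have "\<forall>\<^sub>F y in nhds x. g 0 = g (max 0 y)"
      using eventually_nhds_in_open[of "{..<0}" x] 2 by (auto elim!: eventually_mono simp: max_def)
    then have "((\<lambda>y. g (max 0 y)) has_real_derivative 0) (at x)"
      by (subst DERIV_cong_ev[OF refl _ refl, symmetric]) auto
    then show ?thesis using 2 g0 by (simp add: max_def)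
  next
    case 3
    have "((\<lambda>h. (g h - g 0) / h) \<longlongrightarrow> 0) (at 0)"
      using g[of 0] g0 by (simp add: DERIV_def)
    then have "((\<lambda>h. norm ((g h - g 0) / h)) \<longlongrightarrow> 0) (at 0)" by (rule tendsto_norm_zero)
    then have "((\<lambda>h. (g (max 0 h) - g 0) / h) \<longlongrightarrow> 0) (at 0)"
      by (rule Lim_null_comparison[rotated]) (auto intro!: always_eventually simp: max_def divide_le_0_iff)
    then show ?thesis using 3 g0 by (simp add: DERIV_def)
  qed
qed

text \<open>
  The function \<open>x - arctan x\<close> vanishes to third order at 0, so that its positive branch
  continues the zero function as a function of class C2. Subtracting it bends the identity
  into a bounded function.
\<close>

definition bend :: "real \<Rightarrow> real" where "bend x = max 0 x - arctan (max 0 x)"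
definition bend' :: "real \<Rightarrow> real" where "bend' x = 1 - inverse (1 + (max 0 x)\<^sup>2)"
definition bend'' :: "real \<Rightarrow> real" where "bend'' x = 2 * max 0 x / (1 + (max 0 x)\<^sup>2)\<^sup>2"

lemma bend_derivatives:
  "(bend has_real_derivative bend' x) (at x)" "(bend' has_real_derivative bend'' x) (at x)"
proof -
  have nz: "1 + y\<^sup>2 \<noteq> (0::real)" for y by (metis add_nonneg_eq_0_iff one_neq_zero zero_le_one zero_le_power2)
  show "(bend has_real_derivative bend' x) (at x)"
    unfolding bend_def[abs_def] bend'_def
    by (rule DERIV_max_0[where g="\<lambda>y. y - arctan y" and g'="\<lambda>y. 1 - inverse (1 + y\<^sup>2)"])
      (auto intro!: derivative_eq_intros)
  show "(bend' has_real_derivative bend'' x) (at x)"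
    unfolding bend'_def[abs_def] bend''_def
    by (rule DERIV_max_0[where g="\<lambda>y. 1 - inverse (1 + y\<^sup>2)" and g'="\<lambda>y. 2 * y / (1 + y\<^sup>2)\<^sup>2"])
      (use nz in \<open>auto intro!: derivative_eq_intros simp: power2_eq_square divide_inverse\<close>)
qed

lemma bend'_bounds: "0 \<le> bend' x" "bend' x \<le> 1" "x \<le> 0 \<Longrightarrow> bend' x = 0"
proof -
  have "inverse (1 + (max 0 x)\<^sup>2) \<le> inverse 1" by (rule le_imp_inverse_le) auto
  then show "0 \<le> bend' x" by (simp add: bend'_def)
  have "0 \<le> inverse (1 + (max 0 x)\<^sup>2)" by simp
  then show "bend' x \<le> 1" unfolding bend'_def by linarith
  show "x \<le> 0 \<Longrightarrow> bend' x = 0" by (simp add: bend'_def max_def)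
qed

lemma bend''_bounds: "\<bar>bend'' x\<bar> \<le> 1"
proof -
  define m where "m = max 0 x"
  have m: "0 \<le> m" by (simp add: m_def)
  have "2 * m \<le> 1 + m\<^sup>2" using sum_squares_bound[of 1 m] by simp
  also have "\<dots> \<le> (1 + m\<^sup>2)\<^sup>2" by (rule self_le_power) auto
  finally have "2 * m / (1 + m\<^sup>2)\<^sup>2 \<le> 1" by (subst divide_le_eq_1) (auto simp: add_pos_nonneg)
  then show ?thesis using m by (simp add: bend''_def m_def[symmetric])
qed

text \<open>
  The identity on \<open>[-1, 1]\<close>, continued by \<open>1 + arctan (v - 1)\<close> for \<open>v > 1\<close> and oddly: a
  bounded increasing function of class C2.
\<close>

definition cutoff :: "real \<Rightarrow> real" where "cutoff v = v - bend (v - 1) + bend (- v - 1)"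
definition cutoff' :: "real \<Rightarrow> real" where "cutoff' v = 1 - bend' (v - 1) - bend' (- v - 1)"
definition cutoff'' :: "real \<Rightarrow> real" where "cutoff'' v = - bend'' (v - 1) + bend'' (- v - 1)"

lemma cutoff_derivatives:
  "(cutoff has_real_derivative cutoff' v) (at v)" "(cutoff' has_real_derivative cutoff'' v) (at v)"
proof -
  have 1: "((\<lambda>v. v - 1) has_real_derivative 1) (at v)" for v :: real by (auto intro!: derivative_eq_intros)
  have 2: "((\<lambda>v. - v - 1) has_real_derivative - 1) (at v)" for v :: real by (auto intro!: derivative_eq_intros)
  have "((\<lambda>v. v - bend (v - 1) + bend (- v - 1)) has_real_derivative 1 - bend' (v - 1) * 1 + bend' (- v - 1) * - 1) (at v)"
    by (intro DERIV_add DERIV_diff DERIV_ident DERIV_chain2[OF bend_derivatives(1)] 1 2)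
  then show "(cutoff has_real_derivative cutoff' v) (at v)" unfolding cutoff_def[abs_def] cutoff'_def by simp
  have "((\<lambda>v. 1 - bend' (v - 1) - bend' (- v - 1)) has_real_derivative 0 - bend'' (v - 1) * 1 - bend'' (- v - 1) * - 1) (at v)"
    by (intro DERIV_diff DERIV_const DERIV_chain2[OF bend_derivatives(2)] 1 2)
  then show "(cutoff' has_real_derivative cutoff'' v) (at v)" unfolding cutoff'_def[abs_def] cutoff''_def by simp
qed

lemma cutoff'_bounds: "0 \<le> cutoff' v" "cutoff' v \<le> 1"
  using bend'_bounds[of "v - 1"] bend'_bounds[of "- v - 1"] by (cases "0 \<le> v"; simp add: cutoff'_def)+

lemma cutoff''_bounds: "\<bar>cutoff'' v\<bar> \<le> 2"
  using bend''_bounds[of "v - 1"] bend''_bounds[of "- v - 1"] by (simp add: cutoff''_def)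

lemma cutoff_minus: "cutoff (- v) = - cutoff v"
  by (simp add: cutoff_def)

lemma cutoff_eq: assumes "\<bar>v\<bar> \<le> 1" shows "cutoff v = v"
proof -
  have "max 0 (v - 1) = 0" "max 0 (- v - 1) = 0" using assms by (auto intro!: max_absorb1)
  then show ?thesis by (simp add: cutoff_def bend_def)
qed

lemma cutoff_nonneg: assumes "0 \<le> v" shows "0 \<le> cutoff v" "cutoff v \<le> v" "cutoff v \<le> 3"
proof -
  have "bend (- v - 1) = 0" using assms by (simp add: bend_def max_def)
  then have c: "cutoff v = v - bend (v - 1)" by (simp add: cutoff_def)
  have "0 \<le> cutoff v \<and> cutoff v \<le> v \<and> cutoff v \<le> 3"
  proof (cases "v \<le> 1")
    case True then show ?thesis using assms cutoff_eq[of v] by simp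
  next
    case False
    then have c: "cutoff v = 1 + arctan (v - 1)" by (simp add: c bend_def)
    have "0 \<le> arctan (v - 1)" "arctan (v - 1) \<le> v - 1" using False by (auto simp: arctan_le_self)
    moreover have "arctan (v - 1) < 2" using arctan_ubound[of "v - 1"] pi_less_4 by linarith
    ultimately show ?thesis unfolding c by linarith
  qed
  then show "0 \<le> cutoff v" "cutoff v \<le> v" "cutoff v \<le> 3" by auto
qed

lemma cutoff_abs: "\<bar>cutoff v\<bar> \<le> 3" "\<bar>cutoff v\<bar> \<le> \<bar>v\<bar>"
  using cutoff_nonneg[of v] cutoff_nonneg[of "- v"] cutoff_minus[of v] by (cases "0 \<le> v"; simp)+

lemma continuous_antiderivative:
  fixes k :: "real \<Rightarrow> real"
  assumes "continuous_on UNIV k"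
  obtains P where "P 0 = 0" "\<And>v. (P has_real_derivative k v) (at v)"
proof -
  define P where "P v = (LBINT y=ereal 0..ereal v. k y)" for v
  have "(P has_real_derivative k v) (at v)" for v
  proof -
    have "((\<lambda>u. LBINT y=ereal 0..ereal u. k y) has_vector_derivative k v) (at v within {- \<bar>v\<bar> - 1..\<bar>v\<bar> + 1})"
      by (rule interval_integral_FTC2) (auto intro: continuous_on_subset[OF assms])
    moreover have "at v within {- \<bar>v\<bar> - 1..\<bar>v\<bar> + 1} = at v"
      by (rule at_within_interior) auto
    ultimately show ?thesis unfolding P_def by (simp add: has_real_derivative_iff_has_vector_derivative)
  qed
  moreover have "P 0 = 0" by (simp add: P_def)
  ultimately show thesis using that by blast
qed

text \<open>
  Composing the nonlinearity with the cutoff gives a function \<open>k\<close> with bounded first and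
  second derivatives, as the fixed point theorem requires, which agrees with the original one
  on \<open>[-1, 1]\<close>. It retains the features used in the estimates: \<open>k\<close> is bounded by a multiple of
  \<open>|cutoff v|^5\<close>, and its antiderivative \<open>P\<close> controls \<open>|cutoff v|^6\<close> while being bounded by a
  multiple of \<open>v^6\<close>, which makes the initial energy finite.
\<close>

lemma truncated_nonlinearity:
  fixes p :: real assumes p: "p > 6"
  obtains k k' k'' P :: "real \<Rightarrow> real" and L C :: real where
    "\<And>v. (k has_real_derivative k' v) (at v)" "\<And>v. (k' has_real_derivative k'' v) (at v)"
    "continuous_on UNIV k''" "\<And>v. \<bar>k' v\<bar> \<le> L" "\<And>v. \<bar>k'' v\<bar> \<le> L"
    "\<And>v. \<bar>v\<bar> \<le> 1 \<Longrightarrow> k v = v ^ 5 + v * \<bar>v\<bar> powr (p - 2)"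
    "0 < C" "\<And>v. \<bar>k v\<bar> \<le> C * \<bar>cutoff v\<bar> ^ 5"
    "\<And>v. (P has_real_derivative k v) (at v)" "\<And>v. \<bar>cutoff v\<bar> ^ 6 \<le> 6 * P v" "\<And>v. 6 * P v \<le> C * v ^ 6"
proof -
  define f where "f v = v ^ 5 + v * \<bar>v\<bar> powr (p - 2)" for v :: real
  define f' where "f' v = 5 * v ^ 4 + (p - 1) * (v * (v * \<bar>v\<bar> powr (p - 4)))" for v :: real
  define f'' where "f'' v = 20 * v ^ 3 + (p - 1) * (v * ((p - 3) * \<bar>v\<bar> powr (p - 4)) + v * \<bar>v\<bar> powr (p - 4))" for v :: real
  define k where "k v = f (cutoff v)" for v
  define k' where "k' v = f' (cutoff v) * cutoff' v" for v
  define k'' where "k'' v = f'' (cutoff v) * cutoff' v * cutoff' v + f' (cutoff v) * cutoff'' v" for v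
  define C where "C = 1 + 3 powr (p - 6)"
  \<comment> \<open>With the power written in this form, the second derivative of f follows from the product
    rule also at 0.\<close>
  have ident: "\<bar>v\<bar> powr (p - 2) = v * (v * \<bar>v\<bar> powr (p - 4))" for v :: real
  proof (cases "v = 0")
    case False
    have "\<bar>v\<bar> powr (2 + (p - 4)) = \<bar>v\<bar> powr 2 * \<bar>v\<bar> powr (p - 4)" by (rule powr_add)
    also have "\<bar>v\<bar> powr 2 = v * v" using False by (simp add: powr_numeral power2_eq_square)
    finally show ?thesis by (simp add: algebra_simps)
  qed simp
  have df: "(f has_real_derivative f' v) (at v)" for v
  proof -
    have "((\<lambda>v::real. v ^ 5 + v * \<bar>v\<bar> powr (p - 2)) has_real_derivative 5 * v ^ 4 + (p - 2 + 1) * \<bar>v\<bar> powr (p - 2)) (at v)"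
      using p by (intro DERIV_add DERIV_mult_abs_powr) (auto intro!: derivative_eq_intros)
    then show ?thesis unfolding f_def[abs_def] f'_def ident[symmetric] by simp
  qed
  have df': "(f' has_real_derivative f'' v) (at v)" for v
  proof -
    have "((\<lambda>v. v * (v * \<bar>v\<bar> powr (p - 4))) has_real_derivative 1 * (v * \<bar>v\<bar> powr (p - 4)) + ((p - 4 + 1) * \<bar>v\<bar> powr (p - 4)) * v) (at v)"
      using p by (intro DERIV_mult DERIV_ident DERIV_mult_abs_powr) auto
    from DERIV_cmult[OF this, of "p - 1"]
    have "((\<lambda>v. 5 * v ^ 4 + (p - 1) * (v * (v * \<bar>v\<bar> powr (p - 4)))) has_real_derivative
       20 * v ^ 3 + (p - 1) * (1 * (v * \<bar>v\<bar> powr (p - 4)) + ((p - 4 + 1) * \<bar>v\<bar> powr (p - 4)) * v)) (at v)"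
      by (intro DERIV_add) (auto intro!: derivative_eq_intros)
    then show ?thesis unfolding f'_def[abs_def] f''_def by (simp add: algebra_simps)
  qed
  have dk: "(k has_real_derivative k' v) (at v)" for v
    unfolding k_def[abs_def] k'_def by (rule DERIV_chain2[OF df cutoff_derivatives(1)])
  have dk': "(k' has_real_derivative k'' v) (at v)" for v
  proof -
    have "(k' has_real_derivative (f'' (cutoff v) * cutoff' v) * cutoff' v + cutoff'' v * f' (cutoff v)) (at v)"
      unfolding k'_def[abs_def] by (intro DERIV_mult DERIV_chain2[OF df' cutoff_derivatives(1)] cutoff_derivatives(2))
    then show ?thesis by (simp add: k''_def mult.commute)
  qed
  have cont: "continuous_on UNIV cutoff" "continuous_on UNIV cutoff'" "continuous_on UNIV f" "continuous_on UNIV f'" "continuous_on UNIV k"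
    using cutoff_derivatives df df' dk by (auto intro!: continuous_at_imp_continuous_on DERIV_isCont)
  have contf'': "continuous_on UNIV f''" unfolding f''_def[abs_def] using p by (intro continuous_intros continuous_on_powr') auto
  have cont'': "continuous_on UNIV cutoff''"
    unfolding cutoff''_def[abs_def] bend''_def
    by (intro continuous_intros) (auto simp: add_nonneg_eq_0_iff)
  have kc: "continuous_on UNIV k''" unfolding k''_def[abs_def]
    by (intro continuous_intros cont cont'' continuous_on_compose2[OF contf'' cont(1)] continuous_on_compose2[OF cont(4) cont(1)]) auto
  obtain B1 where B1: "B1 > 0" "\<And>v. norm v \<le> 3 \<Longrightarrow> norm (f' v) \<le> B1"
    using continuous_on_UNIV_bounded[OF cont(4), of 3] by blast
  obtain B2 where B2: "B2 > 0" "\<And>v. norm v \<le> 3 \<Longrightarrow> norm (f'' v) \<le> B2"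
    using continuous_on_UNIV_bounded[OF contf'', of 3] by blast
  have b1: "\<bar>f' (cutoff v)\<bar> \<le> B1" and b2: "\<bar>f'' (cutoff v)\<bar> \<le> B2" for v
    using B1(2)[of "cutoff v"] B2(2)[of "cutoff v"] cutoff_abs(1)[of v] by auto
  have am: "\<bar>x * y\<bar> \<le> X * Y" if "\<bar>x\<bar> \<le> X" "\<bar>y\<bar> \<le> Y" for x y X Y :: real
    unfolding abs_mult using that by (intro mult_mono) auto
  have c1: "\<bar>cutoff' v\<bar> \<le> 1" for v using cutoff'_bounds[of v] by simp
  have L1: "\<bar>k' v\<bar> \<le> B2 + 2 * B1" for v
    using am[OF b1 c1, of v v] B1 B2 unfolding k'_def by linarith
  have L2: "\<bar>k'' v\<bar> \<le> B2 + 2 * B1" for v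
    using am[OF am[OF b2 c1] c1, of v v v] am[OF b1 cutoff''_bounds, of v v] unfolding k''_def by linarith
  have keq: "k v = v ^ 5 + v * \<bar>v\<bar> powr (p - 2)" if "\<bar>v\<bar> \<le> 1" for v
    using cutoff_eq[OF that] by (simp add: k_def f_def)
  have C: "1 \<le> C" by (simp add: C_def)
  have fpos: "a ^ 5 \<le> f a" "f a \<le> C * a ^ 5" if a: "0 \<le> a" "a \<le> 3" for a
  proof -
    show "a ^ 5 \<le> f a" using a by (simp add: f_def)
    show "f a \<le> C * a ^ 5"
    proof (cases "a = 0")
      case False
      have "a * a powr (p - 2) = a powr (1 + (p - 2))" using a False by (subst powr_add) simp
      also have "\<dots> = a powr (5 + (p - 6))" by simp
      also have "\<dots> = a ^ 5 * a powr (p - 6)" using a False by (subst powr_add) (simp add: powr_numeral)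
      also have "\<dots> \<le> a ^ 5 * 3 powr (p - 6)" using a p by (intro mult_left_mono powr_mono2) auto
      finally show ?thesis using a by (simp add: f_def C_def algebra_simps)
    qed (simp add: f_def)
  qed
  have fminus: "f (- a) = - f a" for a by (simp add: f_def)
  have fabs: "\<bar>f a\<bar> \<le> C * \<bar>a\<bar> ^ 5" if a: "0 \<le> a" "a \<le> 3" for a
  proof -
    have "0 \<le> a ^ 5" using a(1) by (rule zero_le_power)
    then have "\<bar>f a\<bar> \<le> C * a ^ 5" using fpos[OF a] by linarith
    then show ?thesis using a by simp
  qed
  have kb: "\<bar>k v\<bar> \<le> C * \<bar>cutoff v\<bar> ^ 5" for v
  proof (cases "0 \<le> v")
    case True
    show ?thesis unfolding k_def by (rule fabs) (rule cutoff_nonneg[OF True])+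
  next
    case False
    then have "0 \<le> - v" by simp
    from fabs[OF cutoff_nonneg(1)[OF this] cutoff_nonneg(3)[OF this]]
    show ?thesis by (simp add: k_def cutoff_minus fminus)
  qed
  obtain P where P0: "P 0 = 0" and dP: "\<And>v. (P has_real_derivative k v) (at v)"
    using continuous_antiderivative[OF cont(5)] by blast
  have kminus: "k (- v) = - k v" for v by (simp add: k_def cutoff_minus fminus)
  have half: "cutoff v ^ 6 \<le> 6 * R v \<and> 6 * R v \<le> C * v ^ 6"
    if v: "0 \<le> v" and R0: "R 0 = 0" and dR: "\<And>v. 0 \<le> v \<Longrightarrow> (R has_real_derivative k v) (at v)" for R :: "real \<Rightarrow> real" and v
  proof
    have c0: "cutoff 0 = 0" by (simp add: cutoff_eq)
    have "6 * R 0 - cutoff 0 ^ 6 \<le> 6 * R v - cutoff v ^ 6"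
    proof (rule DERIV_nonneg_imp_nondecreasing[OF v])
      fix x assume x: "0 \<le> x" "x \<le> v"
      note c = cutoff_nonneg[OF x(1)]
      have "((\<lambda>x. 6 * R x - cutoff x ^ 6) has_real_derivative 6 * k x - 6 * cutoff x ^ 5 * cutoff' x) (at x)"
        using dR[OF x(1)] cutoff_derivatives(1)[of x] by (auto intro!: derivative_eq_intros)
      moreover have "cutoff x ^ 5 * cutoff' x \<le> cutoff x ^ 5 * 1" using c cutoff'_bounds by (intro mult_left_mono) auto
      ultimately show "\<exists>y. ((\<lambda>x. 6 * R x - cutoff x ^ 6) has_real_derivative y) (at x) \<and> 0 \<le> y"
        using fpos(1)[OF c(1,3)] by (intro exI conjI) (auto simp: k_def)
    qed
    then show "cutoff v ^ 6 \<le> 6 * R v" by (simp add: c0 R0)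
    have "C * 0 ^ 6 - 6 * R 0 \<le> C * v ^ 6 - 6 * R v"
    proof (rule DERIV_nonneg_imp_nondecreasing[OF v])
      fix x assume x: "0 \<le> x" "x \<le> v"
      note c = cutoff_nonneg[OF x(1)]
      have "((\<lambda>x. C * x ^ 6 - 6 * R x) has_real_derivative 6 * (C * x ^ 5 - k x)) (at x)"
        using dR[OF x(1)] by (auto intro!: derivative_eq_intros simp: algebra_simps)
      moreover have "C * cutoff x ^ 5 \<le> C * x ^ 5" using c x C by (intro mult_left_mono power_mono) auto
      ultimately show "\<exists>y. ((\<lambda>x. C * x ^ 6 - 6 * R x) has_real_derivative y) (at x) \<and> 0 \<le> y"
        using fpos(2)[OF c(1,3)] by (intro exI conjI) (auto simp: k_def)
    qed
    then show "6 * R v \<le> C * v ^ 6" by (simp add: R0)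
  qed
  have "\<bar>cutoff v\<bar> ^ 6 \<le> 6 * P v \<and> 6 * P v \<le> C * v ^ 6" for v
  proof (cases "0 \<le> v")
    case True
    then show ?thesis using half[OF True P0 dP] by simp
  next
    case False
    have "((\<lambda>v. P (- v)) has_real_derivative k v) (at v)" for v
    proof -
      have "((\<lambda>v. P (- v)) has_real_derivative k (- v) * - 1) (at v)"
        by (rule DERIV_chain2[OF dP]) (auto intro!: derivative_eq_intros)
      then show ?thesis by (simp add: kminus)
    qed
    from half[of "- v" "\<lambda>v. P (- v)", OF _ _ this] show ?thesis using False P0 by (simp add: cutoff_minus)
  qed
  then have PP: "\<bar>cutoff v\<bar> ^ 6 \<le> 6 * P v" "6 * P v \<le> C * v ^ 6" for v by auto
  have C0: "0 < C" using C by simp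
  show thesis
    by (rule that[of k k' k'' "B2 + 2 * B1" C P]) (fact dk dk' kc L1 L2 keq C0 kb dP PP)+
qed

section \<open>Polar coordinates\<close>

lemma nn_integral_scale_space:
  fixes f :: "real^3 \<Rightarrow> ennreal"
  assumes [measurable]: "f \<in> borel_measurable borel" and c: "0 < c"
  shows "(\<integral>\<^sup>+y. f y \<partial>lborel) = ennreal (c ^ 3) * (\<integral>\<^sup>+z. f (c *\<^sub>R z) \<partial>lborel)"
  by (subst lborel_affine[of c "0 :: real^3"])
    (use c in \<open>auto simp: nn_integral_density nn_integral_distr nn_integral_cmult\<close>)

lemma nn_integral_inverse_power_4:
  assumes a: "0 < a"
  shows "(\<integral>\<^sup>+s. ennreal (inverse (s ^ 4)) * indicator {a..} s \<partial>lborel) = ennreal (1 / (3 * a ^ 3))"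
proof -
  have "(\<integral>\<^sup>+s. ennreal (inverse (s ^ 4)) * indicator {a..} s \<partial>lborel) = ennreal (0 - (- 1 / (3 * a ^ 3)))"
  proof (rule nn_integral_FTC_atLeast)
    show "((\<lambda>s. - 1 / (3 * s ^ 3)) has_real_derivative inverse (x ^ 4)) (at x)" if "a \<le> x" for x
      using a that by (auto intro!: derivative_eq_intros simp: field_simps power_numeral_reduce)
    show "((\<lambda>s::real. - 1 / (3 * s ^ 3)) \<longlongrightarrow> 0) at_top" by real_asymp
  qed (use a in auto)
  then show ?thesis by simp
qed

lemma measurable_sgn_compose [measurable (raw)]:
  fixes f :: "'a \<Rightarrow> real^3"
  shows "f \<in> borel_measurable M \<Longrightarrow> (\<lambda>x. sgn (f x)) \<in> borel_measurable M"
  by (rule measurable_compose[OF _ sgn_measurable])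

lemma cball_measurable [measurable]: "cball (0::real^3) t \<in> sets borel"
  by simp

text \<open>
  Here the direction is averaged over the unit ball. Substituting \<open>r = |z| s\<close> for fixed \<open>z\<close>,
  exchanging the integrals, substituting \<open>y = s z\<close> for fixed \<open>s\<close>, and exchanging again turns
  the left side into the integral of \<open>g y |y|^3\<close> times \<open>\<integral> s^(-4) ds\<close> over \<open>s \<ge> |y|\<close>, which is
  \<open>1 / (3 |y|^3)\<close>.
\<close>

lemma polar_coordinates:
  fixes g :: "real^3 \<Rightarrow> ennreal"
  assumes g [measurable]: "g \<in> borel_measurable borel"
  shows "(\<integral>\<^sup>+r. (\<integral>\<^sup>+z. ennreal (r\<^sup>2) * indicator {0..t} r * (indicator (cball 0 1) z * g (r *\<^sub>R sgn z)) \<partial>lborel) \<partial>lborel)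
     = ennreal (1 / 3) * (\<integral>\<^sup>+y. indicator (cball 0 t) y * g y \<partial>lborel)"
proof -
  let ?A = "\<lambda>r z. ennreal (r\<^sup>2) * indicator {0..t} r * (indicator (cball 0 1) z * g (r *\<^sub>R sgn z))"
  let ?E = "\<lambda>s z. ennreal (s\<^sup>2) * indicator {0..} s * (ennreal (norm z ^ 3) * indicator (cball 0 1) z * (indicator (cball 0 t) (s *\<^sub>R z) * g (s *\<^sub>R z)))"
  let ?D = "\<lambda>s y. (ennreal (inverse (s ^ 4)) * indicator {norm y..} s) * (ennreal (norm y ^ 3) * (indicator (cball 0 t) y * g y))"
  have AE0: "AE z in lborel. z \<noteq> (0::real^3)" by (rule AE_lborel_singleton)
  have "(\<integral>\<^sup>+r. (\<integral>\<^sup>+z. ?A r z \<partial>lborel) \<partial>lborel)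
    = (\<integral>\<^sup>+z. (\<integral>\<^sup>+r. ?A r z \<partial>lborel) \<partial>lborel)"
    by (rule lborel_pair.Fubini'[symmetric]) measurable
  also have "\<dots> = (\<integral>\<^sup>+z. (\<integral>\<^sup>+s. ?E s z \<partial>lborel) \<partial>lborel)"
  proof (rule nn_integral_cong_AE)
    show "AE z in lborel. (\<integral>\<^sup>+r. ?A r z \<partial>lborel)
      = (\<integral>\<^sup>+s. ?E s z \<partial>lborel)"
      using AE0
    proof eventually_elim
      case (elim z)
      then have z: "0 < norm z" by simp
      have "(\<integral>\<^sup>+r. ?A r z \<partial>lborel)
         = ennreal (norm z) * (\<integral>\<^sup>+s. ?A (norm z * s) z \<partial>lborel)"
        using z by (subst nn_integral_real_affine[where c="norm z" and t=0]) auto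
      also have "\<dots> = (\<integral>\<^sup>+s. ennreal (norm z) * (?A (norm z * s) z) \<partial>lborel)"
        by (rule nn_integral_cmult[symmetric]) measurable
      also have "\<dots> = (\<integral>\<^sup>+s. ?E s z \<partial>lborel)"
      proof (rule nn_integral_cong)
        fix s :: real
        have 1: "ennreal (norm z) * ennreal ((norm z * s)\<^sup>2) = ennreal (s\<^sup>2) * ennreal (norm z ^ 3)"
        proof -
          have "ennreal (norm z) * ennreal ((norm z * s)\<^sup>2) = ennreal (norm z * (norm z * s)\<^sup>2)"
            by (rule ennreal_mult[symmetric]) auto
          also have "norm z * (norm z * s)\<^sup>2 = s\<^sup>2 * norm z ^ 3"
            by (simp add: power2_eq_square power3_eq_cube)
          also have "ennreal (s\<^sup>2 * norm z ^ 3) = ennreal (s\<^sup>2) * ennreal (norm z ^ 3)"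
            by (rule ennreal_mult) auto
          finally show ?thesis .
        qed
        have 2: "indicator {0..t} (norm z * s) = (indicator {0..} s * indicator (cball 0 t) (s *\<^sub>R z) :: ennreal)"
          using z by (auto simp: indicator_def zero_le_mult_iff mult.commute split: if_splits)
        have 3: "(norm z * s) *\<^sub>R sgn z = s *\<^sub>R z" using z by (simp add: sgn_div_norm)
        have "ennreal (norm z) * (?A (norm z * s) z)
          = (ennreal (norm z) * ennreal ((norm z * s)\<^sup>2)) * indicator {0..t} (norm z * s) * (indicator (cball 0 1) z * g ((norm z * s) *\<^sub>R sgn z))"
          by (simp only: ac_simps)
        then show "ennreal (norm z) * (?A (norm z * s) z)
          = ?E s z"
          unfolding 1 2 3 by (simp only: ac_simps)
      qed
      finally show ?case .
    qed
  qed
  also have "\<dots> = (\<integral>\<^sup>+s. (\<integral>\<^sup>+z. ?E s z \<partial>lborel) \<partial>lborel)"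
    by (rule lborel_pair.Fubini') measurable
  also have "\<dots> = (\<integral>\<^sup>+s. (\<integral>\<^sup>+y. ?D s y \<partial>lborel) \<partial>lborel)"
  proof (rule nn_integral_cong_AE)
    have "AE s in lborel. s \<noteq> (0::real)" by (rule AE_lborel_singleton)
    then show "AE s in lborel. (\<integral>\<^sup>+z. ?E s z \<partial>lborel)
      = (\<integral>\<^sup>+y. ?D s y \<partial>lborel)"
    proof eventually_elim
      case (elim s)
      show ?case
      proof (cases "0 < s")
        case False
        then have "indicator {norm y..} s = (0::ennreal)" for y :: "real^3"
          using elim norm_ge_zero[of y] by (auto simp: indicator_def simp del: norm_ge_zero)
        moreover have "indicator {0..} s = (0::ennreal)" using False elim by (auto simp: indicator_def)
        ultimately show ?thesis by simp
      next
        case s: True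
        have "(\<integral>\<^sup>+y. ?D s y \<partial>lborel)
          = ennreal (s ^ 3) * (\<integral>\<^sup>+z. ?D s (s *\<^sub>R z) \<partial>lborel)"
        proof (rule nn_integral_scale_space[OF _ s])
          have "(\<lambda>y::real^3. indicator {norm y..} s :: ennreal) = indicator {y. norm y \<le> s}"
            by (auto simp: indicator_def fun_eq_iff)
          moreover have "{y::real^3. norm y \<le> s} \<in> sets borel" by measurable
          ultimately have [measurable]: "(\<lambda>y::real^3. indicator {norm y..} s :: ennreal) \<in> borel_measurable borel" by simp
          show "(\<lambda>y. ?D s y) \<in> borel_measurable borel"
            by measurable
        qed
        also have "\<dots> = (\<integral>\<^sup>+z. ennreal (s ^ 3) * (?D s (s *\<^sub>R z)) \<partial>lborel)"
        proof (rule nn_integral_cmult[symmetric])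
          have "(\<lambda>y::real^3. indicator {norm (s *\<^sub>R y)..} s :: ennreal) = indicator {y. norm (s *\<^sub>R y) \<le> s}"
            by (auto simp: indicator_def fun_eq_iff)
          moreover have "{y::real^3. norm (s *\<^sub>R y) \<le> s} \<in> sets borel" by measurable
          ultimately have [measurable]: "(\<lambda>y::real^3. indicator {norm (s *\<^sub>R y)..} s :: ennreal) \<in> borel_measurable lborel" by simp
          show "(\<lambda>z. ?D s (s *\<^sub>R z)) \<in> borel_measurable lborel"
            by measurable
        qed
        also have "\<dots> = (\<integral>\<^sup>+z. ?E s z \<partial>lborel)"
        proof (rule nn_integral_cong)
          fix z :: "real^3"
          have 1: "indicator {norm (s *\<^sub>R z)..} s = (indicator {0..} s * indicator (cball 0 1) z :: ennreal)"
            using s by (auto simp: indicator_def)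
          have 2: "ennreal (s ^ 3) * ennreal (inverse (s ^ 4)) * ennreal (norm (s *\<^sub>R z) ^ 3) = ennreal (s\<^sup>2) * ennreal (norm z ^ 3)"
          proof -
            have "s ^ 3 * inverse (s ^ 4) * norm (s *\<^sub>R z) ^ 3 = s\<^sup>2 * norm z ^ 3"
              using s by (simp add: power_mult_distrib field_simps power_numeral_reduce)
            then show ?thesis using s by (simp flip: ennreal_mult)
          qed
          have "ennreal (s ^ 3) * (?D s (s *\<^sub>R z))
            = (ennreal (s ^ 3) * ennreal (inverse (s ^ 4)) * ennreal (norm (s *\<^sub>R z) ^ 3)) * (indicator {norm (s *\<^sub>R z)..} s * (indicator (cball 0 t) (s *\<^sub>R z) * g (s *\<^sub>R z)))"
            by (simp only: ac_simps)
          then show "ennreal (s ^ 3) * (?D s (s *\<^sub>R z))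
            = ?E s z"
            unfolding 2 1 by (simp only: ac_simps)
        qed
        finally show ?thesis by simp
      qed
    qed
  qed
  also have "\<dots> = (\<integral>\<^sup>+y. (\<integral>\<^sup>+s. ?D s y \<partial>lborel) \<partial>lborel)"
  proof (rule lborel_pair.Fubini'[symmetric])
    have "(\<lambda>(s::real, y::real^3). indicator {norm y..} s :: ennreal) = indicator {z. norm (snd z) \<le> fst z}"
      by (auto simp: indicator_def fun_eq_iff)
    moreover have "{z::real \<times> (real^3). norm (snd z) \<le> fst z} \<in> sets (lborel \<Otimes>\<^sub>M lborel)"
    proof -
      have "{z \<in> space (lborel \<Otimes>\<^sub>M lborel). norm (snd z :: real^3) \<le> fst z} \<in> sets (lborel \<Otimes>\<^sub>M lborel)"
        by measurable
      then show ?thesis by (simp add: space_pair_measure)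
    qed
    ultimately have m: "(\<lambda>(s::real, y::real^3). indicator {norm y..} s :: ennreal) \<in> borel_measurable (lborel \<Otimes>\<^sub>M lborel)" by simp
    have "(\<lambda>z. (ennreal (inverse (fst z ^ 4)) * (\<lambda>(s::real, y::real^3). indicator {norm y..} s :: ennreal) z) * (ennreal (norm (snd z) ^ 3) * (indicator (cball 0 t) (snd z) * g (snd z))))
        \<in> borel_measurable (lborel \<Otimes>\<^sub>M lborel)"
      using m by measurable
    then show "(\<lambda>(s, y). ?D s y) \<in> borel_measurable (lborel \<Otimes>\<^sub>M lborel)"
      by (simp add: split_beta)
  qed
  also have "\<dots> = (\<integral>\<^sup>+y. ennreal (1 / 3) * (indicator (cball 0 t) y * g y) \<partial>lborel)"
  proof (rule nn_integral_cong_AE)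
    show "AE y in lborel. (\<integral>\<^sup>+s. ?D s y \<partial>lborel)
      = ennreal (1 / 3) * (indicator (cball 0 t) y * g y)"
      using AE0
    proof eventually_elim
      case (elim y)
      have "(\<integral>\<^sup>+s. ?D s y \<partial>lborel)
         = ennreal (1 / (3 * norm y ^ 3)) * (ennreal (norm y ^ 3) * (indicator (cball 0 t) y * g y))"
        using elim by (subst nn_integral_multc) (auto simp: nn_integral_inverse_power_4)
      also have "\<dots> = (ennreal (1 / (3 * norm y ^ 3)) * ennreal (norm y ^ 3)) * (indicator (cball 0 t) y * g y)"
        by (simp only: ac_simps)
      also have "ennreal (1 / (3 * norm y ^ 3)) * ennreal (norm y ^ 3) = ennreal (1 / 3)"
        using elim by (simp flip: ennreal_mult)
      finally show ?case .
    qed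
  qed
  also have "\<dots> = ennreal (1 / 3) * (\<integral>\<^sup>+y. indicator (cball 0 t) y * g y \<partial>lborel)"
    by (rule nn_integral_cmult) measurable
  finally show ?thesis .
qed

section \<open>The pointwise bound and the global solution\<close>

lemma smean_mono:
  assumes "continuous_on UNIV f" "continuous_on UNIV g" "\<And>v. f v \<le> g v"
  shows "smean f \<le> smean g"
  unfolding smean_def by (intro integral_mono smean_integrable assms)

lemma smean_abs: "\<bar>smean f\<bar> \<le> smean (\<lambda>v. \<bar>f v\<bar>)"
  unfolding smean_def by (rule integral_abs_bound)

lemma nn_integral_smean:
  assumes h: "continuous_on UNIV h" "\<And>v. 0 \<le> h v"
  shows "ennreal (smean h) = ennreal (1 / ball_vol) * (\<integral>\<^sup>+z. indicator (cball 0 1) z * ennreal (h (sgn z)) \<partial>lborel)"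
proof -
  have [measurable]: "h \<in> borel_measurable borel" by (rule borel_measurable_continuous_onI[OF h(1)])
  have "ennreal (smean h) = (\<integral>\<^sup>+z. ennreal (h (sgn z)) \<partial>unit_ball)"
    unfolding smean_def by (rule nn_integral_eq_integral[symmetric]) (use smean_integrable[OF h(1)] h(2) in auto)
  also have "\<dots> = (\<integral>\<^sup>+z. ennreal (h (sgn z)) * indicator (cball 0 1) z \<partial>lborel) / emeasure lborel (cball (0::real^3) 1)"
    unfolding unit_ball_def by (rule nn_integral_uniform_measure) auto
  also have "\<dots> = ennreal (1 / ball_vol) * (\<integral>\<^sup>+z. indicator (cball 0 1) z * ennreal (h (sgn z)) \<partial>lborel)"
    using ball_vol(1) unfolding ball_vol(2) by (simp add: divide_ennreal_def inverse_ennreal inverse_eq_divide mult.commute)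
  finally show ?thesis .
qed

text \<open>
  Polar coordinates on the mantle of the cone: the left side integrates over spheres of radius
  \<open>t - \<tau>\<close> at time \<open>\<tau>\<close>, the right side over the projection of the mantle to the base.
\<close>

lemma retarded_polar_coordinates:
  assumes g: "continuous_on Slab g" "\<And>z. z \<in> Slab \<Longrightarrow> 0 \<le> g z" and t: "0 \<le> t"
  shows "integral {0..t} (\<lambda>\<tau>. (t - \<tau>)\<^sup>2 * smean (\<lambda>v. g (x + (t - \<tau>) *\<^sub>R v, \<tau>)))
     \<le> 1 / (3 * ball_vol) * (\<integral>y. indicator (cball 0 t) y *\<^sub>R g (x + y, t - norm y) \<partial>lborel)"
proof -
  let ?J = "\<integral>y. indicator (cball 0 t) y *\<^sub>R g (x + y, t - norm y) \<partial>lborel"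
  define N where "N \<tau> = smean (\<lambda>v. g (x + (t - \<tau>) *\<^sub>R v, \<tau>))" for \<tau>
  \<comment> \<open>The maximum keeps the argument in the domain of g outside the ball, where the value is
    multiplied by 0.\<close>
  define G where "G y = ennreal (g (x + y, max 0 (t - norm y)))" for y
  have Gc: "continuous_on UNIV (\<lambda>y. g (x + y, max 0 (t - norm y)))"
    by (rule continuous_on_compose2[OF g(1)]) (auto intro!: continuous_intros)
  have Gm [measurable]: "G \<in> borel_measurable borel"
    unfolding G_def using borel_measurable_continuous_onI[OF Gc] by measurable
  have hc: "continuous_on UNIV (\<lambda>v. g (x + r *\<^sub>R v, s))" if "0 \<le> s" for r s
    by (rule continuous_on_compose2[OF g(1)]) (use that in \<open>auto intro!: continuous_intros\<close>)
  have Nc: "continuous_on {0..t} N" unfolding N_def by (rule smean_retarded_continuous[OF g(1) t])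
  have N0: "0 \<le> N \<tau>" if "\<tau> \<in> {0..t}" for \<tau>
    unfolding N_def smean_def using that g(2) by (intro integral_nonneg_AE) auto
  define q where "q \<tau> = (t - \<tau>)\<^sup>2 * N \<tau>" for \<tau>
  have qc: "continuous_on {0..t} q" unfolding q_def by (intro continuous_intros Nc)
  have qi: "set_integrable lborel {0..t} q" by (rule borel_integrable_atLeastAtMost'[OF qc])
  have "ennreal (integral {0..t} q) = ennreal (\<integral>\<tau>. indicator {0..t} \<tau> *\<^sub>R q \<tau> \<partial>lborel)"
    using set_borel_integral_eq_integral(2)[OF qi] by (simp add: set_lebesgue_integral_def)
  also have "\<dots> = (\<integral>\<^sup>+\<tau>. ennreal (indicator {0..t} \<tau> *\<^sub>R q \<tau>) \<partial>lborel)"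
    by (rule nn_integral_eq_integral[symmetric])
      (use qi N0 in \<open>auto simp: set_integrable_def q_def indicator_def\<close>)
  also have "\<dots> = (\<integral>\<^sup>+r. ennreal (indicator {0..t} (t - r) *\<^sub>R q (t - r)) \<partial>lborel)"
  proof -
    have "(\<lambda>\<tau>. indicator {0..t} \<tau> *\<^sub>R q \<tau>) \<in> borel_measurable borel"
      using qi unfolding set_integrable_def by (simp add: borel_measurable_integrable)
    then have "(\<lambda>\<tau>. ennreal (indicator {0..t} \<tau> *\<^sub>R q \<tau>)) \<in> borel_measurable borel" by measurable
    from nn_integral_real_affine[OF this, of "-1" t] show ?thesis by simp
  qed
  also have "\<dots> = (\<integral>\<^sup>+r. ennreal (1 / ball_vol) * (\<integral>\<^sup>+z. ennreal (r\<^sup>2) * indicator {0..t} r * (indicator (cball 0 1) z * G (r *\<^sub>R sgn z)) \<partial>lborel) \<partial>lborel)"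
  proof (rule nn_integral_cong)
    fix r :: real
    show "ennreal (indicator {0..t} (t - r) *\<^sub>R q (t - r)) = ennreal (1 / ball_vol) * (\<integral>\<^sup>+z. ennreal (r\<^sup>2) * indicator {0..t} r * (indicator (cball 0 1) z * G (r *\<^sub>R sgn z)) \<partial>lborel)"
    proof (cases "r \<in> {0..t}")
      case True
      define h where "h v = g (x + r *\<^sub>R v, t - r)" for v
      have h: "continuous_on UNIV h" unfolding h_def by (rule hc) (use True in auto)
      have h0: "0 \<le> h v" for v unfolding h_def using g(2) True by auto
      have [measurable]: "h \<in> borel_measurable borel" by (rule borel_measurable_continuous_onI[OF h])
      have "ennreal (indicator {0..t} (t - r) *\<^sub>R q (t - r)) = ennreal (r\<^sup>2) * ennreal (smean h)"
      proof -
        have "indicator {0..t} (t - r) *\<^sub>R q (t - r) = r\<^sup>2 * smean h"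
          using True by (simp add: q_def N_def h_def[abs_def])
        then show ?thesis by (simp add: ennreal_mult')
      qed
      also have "\<dots> = ennreal (1 / ball_vol) * (ennreal (r\<^sup>2) * (\<integral>\<^sup>+z. indicator (cball 0 1) z * ennreal (h (sgn z)) \<partial>lborel))"
        unfolding nn_integral_smean[OF h h0] by (simp only: ac_simps)
      also have "ennreal (r\<^sup>2) * (\<integral>\<^sup>+z. indicator (cball 0 1) z * ennreal (h (sgn z)) \<partial>lborel)
          = (\<integral>\<^sup>+z. ennreal (r\<^sup>2) * (indicator (cball 0 1) z * ennreal (h (sgn z))) \<partial>lborel)"
        by (rule nn_integral_cmult[symmetric]) measurable
      also have "\<dots> = (\<integral>\<^sup>+z. ennreal (r\<^sup>2) * indicator {0..t} r * (indicator (cball 0 1) z * G (r *\<^sub>R sgn z)) \<partial>lborel)"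
      proof (rule nn_integral_cong_AE)
        have "AE z in lborel. z \<noteq> (0::real^3)" by (rule AE_lborel_singleton)
        then show "AE z in lborel. ennreal (r\<^sup>2) * (indicator (cball 0 1) z * ennreal (h (sgn z)))
            = ennreal (r\<^sup>2) * indicator {0..t} r * (indicator (cball 0 1) z * G (r *\<^sub>R sgn z))"
        proof eventually_elim
          case (elim z)
          then have "norm (sgn z) = 1" by (simp add: norm_sgn)
          then show ?case using True by (simp add: G_def h_def)
        qed
      qed
      finally show ?thesis .
    qed auto
  qed
  also have "\<dots> = ennreal (1 / ball_vol) * (\<integral>\<^sup>+r. (\<integral>\<^sup>+z. ennreal (r\<^sup>2) * indicator {0..t} r * (indicator (cball 0 1) z * G (r *\<^sub>R sgn z)) \<partial>lborel) \<partial>lborel)"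
    by (rule nn_integral_cmult) measurable
  also have "\<dots> = ennreal (1 / ball_vol) * (ennreal (1 / 3) * (\<integral>\<^sup>+y. indicator (cball 0 t) y * G y \<partial>lborel))"
    unfolding polar_coordinates[OF Gm] ..
  also have "(\<integral>\<^sup>+y. indicator (cball 0 t) y * G y \<partial>lborel) = (\<integral>\<^sup>+y. ennreal (indicator (cball 0 t) y *\<^sub>R g (x + y, t - norm y)) \<partial>lborel)"
    by (rule nn_integral_cong) (auto simp: G_def indicator_def)
  also have "\<dots> = ennreal ?J"
  proof (rule nn_integral_eq_integral)
    show "integrable lborel (\<lambda>y. indicator (cball 0 t) y *\<^sub>R g (x + y, t - norm y))"
      by (rule borel_integrable_compact) (auto intro!: continuous_on_compose2[OF g(1)] continuous_intros)
    show "AE y in lborel. 0 \<le> indicator (cball 0 t) y *\<^sub>R g (x + y, t - norm y)"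
      using g(2) by (auto simp: indicator_def)
  qed
  also have "ennreal (1 / ball_vol) * (ennreal (1 / 3) * ennreal ?J)
     = ennreal (1 / (3 * ball_vol) * ?J)"
    using ball_vol(1) by (simp add: mult.assoc[symmetric] mult.commute[of ball_vol] flip: ennreal_mult')
  finally have eq: "ennreal (integral {0..t} q) = ennreal (1 / (3 * ball_vol) * ?J)" .
  have "0 \<le> ?J"
    using g(2) by (intro integral_nonneg_AE) (auto simp: indicator_def)
  then have b0: "0 \<le> 1 / (3 * ball_vol) * ?J"
    using ball_vol(1) by simp
  show ?thesis
    using eq_refl[OF eq] unfolding ennreal_le_iff[OF b0] q_def N_def .
qed

text \<open>
  For small \<open>r\<close> the left side is small since \<open>a\<close> is bounded. For larger \<open>r\<close> either \<open>a r \<ge> \<mu>\<close>,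
  and one factor \<open>1 / a \<le> r / \<mu>\<close> may be spent, or \<open>a < \<mu> / r\<close>, and the left side is at most
  \<open>\<mu>^5 / r^4\<close>. The point is that the second term is integrable in \<open>r\<close> with a small integral,
  uniformly in the time interval.
\<close>

lemma young_split:
  fixes \<delta> :: real assumes \<delta>: "0 < \<delta>"
  obtains \<mu> where "0 < \<mu>" "\<And>r a. 0 \<le> r \<Longrightarrow> 0 \<le> a \<Longrightarrow> a \<le> 3 \<Longrightarrow> r * a ^ 5 \<le> r\<^sup>2 * a ^ 6 / \<mu> + \<delta> / (1 + r\<^sup>2)"
proof -
  define \<rho> where "\<rho> = min 1 (\<delta> / 486)"
  have \<rho>: "0 < \<rho>" "\<rho> \<le> 1" "486 * \<rho> \<le> \<delta>" using \<delta> by (auto simp: \<rho>_def)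
  define M where "M = 1 / \<rho> ^ 4 + 1 / \<rho>\<^sup>2"
  have M: "0 < M" using \<rho> by (simp add: M_def add_pos_pos)
  define \<mu> where "\<mu> = min 1 (\<delta> / M)"
  have \<mu>: "0 < \<mu>" "\<mu> \<le> 1" "\<mu> * M \<le> \<delta>" using \<delta> M by (auto simp: \<mu>_def min_def field_simps)
  have "r * a ^ 5 \<le> r\<^sup>2 * a ^ 6 / \<mu> + \<delta> / (1 + r\<^sup>2)" if r: "0 \<le> r" and a: "0 \<le> a" "a \<le> 3" for r a
  proof (cases "r \<le> \<rho>")
    case True
    have "r * a ^ 5 \<le> \<rho> * 3 ^ 5" using True r a by (intro mult_mono power_mono) auto
    also have "\<dots> \<le> \<delta> / 2" using \<rho> by simp
    also have "\<dots> \<le> \<delta> / (1 + r\<^sup>2)"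
    proof (rule divide_left_mono)
      have "r\<^sup>2 \<le> 1\<^sup>2" using True \<rho> r by (intro power_mono) auto
      then show "1 + r\<^sup>2 \<le> 2" by simp
    qed (use \<delta> in \<open>auto simp: add_pos_nonneg\<close>)
    finally have "r * a ^ 5 \<le> \<delta> / (1 + r\<^sup>2)" .
    moreover have "0 \<le> r\<^sup>2 * a ^ 6 / \<mu>" using \<mu> a by simp
    ultimately show ?thesis by linarith
  next
    case False
    then have r0: "0 < r" "\<rho> \<le> r" using \<rho> by auto
    show ?thesis
    proof (cases "\<mu> \<le> a * r")
      case True
      have "r * a ^ 5 * \<mu> \<le> r * a ^ 5 * (a * r)" using True r a by (intro mult_left_mono) auto
      also have "\<dots> = r\<^sup>2 * a ^ 6" by (simp add: power_numeral_reduce)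
      finally have "r * a ^ 5 \<le> r\<^sup>2 * a ^ 6 / \<mu>" using \<mu> by (simp add: pos_le_divide_eq)
      moreover have "0 \<le> \<delta> / (1 + r\<^sup>2)" using \<delta> by (simp add: add_nonneg_nonneg)
      ultimately show ?thesis by linarith
    next
      case False
      then have "a * r \<le> \<mu>" by simp
      then have "(a * r) ^ 5 \<le> \<mu> ^ 5" using a r by (intro power_mono) auto
      also have "\<dots> \<le> \<mu> ^ 1" using \<mu> by (intro power_decreasing) auto
      finally have ar: "(a * r) ^ 5 \<le> \<mu>" by simp
      have "r * a ^ 5 = (a * r) ^ 5 / r ^ 4" using r0 by (simp add: power_mult_distrib field_simps power_numeral_reduce)
      also have "\<dots> \<le> \<mu> / r ^ 4" using ar r0 by (intro divide_right_mono) auto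
      also have "\<dots> \<le> \<delta> / (1 + r\<^sup>2)"
      proof -
        have "\<mu> * ((1 + r\<^sup>2) / r ^ 4) = \<mu> * (1 / r ^ 4 + 1 / r\<^sup>2)"
          using r0 by (simp add: field_simps power_numeral_reduce)
        also have "\<dots> \<le> \<mu> * M" unfolding M_def using r0 \<rho> \<mu>
          by (intro mult_left_mono add_mono divide_left_mono power_mono) auto
        also have "\<dots> \<le> \<delta>" by (rule \<mu>(3))
        finally have "\<mu> * (1 + r\<^sup>2) / r ^ 4 \<le> \<delta>" by simp
        moreover have "0 < 1 + r\<^sup>2" by (simp add: add_pos_nonneg)
        ultimately show ?thesis by (simp add: pos_le_divide_eq)
      qed
      finally have "r * a ^ 5 \<le> \<delta> / (1 + r\<^sup>2)" .
      moreover have "0 \<le> r\<^sup>2 * a ^ 6 / \<mu>" using \<mu> a by simp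
      ultimately show ?thesis by linarith
    qed
  qed
  with \<mu>(1) show thesis by (rule that)
qed

lemma integral_arctan_bound:
  fixes t :: real
  assumes "0 \<le> t"
  shows "(\<lambda>\<tau>. 1 / (1 + (t - \<tau>)\<^sup>2)) integrable_on {0..t}" "integral {0..t} (\<lambda>\<tau>. 1 / (1 + (t - \<tau>)\<^sup>2)) \<le> 2"
proof -
  have "((\<lambda>\<tau>. 1 / (1 + (t - \<tau>)\<^sup>2)) has_integral (- arctan (t - t) - (- arctan (t - 0)))) {0..t}"
  proof (rule fundamental_theorem_of_calculus[OF assms])
    fix s assume "s \<in> {0..t}"
    have "((\<lambda>\<tau>. - arctan (t - \<tau>)) has_real_derivative 1 / (1 + (t - s)\<^sup>2)) (at s within {0..t})"
      by (auto intro!: derivative_eq_intros simp: inverse_eq_divide)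
    then show "((\<lambda>\<tau>. - arctan (t - \<tau>)) has_vector_derivative 1 / (1 + (t - s)\<^sup>2)) (at s within {0..t})"
      by (simp add: has_real_derivative_iff_has_vector_derivative)
  qed
  then have i: "((\<lambda>\<tau>. 1 / (1 + (t - \<tau>)\<^sup>2)) has_integral arctan t) {0..t}" by simp
  then show "(\<lambda>\<tau>. 1 / (1 + (t - \<tau>)\<^sup>2)) integrable_on {0..t}" by blast
  show "integral {0..t} (\<lambda>\<tau>. 1 / (1 + (t - \<tau>)\<^sup>2)) \<le> 2"
    using integral_unique[OF i] arctan_ubound[of t] pi_less_4 by linarith
qed

text \<open>
  Kirchhoff's kernel is \<open>r dr\<close> times spherical means, while the flux controls \<open>r^2 dr\<close> times
  means of \<open>\<theta>^6\<close>. The elementary inequality splits \<open>r \<theta>^5\<close> into a multiple of \<open>r^2 \<theta>^6\<close> and an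
  integrable remainder.
\<close>

lemma duhamel_bound:
  assumes F: "continuous_on Slab F" and \<theta>: "continuous_on Slab \<theta>" "\<And>z. z \<in> Slab \<Longrightarrow> 0 \<le> \<theta> z" "\<And>z. z \<in> Slab \<Longrightarrow> \<theta> z \<le> 3"
    and C: "0 < C" "\<And>z. z \<in> Slab \<Longrightarrow> \<bar>F z\<bar> \<le> C * \<theta> z ^ 5"
    and \<mu>: "0 < \<mu>" "\<And>r a. 0 \<le> r \<Longrightarrow> 0 \<le> a \<Longrightarrow> a \<le> 3 \<Longrightarrow> r * a ^ 5 \<le> r\<^sup>2 * a ^ 6 / \<mu> + \<delta> / (1 + r\<^sup>2)"
    and \<delta>: "0 < \<delta>" and t: "0 \<le> t"
  shows "\<bar>wave.duhamel F (x, t)\<bar> \<le> C / \<mu> * (1 / (3 * ball_vol) * (\<integral>y. indicator (cball 0 t) y *\<^sub>R \<theta> (x + y, t - norm y) ^ 6 \<partial>lborel)) + 2 * C * \<delta>"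
proof -
  have sl: "continuous_on UNIV (\<lambda>v. f (x + r *\<^sub>R v, s))" if "continuous_on Slab f" "0 \<le> s" for r s and f :: "(real^3) \<times> real \<Rightarrow> real"
    by (rule continuous_on_compose2[OF that(1)]) (use that(2) in \<open>auto intro!: continuous_intros\<close>)
  note sc = smean_retarded_continuous[OF _ t]
  have \<theta>6: "continuous_on Slab (\<lambda>z. \<theta> z ^ 6)" by (intro continuous_intros \<theta>)
  define A where "A \<tau> = (t - \<tau>)\<^sup>2 * smean (\<lambda>v. \<theta> (x + (t - \<tau>) *\<^sub>R v, \<tau>) ^ 6)" for \<tau>
  have Ai: "A integrable_on {0..t}" unfolding A_def
    by (intro integrable_continuous_real continuous_intros sc \<theta>6)
  have "\<bar>wave.duhamel F (x, t)\<bar> = norm (integral {0..t} (\<lambda>\<tau>. (t - \<tau>) * smean (\<lambda>v. F (x + (t - \<tau>) *\<^sub>R v, \<tau>))))"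
    by (simp add: duhamel_eq_integral[OF F t])
  also have "\<dots> \<le> integral {0..t} (\<lambda>\<tau>. C / \<mu> * A \<tau> + C * \<delta> * (1 / (1 + (t - \<tau>)\<^sup>2)))"
  proof (rule integral_norm_bound_integral)
    show "(\<lambda>\<tau>. (t - \<tau>) * smean (\<lambda>v. F (x + (t - \<tau>) *\<^sub>R v, \<tau>))) integrable_on {0..t}"
      by (intro integrable_continuous_real continuous_intros sc F)
    show "(\<lambda>\<tau>. C / \<mu> * A \<tau> + C * \<delta> * (1 / (1 + (t - \<tau>)\<^sup>2))) integrable_on {0..t}"
      using Ai integral_arctan_bound(1)[OF t] by (intro integrable_add integrable_on_mult_right)
    fix \<tau> assume \<tau>: "\<tau> \<in> {0..t}"
    define r where "r = t - \<tau>"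
    have r: "0 \<le> r" using \<tau> by (simp add: r_def)
    define Fv where "Fv v = F (x + r *\<^sub>R v, \<tau>)" for v
    define \<theta>v where "\<theta>v v = \<theta> (x + r *\<^sub>R v, \<tau>)" for v
    have c: "continuous_on UNIV Fv" "continuous_on UNIV \<theta>v" unfolding Fv_def \<theta>v_def using \<tau> by (auto intro!: sl F \<theta>)
    have "\<bar>r * smean Fv\<bar> \<le> r * smean (\<lambda>v. \<bar>Fv v\<bar>)" unfolding abs_mult using r smean_abs[of Fv] by (simp add: mult_left_mono)
    also have "\<dots> = smean (\<lambda>v. r * \<bar>Fv v\<bar>)" by (simp add: smean_cmult)
    also have "\<dots> \<le> smean (\<lambda>v. C / \<mu> * r\<^sup>2 * \<theta>v v ^ 6 + C * \<delta> * (1 / (1 + r\<^sup>2)))"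
    proof (rule smean_mono)
      fix v
      have z: "(x + r *\<^sub>R v, \<tau>) \<in> Slab" using \<tau> by auto
      have "r * \<bar>Fv v\<bar> \<le> r * (C * \<theta>v v ^ 5)" unfolding Fv_def \<theta>v_def using C(2)[OF z] r by (rule mult_left_mono)
      also have "\<dots> = C * (r * \<theta>v v ^ 5)" by simp
      also have "\<dots> \<le> C * (r\<^sup>2 * \<theta>v v ^ 6 / \<mu> + \<delta> / (1 + r\<^sup>2))"
        unfolding \<theta>v_def using C(1) by (intro mult_left_mono \<mu>(2) r \<theta>(2)[OF z] \<theta>(3)[OF z]) auto
      finally show "r * \<bar>Fv v\<bar> \<le> C / \<mu> * r\<^sup>2 * \<theta>v v ^ 6 + C * \<delta> * (1 / (1 + r\<^sup>2))" by (simp add: algebra_simps)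
    qed (intro continuous_intros c)+
    also have "\<dots> = C / \<mu> * A \<tau> + C * \<delta> * (1 / (1 + r\<^sup>2))"
    proof -
      have "smean (\<lambda>v. C / \<mu> * r\<^sup>2 * \<theta>v v ^ 6 + C * \<delta> * (1 / (1 + r\<^sup>2))) = smean (\<lambda>v. C / \<mu> * r\<^sup>2 * \<theta>v v ^ 6) + smean (\<lambda>v. C * \<delta> * (1 / (1 + r\<^sup>2)))"
        by (rule smean_add) (intro continuous_intros c)+
      moreover have "smean (\<lambda>v. C / \<mu> * r\<^sup>2 * \<theta>v v ^ 6) = C / \<mu> * r\<^sup>2 * smean (\<lambda>v. \<theta>v v ^ 6)"
        by (rule smean_cmult)
      ultimately show ?thesis by (simp add: smean_const A_def r_def[symmetric] \<theta>v_def)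
    qed
    finally show "norm ((t - \<tau>) * smean (\<lambda>v. F (x + (t - \<tau>) *\<^sub>R v, \<tau>))) \<le> C / \<mu> * A \<tau> + C * \<delta> * (1 / (1 + (t - \<tau>)\<^sup>2))"
      unfolding Fv_def r_def by simp
  qed
  also have "\<dots> = C / \<mu> * integral {0..t} A + C * \<delta> * integral {0..t} (\<lambda>\<tau>. 1 / (1 + (t - \<tau>)\<^sup>2))"
    using Ai integral_arctan_bound(1)[OF t]
    by (subst integral_add) (auto intro!: integrable_on_mult_right simp del: times_divide_eq_right times_divide_eq_left)
  also have "\<dots> \<le> C / \<mu> * (1 / (3 * ball_vol) * (\<integral>y. indicator (cball 0 t) y *\<^sub>R \<theta> (x + y, t - norm y) ^ 6 \<partial>lborel)) + C * \<delta> * 2"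
    unfolding A_def
    using C(1) \<mu>(1) \<delta> \<theta>(2) integral_arctan_bound(2)[OF t]
    by (intro add_mono mult_left_mono retarded_polar_coordinates[OF \<theta>6 _ t]) auto
  finally show ?thesis by simp
qed

lemma C2_compose:
  assumes u: "C2 Slab u" and k: "\<And>x. (k has_real_derivative k' x) (at x)" and k': "\<And>x. (k' has_real_derivative k'' x) (at x)"
    and k'': "continuous_on UNIV k''"
  shows "C2 Slab (\<lambda>z. k (u z))"
proof -
  obtain G where G: "has_grad u G Slab" "\<And>v. C1 Slab (\<lambda>z. G z \<bullet> v)" using u unfolding C2_def by blast
  have k'c: "continuous_on UNIV k'" by (rule continuous_on_UNIV_DERIV[OF k'])
  have "C1 Slab u" using G(1) unfolding C1_def by blast
  then have "C1 Slab (\<lambda>z. (k' (u z) *\<^sub>R G z) \<bullet> v)" for v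
    using C1_mult[OF C1_compose[OF _ k' k''] G(2)] by simp
  with has_grad_compose[OF G(1) k k'c] show ?thesis unfolding C2_def by blast
qed

lemma C2_cmult:
  assumes "C2 Slab u" shows "C2 Slab (\<lambda>z. c * u z)"
  by (rule C2_compose[OF assms, where k="\<lambda>x. c * x" and k'="\<lambda>x. c" and k''="\<lambda>x. 0"])
    (auto intro!: derivative_eq_intros)

theorem theorem5p1:
  fixes p :: real
    and u\<^sub>0 u\<^sub>1 :: "real^3 \<Rightarrow> real"
    and w :: "real^3 \<Rightarrow> real \<Rightarrow> real"
  assumes p: "p > 6"
    and u0_C3: "C_k_on 3 UNIV u\<^sub>0"
    and u1_C2: "C_k_on 2 UNIV u\<^sub>1"
    and finite_energy:
      "(\<integral>\<^sup>+ x. ennreal (((u\<^sub>1 x)\<^sup>2 + (norm (gradient u\<^sub>0 x))\<^sup>2) / 2 + \<bar>u\<^sub>0 x\<bar> ^ 6 / 6) \<partial>lborel) < \<infinity>"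
    and w_C2: "C_k_on 2 (UNIV \<times> {0..}) (\<lambda>(x, t). w x t)"
    and w_wave: "\<And>x t. t \<ge> 0 \<Longrightarrow>
      time_deriv (time_deriv w) x t - laplacian (\<lambda>y. w y t) x = 0"
    and w_init: "\<And>x. w x 0 = u\<^sub>0 x" "\<And>x. time_deriv w x 0 = u\<^sub>1 x"
    and w_bounded: "bounded ((\<lambda>(x, t). w x t) ` (UNIV \<times> {0..}))"
  shows "\<exists>\<epsilon>\<^sub>0>0. \<forall>\<epsilon>. \<bar>\<epsilon>\<bar> < \<epsilon>\<^sub>0 \<longrightarrow>
    (\<exists>u :: real^3 \<Rightarrow> real \<Rightarrow> real.
      C_k_on 2 (UNIV \<times> {0..}) (\<lambda>(x, t). u x t) \<and>
      (\<forall>x. \<forall>t\<ge>0. time_deriv (time_deriv u) x t - laplacian (\<lambda>y. u y t) x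
         + u x t ^ 5 + u x t * \<bar>u x t\<bar> powr (p - 2) = 0) \<and>
      (\<forall>x. u x 0 = \<epsilon> * u\<^sub>0 x) \<and>
      (\<forall>x. time_deriv u x 0 = \<epsilon> * u\<^sub>1 x))"
proof -
  obtain k k' k'' P :: "real \<Rightarrow> real" and L C :: real where
    k: "\<And>v. (k has_real_derivative k' v) (at v)" and k': "\<And>v. (k' has_real_derivative k'' v) (at v)"
    and k'': "continuous_on UNIV k''" and L: "\<And>v. \<bar>k' v\<bar> \<le> L" "\<And>v. \<bar>k'' v\<bar> \<le> L"
    and k_eq: "\<And>v. \<bar>v\<bar> \<le> 1 \<Longrightarrow> k v = v ^ 5 + v * \<bar>v\<bar> powr (p - 2)"
    and C: "0 < C" "\<And>v. \<bar>k v\<bar> \<le> C * \<bar>cutoff v\<bar> ^ 5"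
    and P: "\<And>v. (P has_real_derivative k v) (at v)" "\<And>v. \<bar>cutoff v\<bar> ^ 6 \<le> 6 * P v" "\<And>v. 6 * P v \<le> C * v ^ 6"
    by (rule truncated_nonlinearity[OF p], rule that)
  have kc: "continuous_on UNIV k" by (rule continuous_on_UNIV_DERIV[OF k])
  have cc: "continuous_on UNIV cutoff" by (rule continuous_on_UNIV_DERIV[OF cutoff_derivatives(1)])
  have w2: "C2 Slab (\<lambda>(x, t). w x t)" using w_C2 C2_iff_C_k_on by blast
  obtain Gw where Gw: "has_grad (\<lambda>(x, t). w x t) Gw Slab" using w2 unfolding C2_def by blast
  obtain W where W: "0 < W" "\<And>x t. 0 \<le> t \<Longrightarrow> \<bar>w x t\<bar> \<le> W"
    using w_bounded unfolding bounded_pos by auto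
  define E where "E x = ((u\<^sub>1 x)\<^sup>2 + (norm (gradient u\<^sub>0 x))\<^sup>2) / 2 + \<bar>u\<^sub>0 x\<bar> ^ 6 / 6" for x
  have E0: "0 \<le> E x" for x by (simp add: E_def)
  have Gt: "Gw (x, 0) \<bullet> (0, 1) = u\<^sub>1 x" for x
    using time_deriv_eqI[of w x "Gw (x, 0) \<bullet> (0, 1)" 0] has_grad_time_derivative[OF Gw, of 0 x] w_init(2)[of x] by simp
  have Gx: "(\<Sum>b\<in>Basis. (Gw (x, 0) \<bullet> (b, 0))\<^sup>2) = (norm (gradient u\<^sub>0 x))\<^sup>2" for x
  proof -
    have "partial_deriv b u\<^sub>0 x = Gw (x, 0) \<bullet> (b, 0)" for b
      using partial_deriv_Slab[OF Gw, of 0 b x] w_init(1) by simp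
    then have g: "gradient u\<^sub>0 x \<bullet> b = Gw (x, 0) \<bullet> (b, 0)" if "b \<in> Basis" for b
      using that by (simp add: gradient_def inner_sum_left inner_Basis if_distrib cong: if_cong)
    show ?thesis unfolding power2_norm_eq_inner by (subst euclidean_inner) (simp add: g power2_eq_square)
  qed
  define \<E> where "\<E> = enn2real (\<integral>\<^sup>+ x. ennreal (E x) \<partial>lborel)"
  have \<E>: "(\<integral>\<^sup>+ x. ennreal (E x) \<partial>lborel) = ennreal \<E>" "0 \<le> \<E>"
    using finite_energy unfolding \<E>_def E_def by (auto simp: less_top)
  \<comment> \<open>Makes the remainder 2 C \<delta> in the bound of the Duhamel integral equal to 1/4.\<close>
  define \<delta> where "\<delta> = 1 / (8 * C)"
  have \<delta>: "0 < \<delta>" using C by (simp add: \<delta>_def)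
  obtain \<mu> where \<mu>: "0 < \<mu>" "\<And>r a. 0 \<le> r \<Longrightarrow> 0 \<le> a \<Longrightarrow> a \<le> 3 \<Longrightarrow> r * a ^ 5 \<le> r\<^sup>2 * a ^ 6 / \<mu> + \<delta> / (1 + r\<^sup>2)"
    using young_split[OF \<delta>] by blast
  define B where "B = C / \<mu> * (1 / (3 * ball_vol) * (6 * ((1 + C) * \<E>)))"
  have B: "0 \<le> B" using C \<mu> ball_vol(1) \<E> by (simp add: B_def)
  \<comment> \<open>Makes the free solution and the flux term at most 1/4 each.\<close>
  define \<epsilon>\<^sub>0 where "\<epsilon>\<^sub>0 = min 1 (min (1 / (4 * W)) (1 / (4 * (B + 1))))"
  have \<epsilon>\<^sub>0: "0 < \<epsilon>\<^sub>0" using W B by (simp add: \<epsilon>\<^sub>0_def)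
  show ?thesis
  proof (intro exI[of _ \<epsilon>\<^sub>0] conjI allI impI)
    show "0 < \<epsilon>\<^sub>0" by (rule \<epsilon>\<^sub>0)
    fix \<epsilon> :: real assume small: "\<bar>\<epsilon>\<bar> < \<epsilon>\<^sub>0"
    have s1: "\<bar>\<epsilon>\<bar> \<le> 1" and s2: "\<bar>\<epsilon>\<bar> * W \<le> 1 / 4" and s3: "B * \<epsilon>\<^sup>2 \<le> 1 / 4"
    proof -
      show s1: "\<bar>\<epsilon>\<bar> \<le> 1" using small by (simp add: \<epsilon>\<^sub>0_def)
      have "\<bar>\<epsilon>\<bar> \<le> 1 / (4 * W)" using small by (simp add: \<epsilon>\<^sub>0_def)
      then show "\<bar>\<epsilon>\<bar> * W \<le> 1 / 4" using W by (simp add: field_simps)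
      have e: "\<bar>\<epsilon>\<bar> \<le> 1 / (4 * (B + 1))" using small by (simp add: \<epsilon>\<^sub>0_def)
      have "\<epsilon>\<^sup>2 = \<bar>\<epsilon>\<bar> * \<bar>\<epsilon>\<bar>" by (simp add: power2_eq_square)
      also have "\<dots> \<le> \<bar>\<epsilon>\<bar> * 1" using s1 by (intro mult_left_mono) auto
      finally have "B * \<epsilon>\<^sup>2 \<le> (B + 1) * (1 / (4 * (B + 1)))" using e B by (intro mult_mono) auto
      also have "\<dots> = 1 / 4" using B by (simp add: field_simps)
      finally show "B * \<epsilon>\<^sup>2 \<le> 1 / 4" .
    qed
    obtain u where u: "C2 Slab u" and ueq: "\<And>z. z \<in> Slab \<Longrightarrow> u z = \<epsilon> * (\<lambda>(x, t). w x t) z - wave.duhamel (\<lambda>z. k (u z)) z"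
      using wave_C2_solution[OF C2_cmult[OF w2, of \<epsilon>] k k' k'' L] by blast
    define v where "v x t = u (x, t)" for x t
    have F: "C2 Slab (\<lambda>z. k (u z))" by (rule C2_compose[OF u k k' k''])
    have veq: "v x t = \<epsilon> * w x t - wave.duhamel (\<lambda>z. k (u z)) (x, t)" if "0 \<le> t" for x t
      using ueq[of "(x, t)"] that by (simp add: v_def)
    have sol1: "time_deriv (time_deriv v) x t - laplacian (\<lambda>y. v y t) x = - k (u (x, t))" if "0 \<le> t" for x t
      by (rule duhamel_solves_wave(1)[OF w2 _ F _ that]) (erule w_wave veq)+
    have sol2: "time_deriv v x 0 = \<epsilon> * time_deriv w x 0" for x
      by (rule duhamel_solves_wave(2)[OF w2 _ F]) (erule w_wave veq)+
    have v0: "v x 0 = \<epsilon> * u\<^sub>0 x" for x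
      using veq[of 0 x] by (simp add: w_init(1) wave.duhamel_def inner_prod_def)
    obtain G H where G: "has_grad u G Slab" and H: "\<And>d. has_grad (\<lambda>z. G z \<bullet> d) (H d) Slab"
      using u unfolding C2_def C1_def by metis
    have uc: "continuous_on Slab u" by (rule has_gradD(3)[OF G])
    have tv: "time_deriv v x t = G (x, t) \<bullet> (0, 1)" if "0 \<le> t" for x t
      by (rule time_deriv_eqI[OF _ that]) (use has_grad_time_derivative[OF G that] in \<open>simp add: v_def[abs_def]\<close>)
    have ttv: "time_deriv (time_deriv v) x t = H (0, 1) (x, t) \<bullet> (0, 1)" if t: "0 \<le> t" for x t
    proof (rule time_deriv_eqI[OF _ t])
      show "(time_deriv v x has_real_derivative H (0, 1) (x, t) \<bullet> (0, 1)) (at t within {0..})"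
        by (rule has_field_derivative_transform_within[OF has_grad_time_derivative[OF H t] zero_less_one])
          (use t in \<open>auto simp: tv\<close>)
    qed
    have pde: "H (0, 1) z \<bullet> (0, 1) - (\<Sum>b\<in>Basis. H (b, 0) z \<bullet> (b, 0)) = - k (u z)" if z: "z \<in> Slab" for z
    proof -
      obtain x t where [simp]: "z = (x, t)" by (cases z)
      have t: "0 \<le> t" using z by simp
      have "laplacian (\<lambda>y. v y t) x = (\<Sum>b\<in>Basis. H (b, 0) z \<bullet> (b, 0))"
        using laplacian_Slab[OF G H t, of x] by (simp add: v_def)
      then show ?thesis using sol1[OF t, of x] ttv[OF t, of x] by simp
    qed
    have G0t: "G (x, 0) \<bullet> (0, 1) = \<epsilon> * u\<^sub>1 x" for x
      using tv[of 0 x] sol2[of x] w_init(2)[of x] by simp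
    have G0x: "G (x, 0) \<bullet> (b, 0) = \<epsilon> * (Gw (x, 0) \<bullet> (b, 0))" for x b
    proof -
      have "has_grad (\<lambda>z. \<epsilon> * (\<lambda>(x, t). w x t) z) (\<lambda>z. \<epsilon> *\<^sub>R Gw z + (\<lambda>(x, t). w x t) z *\<^sub>R 0) Slab"
        by (intro has_grad_mult has_grad_const Gw)
      from partial_deriv_Slab[OF this, of 0 b x] partial_deriv_Slab[OF G, of 0 b x] v0
      show ?thesis by (simp add: v_def w_init(1))
    qed
    have Ebound: "((G (x, 0) \<bullet> (0, 1))\<^sup>2 + (\<Sum>b\<in>Basis. (G (x, 0) \<bullet> (b, 0))\<^sup>2)) / 2 + P (u (x, 0)) \<le> \<epsilon>\<^sup>2 * ((1 + C) * E x)" for x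
    proof -
      define a where "a = ((u\<^sub>1 x)\<^sup>2 + (norm (gradient u\<^sub>0 x))\<^sup>2) / 2"
      define c where "c = u\<^sub>0 x ^ 6 / 6"
      have ac: "0 \<le> a" "0 \<le> c" "E x = a + c" by (auto simp: a_def c_def E_def)
      have "((G (x, 0) \<bullet> (0, 1))\<^sup>2 + (\<Sum>b\<in>Basis. (G (x, 0) \<bullet> (b, 0))\<^sup>2)) / 2 = \<epsilon>\<^sup>2 * a"
        unfolding a_def Gx[symmetric] G0t G0x by (simp add: power_mult_distrib algebra_simps sum_distrib_left)
      moreover have "P (u (x, 0)) \<le> \<epsilon>\<^sup>2 * (C * c)"
      proof -
        have "6 * P (u (x, 0)) \<le> C * (\<epsilon> * u\<^sub>0 x) ^ 6" using P(3)[of "u (x, 0)"] v0[of x] by (simp add: v_def)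
        also have "\<dots> = \<epsilon> ^ 6 * (C * (6 * c))" by (simp add: c_def power_mult_distrib)
        also have "\<epsilon> ^ 6 * (C * (6 * c)) \<le> \<epsilon>\<^sup>2 * (C * (6 * c))"
        proof (rule mult_right_mono)
          have "\<bar>\<epsilon>\<bar> ^ 6 \<le> \<bar>\<epsilon>\<bar> ^ 2" using s1 by (intro power_decreasing) auto
          then show "\<epsilon> ^ 6 \<le> \<epsilon>\<^sup>2" by simp
        qed (use C ac in auto)
        finally show ?thesis by simp
      qed
      moreover have "a + C * c \<le> (1 + C) * (a + c)" using C ac by (simp add: algebra_simps)
      then have "\<epsilon>\<^sup>2 * (a + C * c) \<le> \<epsilon>\<^sup>2 * ((1 + C) * (a + c))" by (rule mult_left_mono) simp
      ultimately show ?thesis unfolding ac(3) by (simp add: algebra_simps)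
    qed
    \<comment> \<open>Three terms of size at most 1/4 add up to less than 1, so the truncation is inactive along
      the whole solution.\<close>
    have bound: "\<bar>v x t\<bar> \<le> 1" if t: "0 \<le> t" for x t
    proof -
      let ?I = "\<integral>y. indicator (cball 0 t) y *\<^sub>R \<bar>cutoff (u (x + y, t - norm y))\<bar> ^ 6 \<partial>lborel"
      have I: "?I \<le> 6 * (\<epsilon>\<^sup>2 * ((1 + C) * \<E>))"
      proof (cases "t = 0")
        case True
        \<comment> \<open>For t = 0 the mantle is a single point.\<close>
        have "AE y in lborel. y \<noteq> (0::real^3)" by (rule AE_lborel_singleton)
        then have "AE y in lborel. indicator (cball 0 t) y *\<^sub>R \<bar>cutoff (u (x + y, t - norm y))\<bar> ^ 6 = (0::real)"
          by eventually_elim (simp add: True)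
        then have "?I = 0" by (rule integral_eq_zero_AE)
        then show ?thesis using C \<E>(2) by simp
      next
        case False
        then have t': "0 < t" using t by simp
        define e where "e z = ((G z \<bullet> (0, 1))\<^sup>2 + (\<Sum>b\<in>Basis. (G z \<bullet> (b, 0))\<^sup>2)) / 2 + P (u z)" for z
        have Pc: "continuous_on UNIV P" by (rule continuous_on_UNIV_DERIV[OF P(1)])
        have ec: "continuous_on Slab e" unfolding e_def
          by (intro continuous_intros has_gradD(2)[OF G] continuous_on_compose2[OF Pc uc]) auto
        have P0: "0 \<le> P a" for a using P(2)[of a] by (smt (verit) zero_le_power abs_ge_zero)
        have e0: "0 \<le> e z" for z unfolding e_def using P0 by (simp add: sum_nonneg add_nonneg_nonneg)
        have Ri: "integrable lborel (\<lambda>y. indicator (cball 0 t) y *\<^sub>R e (x + y, 0))"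
          by (rule borel_integrable_compact) (auto intro!: continuous_on_compose2[OF ec] continuous_intros)
        have "ennreal (\<integral>y. indicator (cball 0 t) y *\<^sub>R e (x + y, 0) \<partial>lborel) = (\<integral>\<^sup>+y. ennreal (indicator (cball 0 t) y *\<^sub>R e (x + y, 0)) \<partial>lborel)"
          by (rule nn_integral_eq_integral[symmetric, OF Ri]) (use e0 in auto)
        also have "\<dots> \<le> (\<integral>\<^sup>+y. ennreal (e (x + y, 0)) \<partial>lborel)"
          by (rule nn_integral_mono) (auto simp: indicator_def e0)
        also have "\<dots> = (\<integral>\<^sup>+y. ennreal (e (y, 0)) \<partial>lborel)"
        proof -
          have "continuous_on UNIV (\<lambda>y. e (y, 0))"
            by (rule continuous_on_compose2[OF ec]) (auto intro!: continuous_intros)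
          then have [measurable]: "(\<lambda>y. e (y, 0)) \<in> borel_measurable borel" by (rule borel_measurable_continuous_onI)
          have "(\<integral>\<^sup>+y. ennreal (e (y, 0)) \<partial>lborel) = (\<integral>\<^sup>+y. ennreal (e (y, 0)) \<partial>distr lborel borel ((+) x))"
            by (simp add: lborel_distr_plus)
          also have "\<dots> = (\<integral>\<^sup>+y. ennreal (e (x + y, 0)) \<partial>lborel)" by (subst nn_integral_distr) auto
          finally show ?thesis by simp
        qed
        also have "\<dots> \<le> (\<integral>\<^sup>+y. ennreal (\<epsilon>\<^sup>2 * (1 + C)) * ennreal (E y) \<partial>lborel)"
        proof (rule nn_integral_mono)
          fix y
          have "e (y, 0) \<le> (\<epsilon>\<^sup>2 * (1 + C)) * E y" using Ebound[of y] by (simp add: e_def mult.assoc)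
          then have "ennreal (e (y, 0)) \<le> ennreal ((\<epsilon>\<^sup>2 * (1 + C)) * E y)" by (rule ennreal_leI)
          also have "\<dots> = ennreal (\<epsilon>\<^sup>2 * (1 + C)) * ennreal (E y)" using C E0 by (intro ennreal_mult) auto
          finally show "ennreal (e (y, 0)) \<le> ennreal (\<epsilon>\<^sup>2 * (1 + C)) * ennreal (E y)" .
        qed
        also have "\<dots> = ennreal (\<epsilon>\<^sup>2 * (1 + C)) * ennreal \<E>"
        proof -
          have "continuous_on UNIV (\<lambda>y. Gw (y, 0))"
            by (rule continuous_on_compose2[OF has_gradD(2)[OF Gw]]) (auto intro!: continuous_intros)
          moreover have "continuous_on UNIV (\<lambda>y. (\<lambda>(x, t). w x t) (y, 0))"
            by (rule continuous_on_compose2[OF has_gradD(3)[OF Gw]]) (auto intro!: continuous_intros)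
          then have "continuous_on UNIV u\<^sub>0" using w_init(1) by simp
          ultimately have "continuous_on UNIV (\<lambda>y. ((Gw (y, 0) \<bullet> (0, 1))\<^sup>2 + (\<Sum>b\<in>Basis. (Gw (y, 0) \<bullet> (b, 0))\<^sup>2)) / 2 + \<bar>u\<^sub>0 y\<bar> ^ 6 / 6)"
            by (intro continuous_intros) auto
          then have "E \<in> borel_measurable borel"
            unfolding E_def[abs_def] Gx Gt by (rule borel_measurable_continuous_onI)
          then show ?thesis unfolding \<E>(1)[symmetric] by (intro nn_integral_cmult) measurable
        qed
        also have "\<dots> = ennreal (\<epsilon>\<^sup>2 * (1 + C) * \<E>)" using C \<E>(2) by (intro ennreal_mult[symmetric]) auto
        finally have Ebd: "(\<integral>y. indicator (cball 0 t) y *\<^sub>R e (x + y, 0) \<partial>lborel) \<le> \<epsilon>\<^sup>2 * (1 + C) * \<E>"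
          using C \<E>(2) by (subst (asm) ennreal_le_iff) auto
        have flux: "(\<integral>y. indicator (cball 0 t) y *\<^sub>R P (u (x + y, t - norm y)) \<partial>lborel) \<le> (\<integral>y. indicator (cball 0 t) y *\<^sub>R e (x + y, 0) \<partial>lborel)"
          unfolding e_def by (rule cone_energy_flux[OF G H P(1) kc pde t'])
        have "?I \<le> (\<integral>y. 6 * (indicator (cball 0 t) y *\<^sub>R P (u (x + y, t - norm y))) \<partial>lborel)"
        proof (rule integral_mono)
          show "integrable lborel (\<lambda>y. indicator (cball 0 t) y *\<^sub>R \<bar>cutoff (u (x + y, t - norm y))\<bar> ^ 6)"
            by (rule borel_integrable_compact)
              (auto intro!: continuous_intros continuous_on_compose2[OF cc] continuous_on_compose2[OF uc])
          show "integrable lborel (\<lambda>y. 6 * (indicator (cball 0 t) y *\<^sub>R P (u (x + y, t - norm y))))"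
            by (intro integrable_mult_right borel_integrable_compact)
              (auto intro!: continuous_intros continuous_on_compose2[OF Pc] continuous_on_compose2[OF uc])
          show "indicator (cball 0 t) y *\<^sub>R \<bar>cutoff (u (x + y, t - norm y))\<bar> ^ 6 \<le> 6 * (indicator (cball 0 t) y *\<^sub>R P (u (x + y, t - norm y)))" for y
            using P(2)[of "u (x + y, t - norm y)"] by (simp add: indicator_def)
        qed
        also have "\<dots> = 6 * (\<integral>y. indicator (cball 0 t) y *\<^sub>R P (u (x + y, t - norm y)) \<partial>lborel)" by (rule integral_mult_right_zero)
        also have "\<dots> \<le> 6 * (\<epsilon>\<^sup>2 * ((1 + C) * \<E>))" using flux Ebd by simp
        finally show ?thesis .
      qed
      have Fc: "continuous_on Slab (\<lambda>z. k (u z))" by (rule continuous_on_compose2[OF kc uc]) auto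
      have \<theta>c: "continuous_on Slab (\<lambda>z. \<bar>cutoff (u z)\<bar>)" by (intro continuous_intros continuous_on_compose2[OF cc uc]) auto
      have "\<bar>wave.duhamel (\<lambda>z. k (u z)) (x, t)\<bar> \<le> C / \<mu> * (1 / (3 * ball_vol) * ?I) + 2 * C * \<delta>"
        by (rule duhamel_bound[OF Fc \<theta>c _ _ C(1) _ \<mu> \<delta> t]) (use C(2) cutoff_abs(1) in auto)
      also have "\<dots> \<le> C / \<mu> * (1 / (3 * ball_vol) * (6 * (\<epsilon>\<^sup>2 * ((1 + C) * \<E>)))) + 2 * C * \<delta>"
        using I C(1) \<mu>(1) ball_vol(1) by (intro add_mono mult_left_mono order_refl) auto
      also have "\<dots> = B * \<epsilon>\<^sup>2 + 1 / 4" using C(1) by (simp add: B_def \<delta>_def)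
      finally have d: "\<bar>wave.duhamel (\<lambda>z. k (u z)) (x, t)\<bar> \<le> B * \<epsilon>\<^sup>2 + 1 / 4" .
      have "\<bar>\<epsilon> * w x t\<bar> \<le> \<bar>\<epsilon>\<bar> * W" unfolding abs_mult using W(2)[OF t] by (intro mult_left_mono) auto
      then show ?thesis using d s2 s3 veq[OF t, of x] by linarith
    qed
    show "\<exists>u. C_k_on 2 (UNIV \<times> {0..}) (\<lambda>(x, t). u x t) \<and>
      (\<forall>x. \<forall>t\<ge>0. time_deriv (time_deriv u) x t - laplacian (\<lambda>y. u y t) x
         + u x t ^ 5 + u x t * \<bar>u x t\<bar> powr (p - 2) = 0) \<and>
      (\<forall>x. u x 0 = \<epsilon> * u\<^sub>0 x) \<and>
      (\<forall>x. time_deriv u x 0 = \<epsilon> * u\<^sub>1 x)"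
    proof (intro exI[of _ v] conjI allI impI)
      show "C_k_on 2 Slab (\<lambda>(x, t). v x t)" using u by (simp add: C2_iff_C_k_on v_def)
      show "v x 0 = \<epsilon> * u\<^sub>0 x" for x by (rule v0)
      show "time_deriv v x 0 = \<epsilon> * u\<^sub>1 x" for x using sol2[of x] w_init(2)[of x] by simp
      show "time_deriv (time_deriv v) x t - laplacian (\<lambda>y. v y t) x + v x t ^ 5 + v x t * \<bar>v x t\<bar> powr (p - 2) = 0" if t: "0 \<le> t" for x t
        using sol1[OF t, of x] k_eq[OF bound[OF t, of x]] by (simp add: v_def)
    qed
  qed
qed

end
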